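(* Let $m\in\mathbb{Z}_{\ge0}$ and $M\in\mathbb{Z}_{\ge1}$ be such that $\gcd(M,4m+2)=1$, and let $\epsilon,\epsilon'\in\{0,\frac12\}$. Then for $(j,k)\in\Omega^{[B;M;\epsilon']}$ the modified normalized (twisted) (super)characters of $\widehat{osp}_{3|2}$ satisfy: (1) $$\widetilde{ch}^{[B;M,m;\epsilon]}_{j,k;\epsilon'}\Big(-\frac1\tau,\frac{z_1}\tau,\frac{z_2}\tau,t-\frac{z_1z_2}\tau\Big)=\frac{i^{4\epsilon\epsilon'+2\epsilon-2\epsilon'}}{M}\sum_{(a,b)\in\Omega^{[B;M;\epsilon]}}e^{-\frac{\pi i(2m+1)}{M}(bj+ak)}\,\widetilde{ch}^{[B;M,m;\epsilon']}_{a,b;\epsilon}(\tau,z_1,z_2,t).$$ (2) $$\widetilde{ch}^{[B;M,m;\epsilon]}_{j,k;\epsilon'}(\tau+1,z_1,z_2,t)=(-1)^{4\epsilon\epsilon'}e^{\frac{\pi i(2m+1)}{M}jk+\pi i(j-\frac32\epsilon')}\,\widetilde{ch}^{[B;M,m;|\epsilon-\epsilon'|]}_{j,k;\epsilon'}(\tau,z_1,z_2,t).$$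
   Context: Variables: $\tau,z_1,z_2,t\in\mathbb{C}$, $\mathrm{Im}\,\tau>0$, $q^r=e^{2\pi i r\tau}$. All identities are identities of functions away from poles. For $m\in\mathbb{Z}_{\ge0}$ put $$\Phi_1^{[B;m]}(\tau,z_1,z_2,t)=e^{2\pi i(m+\frac12)t}\sum_{j\in\mathbb{Z}}(-1)^j\frac{e^{\pi ij(2m+1)(z_1+z_2)+\pi iz_1}q^{(m+\frac12)j^2+\frac j2}}{1-e^{2\pi iz_1}q^j},$$ $\Phi^{[B;m]}(\tau,z_1,z_2,t)=\Phi_1^{[B;m]}(\tau,z_1,z_2,t)-\Phi_1^{[B;m]}(\tau,z_2,z_1,t)$. For $j\in\frac12\mathbb{Z}$, $$\Theta^-_{j,m+\frac12}(\tau,z)=\sum_{n\in\mathbb{Z}}(-1)^ne^{2\pi i(m+\frac12)z(n+\frac{j}{2m+1})}q^{(m+\frac12)(n+\frac{j}{2m+1})^2}.$$ With $E(x)=2\int_0^xe^{-\pi u^2}du$ and $j\in\mathbb{Z}$, $$R^{[B]}_{j+\frac12,m+\frac12}(\tau,v)=\sum_{\substack{n\in\frac12+\mathbb{Z}\\ n\equiv j+\frac12\ \mathrm{mod}\ 2m+1}}(-1)^{n-(j+\frac12)}\Big\{\mathrm{sgn}(n)-E\Big(\big(n+(2m+1)\tfrac{\mathrm{Im}\,v}{\mathrm{Im}\,\tau}\big)\sqrt{\tfrac{\mathrm{Im}\,\tau}{m+\frac12}}\Big)\Big\}e^{-\frac{\pi in^2\tau}{2m+1}-2\pi inv}.$$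 $$\Phi^{[B;m]}_{\rm add}(\tau,z_1,z_2,t)=\tfrac12e^{2\pi i(m+\frac12)t}\sum_{j=0}^{2m}R^{[B]}_{j+\frac12,m+\frac12}\big(\tau,\tfrac{z_1-z_2}2\big)\big(\Theta^-_{j+\frac12,m+\frac12}+\Theta^-_{-(j+\frac12),m+\frac12}\big)(\tau,z_1+z_2),$$ and $\widetilde\Phi^{[B;m]}=\Phi^{[B;m]}+\Phi^{[B;m]}_{\rm add}$. For $\epsilon,\epsilon'\in\{0,\frac12\}$ and $a,b\in\epsilon'+\mathbb{Z}$ with $a-b\in2\mathbb{Z}$, $$\widetilde\Psi^{[B;M,m;\epsilon]}_{a,b;\epsilon'}(\tau,z_1,z_2,t)=q^{\frac{2m+1}{2M}ab}e^{\frac{2\pi i(2m+1)}{2M}(bz_1+az_2)}\,\widetilde\Phi^{[B;m]}\big(M\tau,z_1+a\tau+\epsilon,z_2+b\tau+\epsilon,\tfrac tM\big).$$ Index sets: $\Omega^{[B;M;\epsilon]}=\{(j,k)\in(\epsilon+\mathbb{Z})^2\mid -M\le j<M,\ 0\le k<M,\ j\equiv k\ \mathrm{mod}\ 2\}$. Jacobi theta functions ($a,b\in\{0,1\}$): $\vartheta_{ab}(\tau,z)=\sum_{n\in\mathbb{Z}}e^{\pi i\tau(n+\frac a2)^2+2\pi i(n+\frac a2)(z+\frac b2)}$; $\eta(\tau)=q^{1/24}\prod_{n\ge1}(1-q^n)$. The normalized (twisted) (super)denominators of $\widehat{osp}_{3|2}$ are $$\widehat R^{(\epsilon)}_{\epsilon'}(\tau,z_1,z_2,t)=c_{\epsilon,\epsilon'}\,e^{\pi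 it}\,\frac{\eta(\tau)^3\,\vartheta_{11}(\tau,z_1+z_2)\,\vartheta_{11}(\tau,\frac{z_1-z_2}2)}{\vartheta_{1-2\epsilon',1-2\epsilon}(\tau,z_1)\,\vartheta_{1-2\epsilon',1-2\epsilon}(\tau,z_2)\,\vartheta_{1-2\epsilon',1-2\epsilon}(\tau,\frac{z_1+z_2}2)},\quad c_{\epsilon,\epsilon'}=e^{\frac{\pi i}2(2(\epsilon-\epsilon')-4\epsilon\epsilon'-1)}.$$ The modified normalized untwisted ($\epsilon'=0$) and twisted ($\epsilon'=\frac12$) characters ($\epsilon=\frac12$) and supercharacters ($\epsilon=0$) are $$\widetilde{ch}^{[B;M,m;\epsilon]}_{j,k;\epsilon'}(\tau,z_1,z_2,t)=(-1)^{j-\epsilon'}\,\frac{\widetilde\Psi^{[B;M,m;\epsilon]}_{j,k;\epsilon'}(\tau,z_1,z_2,t)}{\widehat R^{(\epsilon)}_{\epsilon'}(\tau,z_1,z_2,t)},\qquad(j,k)\in\Omega^{[B;M;\epsilon']}.$$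
   Formalization: In (2) the factor e^{πi(j−(3/2)ε')} is replaced by e^{πi(j+(3/2)ε')}: for ε'=1/2 the printed formula is off by the factor −i (e.g. m=0, M=1, j=k=1/2); for ε'=0 the two agree. *)

theory Defs
  imports "HOL-Analysis.Analysis"
begin

text \<open>
  Conventions. The parameters \<open>eps\<close>, \<open>eps'\<close> and the indices \<open>a, b, j, k\<close>, which are integers or
  half-integers, are real numbers; integrality is imposed where they are introduced.
  Series over the integers or over a coset of them are unordered sums (\<^const>\<open>infsum\<close>);
  all of them converge absolutely for \<open>Im tau > 0\<close>.
  A power of \<open>-1\<close> or \<open>\<i>\<close> whose exponent \<open>x\<close> is real but integer-valued is written
  with \<open>powi \<lfloor>x\<rfloor>\<close>.
\<close>

definition qpow :: "complex \<Rightarrow> complex \<Rightarrow> complex" where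
  "qpow tau r = exp (2 * of_real pi * \<i> * r * tau)"

definition Phi1_B :: "nat \<Rightarrow> complex \<Rightarrow> complex \<Rightarrow> complex \<Rightarrow> complex \<Rightarrow> complex" where
  "Phi1_B m tau z1 z2 t =
     exp (2 * of_real pi * \<i> * (of_nat m + 1/2) * t) *
     (\<Sum>\<^sub>\<infinity>j::int. (-1) powi j *
        (exp (of_real pi * \<i> * of_int j * (2 * of_nat m + 1) * (z1 + z2) + of_real pi * \<i> * z1)
           * qpow tau ((of_nat m + 1/2) * (of_int j)\<^sup>2 + of_int j / 2))
        / (1 - exp (2 * of_real pi * \<i> * z1) * qpow tau (of_int j)))"

definition Phi_B :: "nat \<Rightarrow> complex \<Rightarrow> complex \<Rightarrow> complex \<Rightarrow> complex \<Rightarrow> complex" where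
  "Phi_B m tau z1 z2 t = Phi1_B m tau z1 z2 t - Phi1_B m tau z2 z1 t"

text \<open>\<open>Theta_minus m j\<close> is \<open>\<Theta>\<close> with superscript \<open>-\<close>, index \<open>j\<close> and degree \<open>m + 1/2\<close>.\<close>

definition Theta_minus :: "nat \<Rightarrow> real \<Rightarrow> complex \<Rightarrow> complex \<Rightarrow> complex" where
  "Theta_minus m j tau z =
     (\<Sum>\<^sub>\<infinity>n::int. (-1) powi n *
        exp (2 * of_real pi * \<i> * (of_nat m + 1/2) * z
               * (of_int n + of_real j / (2 * of_nat m + 1)))
        * qpow tau ((of_nat m + 1/2) * (of_int n + of_real j / (2 * of_nat m + 1))\<^sup>2))"

text \<open>The interval integral is oriented, so \<open>E_fun\<close> is odd.\<close>

definition E_fun :: "real \<Rightarrow> real" where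
  "E_fun x = 2 * (LBINT u=ereal 0..ereal x. exp (- pi * u\<^sup>2))"

text \<open>\<open>R_B m j\<close> has the half-integral index \<open>j + 1/2\<close>.\<close>

definition R_B :: "nat \<Rightarrow> int \<Rightarrow> complex \<Rightarrow> complex \<Rightarrow> complex" where
  "R_B m j tau v =
     (\<Sum>\<^sub>\<infinity>n\<in>{n::real. n - 1/2 \<in> \<int> \<and>
                  (\<exists>l::int. n - (of_int j + 1/2) = of_int l * (2 * of_nat m + 1))}.
        (-1) powi \<lfloor>n - (of_int j + 1/2)\<rfloor> *
        of_real (sgn n - E_fun ((n + (2 * of_nat m + 1) * (Im v / Im tau))
                                  * sqrt (Im tau / (of_nat m + 1/2)))) *
        exp (- (of_real pi * \<i> * (of_real n)\<^sup>2 * tau / (2 * of_nat m + 1))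
             - 2 * of_real pi * \<i> * of_real n * v))"

definition Phi_add_B :: "nat \<Rightarrow> complex \<Rightarrow> complex \<Rightarrow> complex \<Rightarrow> complex \<Rightarrow> complex" where
  "Phi_add_B m tau z1 z2 t =
     1/2 * exp (2 * of_real pi * \<i> * (of_nat m + 1/2) * t) *
     (\<Sum>j\<in>{0..2 * int m}. R_B m j tau ((z1 - z2) / 2) *
        (Theta_minus m (of_int j + 1/2) tau (z1 + z2)
           + Theta_minus m (- (of_int j + 1/2)) tau (z1 + z2)))"

definition Phi_tilde_B :: "nat \<Rightarrow> complex \<Rightarrow> complex \<Rightarrow> complex \<Rightarrow> complex \<Rightarrow> complex" where
  "Phi_tilde_B m tau z1 z2 t = Phi_B m tau z1 z2 t + Phi_add_B m tau z1 z2 t"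

text \<open>
  In \<open>Psi_tilde_B M m eps a b eps'\<close> the indices are meant to satisfy \<open>a, b \<in> eps' + \<int>\<close> and
  \<open>a - b \<in> 2\<int>\<close>. The formula itself does not involve \<open>eps'\<close>, which is kept as an argument to
  match the notation.
\<close>

definition Psi_tilde_B ::
  "nat \<Rightarrow> nat \<Rightarrow> real \<Rightarrow> real \<Rightarrow> real \<Rightarrow> real \<Rightarrow> complex \<Rightarrow> complex \<Rightarrow> complex \<Rightarrow> complex \<Rightarrow> complex"
where
  "Psi_tilde_B M m eps a b eps' tau z1 z2 t =
     qpow tau ((2 * of_nat m + 1) / (2 * of_nat M) * of_real a * of_real b) *
     exp (2 * of_real pi * \<i> * (2 * of_nat m + 1) / (2 * of_nat M)
            * (of_real b * z1 + of_real a * z2)) *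
     Phi_tilde_B m (of_nat M * tau)
       (z1 + of_real a * tau + of_real eps) (z2 + of_real b * tau + of_real eps) (t / of_nat M)"

definition Omega_B :: "nat \<Rightarrow> real \<Rightarrow> (real \<times> real) set" where
  "Omega_B M eps = {(j, k). j - eps \<in> \<int> \<and> k - eps \<in> \<int> \<and>
      - real M \<le> j \<and> j < real M \<and> 0 \<le> k \<and> k < real M \<and> (\<exists>n::int. j - k = 2 * of_int n)}"

text \<open>The characteristics \<open>a, b\<close> of \<open>jacobi_theta\<close> take the values 0 and 1 only.\<close>

definition jacobi_theta :: "real \<Rightarrow> real \<Rightarrow> complex \<Rightarrow> complex \<Rightarrow> complex" where
  "jacobi_theta a b tau z =
     (\<Sum>\<^sub>\<infinity>n::int. exp (of_real pi * \<i> * tau * (of_int n + of_real a / 2)\<^sup>2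
        + 2 * of_real pi * \<i> * (of_int n + of_real a / 2) * (z + of_real b / 2)))"

definition dedekind_eta :: "complex \<Rightarrow> complex" where
  "dedekind_eta tau = qpow tau (1/24) * (\<Prod>n. 1 - qpow tau (of_nat (Suc n)))"

definition c_osp :: "real \<Rightarrow> real \<Rightarrow> complex" where
  "c_osp eps eps' = exp (of_real pi * \<i> / 2 * of_real (2 * (eps - eps') - 4 * eps * eps' - 1))"

definition R_hat :: "real \<Rightarrow> real \<Rightarrow> complex \<Rightarrow> complex \<Rightarrow> complex \<Rightarrow> complex \<Rightarrow> complex" where
  "R_hat eps eps' tau z1 z2 t =
     c_osp eps eps' * exp (of_real pi * \<i> * t) *
     (dedekind_eta tau ^ 3 * jacobi_theta 1 1 tau (z1 + z2) * jacobi_theta 1 1 tau ((z1 - z2) / 2))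
     / (jacobi_theta (1 - 2 * eps') (1 - 2 * eps) tau z1
        * jacobi_theta (1 - 2 * eps') (1 - 2 * eps) tau z2
        * jacobi_theta (1 - 2 * eps') (1 - 2 * eps) tau ((z1 + z2) / 2))"

text \<open>
  The points at which the quotient defining the characters makes sense: none of the theta functions
  in \<open>R_hat eps eps'\<close> vanishes, so that it is finite and nonzero.
  The zeros of \<open>jacobi_theta (1 - 2 * eps') (1 - 2 * eps) tau\<close> are the points of
  \<open>eps + eps' * tau + \<int> + \<int> * tau\<close>. Hence, for indices in \<open>eps' + \<int>\<close>, the denominators in the series
  \<open>Phi1_B\<close> occurring in \<open>Psi_tilde_B M m eps\<close> do not vanish at these points either.
\<close>

definition regular_point :: "real \<Rightarrow> real \<Rightarrow> complex \<Rightarrow> complex \<Rightarrow> complex \<Rightarrow> bool" where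
  "regular_point eps eps' tau z1 z2 \<longleftrightarrow>
     jacobi_theta 1 1 tau (z1 + z2) \<noteq> 0 \<and>
     jacobi_theta 1 1 tau ((z1 - z2) / 2) \<noteq> 0 \<and>
     jacobi_theta (1 - 2 * eps') (1 - 2 * eps) tau z1 \<noteq> 0 \<and>
     jacobi_theta (1 - 2 * eps') (1 - 2 * eps) tau z2 \<noteq> 0 \<and>
     jacobi_theta (1 - 2 * eps') (1 - 2 * eps) tau ((z1 + z2) / 2) \<noteq> 0"

text \<open>
  The translation \<open>tau \<mapsto> tau + 1\<close> for \<open>eps' = 1/2\<close>: \<open>R_hat\<close> acquires the factor
  \<open>exp (3 * pi * \<i> / 4)\<close> from \<open>\<eta>^3\<close> and the two functions \<open>\<vartheta>\<close> with characteristics 1, 1;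
  \<open>Phi_tilde_B\<close> acquires \<open>(-1) powi \<lfloor>j - 1/2 + 2 * eps\<rfloor>\<close> from the shift of its arguments by
  integers. Thus the multiplier of \<open>ch_tilde_B\<close> is
  \<open>(-1)^(4 eps eps') * exp (pi * \<i> * (2 * m + 1) / M * j * k + pi * \<i> * (j + 3/2 * eps'))\<close>.
  The source prints \<open>j - 3/2 * eps'\<close> in place of \<open>j + 3/2 * eps'\<close>; for \<open>eps' = 1/2\<close> this is off by
  the factor \<open>-\<i>\<close>.
\<close>

definition ch_tilde_B ::
  "nat \<Rightarrow> nat \<Rightarrow> real \<Rightarrow> real \<Rightarrow> real \<Rightarrow> real \<Rightarrow> complex \<Rightarrow> complex \<Rightarrow> complex \<Rightarrow> complex \<Rightarrow> complex"
where
  "ch_tilde_B M m eps j k eps' tau z1 z2 t =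
     (-1) powi \<lfloor>j - eps'\<rfloor> *
     (Psi_tilde_B M m eps j k eps' tau z1 z2 t / R_hat eps eps' tau z1 z2 t)"

end

theory Submission
  imports Defs "HOL-Complex_Analysis.Complex_Analysis" "HOL-Probability.Distributions" "HOL-Real_Asymp.Real_Asymp"
begin

text \<open>
  Write \<open>N = 2m + 1\<close>, \<open>y = Im \<tau>\<close> and, for a pair \<open>(j, n)\<close> of integers, \<open>\<zeta> = z1 + j \<tau> + n\<close>. The proof rests
  on a formula for the modified function in which its modularity is visible: away from the poles,
  \<open>Phi_tilde_B m \<tau> z1 z2 t = exp (pi \<i> N t) \<i>/(2 pi) (L z1 z2 - L z2 z1)\<close>, where \<open>L z1 z2\<close> is the absolutely
  convergent lattice sum (\<open>kron_sum\<close>) of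
  \<open>(-1)^(j + n + j n) exp (pi \<i> N j z2 - pi N/(2 y) \<zeta> (cnj \<zeta> + 2 \<i> Im z2)) / \<zeta>\<close>.
  Under \<open>\<tau> \<mapsto> - 1/\<tau>\<close>, \<open>\<tau> \<mapsto> \<tau> + 1\<close> and translations of the arguments the terms of this sum are only permuted
  and multiplied by a common factor (\<open>kron_sum_S\<close>, \<open>kron_sum_T\<close>, \<open>kron_sum_shift\<close>).

  To identify the lattice sum with the definition (\<open>Phi_tilde_B_eq_kron_sum\<close>) one sums over \<open>n\<close> first.
  By \<open>appell_expansion\<close>, a sum of a Gaussian over the simple fractions \<open>1/(Z + n)\<close> is \<open>pi/sin (pi Z)\<close>,
  which yields the Appell series, plus a series of error functions, which yields the products of \<open>R_B\<close>
  and \<open>Theta_minus\<close>. That expansion follows from Poisson summation after differentiating in an auxiliary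
  parameter, and Poisson summation for Gaussians is the inversion formula \<open>theta_inversion\<close>.

  At level \<open>M\<close>, inversion turns \<open>M \<tau>\<close> into \<open>\<tau>/M\<close>, and both kernels have the same Gaussian when the arguments
  are rescaled. In the half of \<open>Psi_tilde_B\<close> with index \<open>(a, b)\<close> that has its poles in \<open>z1\<close>, the number \<open>b\<close>
  occurs only in a character of the lattice. Summing this character over \<open>b\<close> against the phases of the
  transformation matrix is a projection, because \<open>N\<close> is prime to \<open>M\<close>, and produces the sublattice that
  belongs to \<open>\<tau>/M\<close> (\<open>sum_weighted_sum_coset\<close>). The parity condition \<open>a \<equiv> b\<close> modulo 2 and the oddness of \<open>M\<close>
  make the summand periodic, so that the two halves can be treated alike (\<open>weighted_sum_shift\<close>).

  The denominators transform by the inversion formula applied to the Jacobi theta functions and, through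
  Euler's pentagonal number theorem, to the eta function (\<open>R_hat_S\<close>). Where the theta functions in
  them are nonzero, no argument of the lattice sums is a lattice point, because at lattice points the
  theta functions vanish (\<open>jacobi_theta_eq_0\<close>).
\<close>

section \<open>Unordered sums and Gaussian series\<close>

text \<open>
  Tannery's theorem for unordered sums along an arbitrary filter: by the Weierstrass test the finite
  partial sums converge uniformly, so the two limits may be exchanged.
\<close>

lemma tendsto_infsum_dominated:
  fixes f :: "'a \<Rightarrow> 'b \<Rightarrow> 'c::banach"
  assumes lim: "\<And>k. k \<in> A \<Longrightarrow> (f k \<longlongrightarrow> g k) F"
    and bd: "eventually (\<lambda>x. \<forall>k\<in>A. norm (f k x) \<le> h k) F"
    and sm: "h summable_on A"
  shows "((\<lambda>x. \<Sum>\<^sub>\<infinity>k\<in>A. f k x) \<longlongrightarrow> (\<Sum>\<^sub>\<infinity>k\<in>A. g k)) F"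
proof (cases "F = bot")
  case False
  define Y where "Y = {x. \<forall>k\<in>A. norm (f k x) \<le> h k}"
  have gb: "norm (g k) \<le> h k" if "k \<in> A" for k
    using tendsto_upperbound[OF tendsto_norm[OF lim[OF that]] eventually_mono[OF bd] False] that
    by blast
  have ul: "uniform_limit Y (\<lambda>X y. \<Sum>x\<in>X. f x y) (\<lambda>y. \<Sum>\<^sub>\<infinity>x\<in>A. f x y) (finite_subsets_at_top A)"
    by (rule Weierstrass_m_test_general[OF _ sm]) (auto simp: Y_def)
  have gs: "(g has_sum (\<Sum>\<^sub>\<infinity>k\<in>A. g k)) A"
    by (rule has_sum_infsum, rule abs_summable_summable, rule Infinite_Sum.abs_summable_on_comparison_test'[OF sm gb])
  show ?thesis
  proof (rule swap_uniform_limit'[where S = Y and F = "finite_subsets_at_top A" and f =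
      "\<lambda>X y. \<Sum>x\<in>X. f x y" and g = "\<lambda>X. \<Sum>x\<in>X. g x"])
    show "\<forall>\<^sub>F X in finite_subsets_at_top A. ((\<lambda>y. \<Sum>x\<in>X. f x y) \<longlongrightarrow> (\<Sum>x\<in>X. g x)) F"
      by (rule eventually_finite_subsets_at_top_weakI) (auto intro!: tendsto_sum lim)
    show "((\<lambda>X. \<Sum>x\<in>X. g x) \<longlongrightarrow> (\<Sum>\<^sub>\<infinity>k\<in>A. g k)) (finite_subsets_at_top A)"
      using gs by (simp add: has_sum_def)
    show "\<forall>\<^sub>F x in F. x \<in> Y" using bd by (simp add: Y_def)
  qed (use ul in auto)
qed auto

lemma has_integral_infsum:
  fixes f :: "'a \<Rightarrow> real \<Rightarrow> 'c::banach"
  assumes c: "\<And>k. k \<in> A \<Longrightarrow> continuous_on {a..b} (f k)"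
    and bd: "\<And>k x. k \<in> A \<Longrightarrow> x \<in> {a..b} \<Longrightarrow> norm (f k x) \<le> h k"
    and sm: "h summable_on A"
  shows "((\<lambda>k. integral {a..b} (f k)) has_sum integral {a..b} (\<lambda>x. \<Sum>\<^sub>\<infinity>k\<in>A. f k x)) A"
    and "continuous_on {a..b} (\<lambda>x. \<Sum>\<^sub>\<infinity>k\<in>A. f k x)"
proof -
  define f' where "f' k = (if k \<in> A then f k else (\<lambda>_. 0))" for k
  have c': "continuous_on {a..b} (f' k)" for k using c by (auto simp: f'_def)
  have ul: "uniform_limit {a..b} (\<lambda>X y. \<Sum>x\<in>X. f x y) (\<lambda>y. \<Sum>\<^sub>\<infinity>x\<in>A. f x y) (finite_subsets_at_top A)"
    by (rule Weierstrass_m_test_general[OF _ sm]) (auto simp: bd)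
  have ul': "uniform_limit {a..b} (\<lambda>X y. \<Sum>x\<in>X. f' x y) (\<lambda>y. \<Sum>\<^sub>\<infinity>x\<in>A. f x y) (finite_subsets_at_top A)"
    by (rule uniform_limit_cong[THEN iffD1, OF _ _ ul], rule eventually_finite_subsets_at_top_weakI)
       (auto simp: f'_def subset_iff intro!: sum.cong)
  obtain I J where I: "\<And>X. ((\<lambda>y. \<Sum>x\<in>X. f' x y) has_integral I X) {a..b}"
    and J: "((\<lambda>y. \<Sum>\<^sub>\<infinity>x\<in>A. f x y) has_integral J) {a..b}"
    and IJ: "(I \<longlongrightarrow> J) (finite_subsets_at_top A)"
    by (rule uniform_limit_integral[OF ul']) (auto intro!: continuous_on_sum c')
  have IX: "I X = (\<Sum>x\<in>X. integral {a..b} (f x))" if "finite X" "X \<subseteq> A" for X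
  proof -
    have "((\<lambda>y. \<Sum>x\<in>X. f' x y) has_integral (\<Sum>x\<in>X. integral {a..b} (f' x))) {a..b}"
      by (intro has_integral_sum that integrable_integral integrable_continuous_real c')
    with I[of X] have "I X = (\<Sum>x\<in>X. integral {a..b} (f' x))" by (rule has_integral_unique)
    also have "\<dots> = (\<Sum>x\<in>X. integral {a..b} (f x))"
      by (rule sum.cong) (use that in \<open>auto simp: f'_def\<close>)
    finally show ?thesis .
  qed
  have "((\<lambda>X. \<Sum>x\<in>X. integral {a..b} (f x)) \<longlongrightarrow> J) (finite_subsets_at_top A)"
    by (rule Lim_transform_eventually[OF IJ], rule eventually_finite_subsets_at_top_weakI) (rule IX)
  with J show "((\<lambda>k. integral {a..b} (f k)) has_sum integral {a..b} (\<lambda>x. \<Sum>\<^sub>\<infinity>k\<in>A. f k x)) A"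
    by (simp add: has_sum_def integral_unique)
  show "continuous_on {a..b} (\<lambda>x. \<Sum>\<^sub>\<infinity>k\<in>A. f k x)"
    by (rule uniform_limit_theorem[OF _ ul'])
       (auto intro!: always_eventually continuous_on_sum c')
qed

text \<open>
  Termwise integration of the derivatives, dominated on the interval, in place of the derivative of
  a series.
\<close>

lemma infsum_increment:
  fixes f f' :: "'a \<Rightarrow> real \<Rightarrow> complex"
  assumes ab: "a \<le> b"
    and d: "\<And>k t. (f k has_vector_derivative f' k t) (at t)"
    and c: "\<And>k. continuous_on {a..b} (f' k)"
    and bd: "\<And>k t. t \<in> {a..b} \<Longrightarrow> norm (f' k t) \<le> h k" and h: "h summable_on UNIV"
    and sa: "(\<lambda>k. f k a) summable_on UNIV" and sb: "(\<lambda>k. f k b) summable_on UNIV"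
  shows "(\<Sum>\<^sub>\<infinity>k. f k b) - (\<Sum>\<^sub>\<infinity>k. f k a) = integral {a..b} (\<lambda>t. \<Sum>\<^sub>\<infinity>k. f' k t)"
proof -
  have "integral {a..b} (f' k) = f k b - f k a" for k
    by (intro integral_unique fundamental_theorem_of_calculus ab has_vector_derivative_at_within[OF d])
  with has_integral_infsum(1)[of UNIV a b f' h] c bd h
  have "((\<lambda>k. f k b - f k a) has_sum integral {a..b} (\<lambda>t. \<Sum>\<^sub>\<infinity>k. f' k t)) UNIV" by simp
  moreover have "((\<lambda>k. f k b - f k a) has_sum ((\<Sum>\<^sub>\<infinity>k. f k b) - (\<Sum>\<^sub>\<infinity>k. f k a))) UNIV"
    using has_sum_add[OF has_sum_infsum[OF sb] has_sum_uminusI[OF has_sum_infsum[OF sa]]] by simp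
  ultimately show ?thesis using has_sum_unique by blast
qed

lemma holomorphic_on_infsum:
  fixes f :: "'a \<Rightarrow> complex \<Rightarrow> complex"
  assumes S: "open S" and hol: "\<And>k. k \<in> A \<Longrightarrow> f k holomorphic_on S"
    and bd: "\<And>z. z \<in> S \<Longrightarrow> \<exists>r>0. \<exists>h. cball z r \<subseteq> S \<and> h summable_on A \<and> (\<forall>k\<in>A. \<forall>w\<in>cball z r. norm (f k w) \<le> h k)"
  shows "(\<lambda>z. \<Sum>\<^sub>\<infinity>k\<in>A. f k z) holomorphic_on S"
proof -
  have "\<exists>r>0. (\<lambda>z. \<Sum>\<^sub>\<infinity>k\<in>A. f k z) holomorphic_on ball z r" if z: "z \<in> S" for z
  proof -
    obtain r h where r: "r > 0" "cball z r \<subseteq> S" and h: "h summable_on A"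
      "\<forall>k\<in>A. \<forall>w\<in>cball z r. norm (f k w) \<le> h k" using bd[OF z] by blast
    have ul: "uniform_limit (cball z r) (\<lambda>X y. \<Sum>x\<in>X. f x y) (\<lambda>y. \<Sum>\<^sub>\<infinity>x\<in>A. f x y) (finite_subsets_at_top A)"
      by (rule Weierstrass_m_test_general[OF _ h(1)]) (use h in auto)
    have hX: "(\<lambda>y. \<Sum>x\<in>X. f x y) holomorphic_on S" if "X \<subseteq> A" for X
      by (intro holomorphic_on_sum hol) (use that in auto)
    have "\<forall>\<^sub>F X in finite_subsets_at_top A. continuous_on (cball z r) (\<lambda>y. \<Sum>x\<in>X. f x y) \<and>
             (\<lambda>y. \<Sum>x\<in>X. f x y) holomorphic_on ball z r"
      by (rule eventually_finite_subsets_at_top_weakI)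
         (use hX holomorphic_on_subset[OF hX r(2)] holomorphic_on_subset[OF hX order_trans[OF ball_subset_cball r(2)]]
           holomorphic_on_imp_continuous_on in blast)
    from holomorphic_uniform_limit[OF this ul] show ?thesis using r by auto
  qed
  then show ?thesis
    using S by (metis (no_types, lifting) analytic_imp_holomorphic analytic_on_def)
qed

lemma summable_on_exp_neg_abs_mult: 
  assumes b: "b > 0"
  shows "(\<lambda>n::int. exp (- b * \<bar>real_of_int n\<bar>)) summable_on UNIV"
proof -
  have g: "summable (\<lambda>n::nat. exp (-b) ^ n)" by (rule summable_geometric) (use b in auto)
  have e: "exp (-b) ^ n = exp (- b * real n)" for n :: nat
    by (subst exp_of_nat_mult[symmetric]) (simp add: mult_ac)
  have nat: "(\<lambda>n::nat. exp (- b * real n)) summable_on UNIV"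
    by (rule norm_summable_imp_summable_on) (use g e in simp)
  have 1: "(\<lambda>n::int. exp (- b * \<bar>real_of_int n\<bar>)) summable_on {0..}"
    by (rule summable_on_reindex_bij_witness[where i = int and j = nat, THEN iffD2, OF _ _ _ _ _ nat]) auto
  have 2: "(\<lambda>n::int. exp (- b * \<bar>real_of_int n\<bar>)) summable_on {..0}"
    by (rule summable_on_reindex_bij_witness[where i = "\<lambda>n. - int n" and j =
        "\<lambda>n. nat (- n)", THEN iffD2, OF _ _ _ _ _ nat]) auto
  have "UNIV = {0..} \<union> {..0::int}" by auto
  then show ?thesis using summable_on_union[OF 1 2] by simp
qed

text \<open>
  Completing the square leaves \<open>-\<bar>n\<bar>\<close> and a constant in the exponent.
\<close>

lemma summable_on_gauss:
  fixes a b :: real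
  assumes "a > 0"
  shows "(\<lambda>n::int. exp (- a * (of_int n)\<^sup>2 + b * \<bar>of_int n\<bar>)) summable_on UNIV"
proof -
  have le: "- a * x\<^sup>2 + b * \<bar>x\<bar> \<le> (b+1)\<^sup>2 / (4*a) - \<bar>x\<bar>" for x :: real
  proof -
    have "0 \<le> (2 * a * \<bar>x\<bar> - (b+1))\<^sup>2" by simp
    then have "4 * a * ((b+1) * \<bar>x\<bar> - a * x\<^sup>2) \<le> (b+1)\<^sup>2"
      by (simp add: power2_eq_square algebra_simps flip: abs_mult)
    then have "(b+1) * \<bar>x\<bar> - a * x\<^sup>2 \<le> (b+1)\<^sup>2 / (4*a)"
      using assms by (simp add: field_simps)
    then show ?thesis by (simp add: algebra_simps)
  qed
  have "(\<lambda>n::int. exp ((b+1)\<^sup>2 / (4*a)) * exp (- 1 * \<bar>real_of_int n\<bar>)) summable_on UNIV"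
    by (intro summable_on_cmult_right summable_on_exp_neg_abs_mult) simp
  then show ?thesis
    by (rule summable_on_comparison_test) (use le in \<open>auto simp: mult_exp_exp\<close>)
qed

lemma summable_on_gauss_affine:
  fixes a b d :: real
  assumes "a > 0"
  shows "(\<lambda>n::int. exp (- a * (of_int n)\<^sup>2 + b * of_int n + d)) summable_on UNIV"
proof (rule summable_on_comparison_test[OF summable_on_cmult_right[OF summable_on_gauss[OF assms, of "\<bar>b\<bar>"], of
    "exp d"]])
  fix n :: int
  have "b * of_int n \<le> \<bar>b\<bar> * \<bar>of_int n\<bar>" by (metis abs_ge_self abs_mult)
  then show "exp (- a * (of_int n)\<^sup>2 + b * of_int n + d) \<le> exp d * exp (- a * (of_int n)\<^sup>2 + \<bar>b\<bar> * \<bar>of_int n\<bar>)"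
    by (simp add: mult_exp_exp)
qed auto

lemma summable_on_gauss_product:
  fixes a b a' b' d :: real
  assumes "a > 0" "a' > 0"
  shows "(\<lambda>(j::int, n::int). exp (- a * (of_int j)\<^sup>2 - a' * (of_int n)\<^sup>2 + b * of_int j + b' * of_int n +
      d)) summable_on UNIV"
proof -
  have "(\<lambda>(j::int, n::int). exp (- a * (of_int j)\<^sup>2 + b * of_int j + d) * exp (- a' * (of_int n)\<^sup>2 + b' *
      of_int n + 0)) summable_on Sigma UNIV (\<lambda>_. UNIV)"
  proof (rule summable_on_SigmaI)
    have s: "(\<lambda>n::int. exp (- a' * (of_int n)\<^sup>2 + b' * of_int n + 0)) summable_on UNIV"
      by (rule summable_on_gauss_affine[OF assms(2)])
    show "((\<lambda>n. case (j, n) of (j::int, n::int) \<Rightarrow> exp (- a * (of_int j)\<^sup>2 + b * of_int j + d) * exp (- a' *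
        (of_int n)\<^sup>2 + b' * of_int n + 0)) has_sum
        exp (- a * (of_int j)\<^sup>2 + b * of_int j + d) * (\<Sum>\<^sub>\<infinity>n::int. exp (- a' * (of_int n)\<^sup>2 + b' * of_int n +
            0))) UNIV" for j :: int
      using has_sum_cmult_right[OF has_sum_infsum[OF s]] by simp
    show "(\<lambda>j::int. exp (- a * (of_int j)\<^sup>2 + b * of_int j + d) * (\<Sum>\<^sub>\<infinity>n::int. exp (- a' * (of_int n)\<^sup>2 + b' *
        of_int n + 0))) summable_on UNIV"
      by (intro summable_on_cmult_left summable_on_gauss_affine assms)
  qed auto
  then show ?thesis by (simp add: mult_exp_exp case_prod_unfold algebra_simps)
qed

text \<open>
  A majorant that depends on \<open>w\<close> only through a bound for its norm, hence uniform on discs.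
\<close>

lemma norm_exp_complex_sq_le:
  fixes w :: complex
  assumes "norm w \<le> R" "a > 0"
  shows "norm (exp (- of_real a * (w + of_int n)\<^sup>2)) \<le> exp (a * R\<^sup>2) * exp (- a * (of_int n)\<^sup>2 + 2 * a * R *
      \<bar>of_int n\<bar>)"
proof -
  have R: "R \<ge> 0" using assms norm_ge_zero order_trans by blast
  have 1: "(Im w)\<^sup>2 \<le> R\<^sup>2"
    using abs_Im_le_cmod[of w] assms R by (subst abs_le_square_iff[symmetric]) auto
  have 2: "- (2 * (Re w * of_int n)) \<le> 2 * (R * \<bar>of_int n\<bar>)"
  proof -
    have "- (Re w * of_int n) \<le> \<bar>Re w\<bar> * \<bar>of_int n\<bar>" by (metis abs_ge_minus_self abs_mult)
    also have "\<dots> \<le> R * \<bar>of_int n\<bar>" using abs_Re_le_cmod[of w] assms by (intro mult_right_mono) auto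
    finally show ?thesis by simp
  qed
  have "Re (- of_real a * (w + of_int n)\<^sup>2) = a * ((Im w)\<^sup>2 - (Re w)\<^sup>2 - (of_int n)\<^sup>2 - 2 * (Re w * of_int n))"
    by (simp add: power2_eq_square algebra_simps)
  also have "\<dots> \<le> a * (R\<^sup>2 - (of_int n)\<^sup>2 + 2 * (R * \<bar>of_int n\<bar>))"
    using assms 1 2 zero_le_power2[of "Re w"] by (intro mult_left_mono) linarith+
  finally show ?thesis
    by (simp add: mult_exp_exp algebra_simps)
qed

lemma summable_on_gauss_complex:
  fixes \<tau> z :: complex
  assumes "Im \<tau> > 0"
  shows "(\<lambda>n::int. norm (exp (of_real pi * \<i> * (of_int n)\<^sup>2 * \<tau> + 2 * of_real pi * \<i> * of_int n *
      z))) summable_on UNIV"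
proof (rule summable_on_comparison_test[OF summable_on_gauss[of "pi * Im \<tau>" "2 * pi * \<bar>Im z\<bar>"]])
  fix n :: int
  have "- (of_int n * Im z) \<le> \<bar>of_int n\<bar> * \<bar>Im z\<bar>" by (metis abs_ge_minus_self abs_mult)
  then have "2 * pi * - (of_int n * Im z) \<le> 2 * pi * (\<bar>of_int n\<bar> * \<bar>Im z\<bar>)"
    by (intro mult_left_mono) auto
  moreover have "Re ((of_int n)\<^sup>2 * \<i>) = 0" by (simp flip: of_int_power)
  ultimately show "norm (exp (of_real pi * \<i> * (of_int n)\<^sup>2 * \<tau> + 2 * of_real pi * \<i> * of_int n * z)) \<le>
      exp (- (pi * Im \<tau>) * (of_int n)\<^sup>2 + 2 * pi * \<bar>Im z\<bar> * \<bar>of_int n\<bar>)"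
    by (simp add: algebra_simps flip: of_int_power)
qed (use assms in auto)

lemma has_sum_int_tendsto:
  fixes f :: "int \<Rightarrow> 'a::{comm_monoid_add,topological_space}"
  assumes "(f has_sum S) UNIV"
  shows "(\<lambda>K::nat. \<Sum>n\<in>{- int K..int K}. f n) \<longlonglongrightarrow> S"
proof -
  have "filterlim (\<lambda>K::nat. {- int K..int K}) (finite_subsets_at_top UNIV) sequentially"
    unfolding filterlim_finite_subsets_at_top
  proof (intro allI impI)
    fix X :: "int set" assume "finite X \<and> X \<subseteq> UNIV"
    then have fin: "finite (abs ` X)" by auto
    define B where "B = nat (Max (insert 0 (abs ` X)))"
    have "\<bar>x\<bar> \<le> int B" if "x \<in> X" for x
    proof -
      have "\<bar>x\<bar> \<le> Max (insert 0 (abs ` X))" using fin that by (intro Max_ge) auto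
      moreover have "0 \<le> Max (insert 0 (abs ` X))" using fin by (intro Max_ge) auto
      ultimately show ?thesis by (simp add: B_def)
    qed
    then have "finite {- int K..int K} \<and> X \<subseteq> {- int K..int K} \<and> {- int K..int K} \<subseteq> UNIV" if "K \<ge> B" for K
      using that by force
    then show "\<forall>\<^sub>F K in sequentially. finite {- int K..int K} \<and> X \<subseteq> {- int K..int K} \<and> {- int K..int K} \<subseteq> UNIV"
      using eventually_sequentially by auto
  qed
  with assms show ?thesis unfolding has_sum_def by (rule filterlim_compose)
qed

lemma sum_int_telescope:
  fixes g :: "int \<Rightarrow> 'a::ab_group_add"
  shows "(\<Sum>n\<in>{- int K..int K}. g (n + 1) - g n) = g (int K + 1) - g (- int K)"
proof (induction K)
  case (Suc K)
  have "{- int (Suc K)..int (Suc K)} = insert (- int K - 1) (insert (int K + 1) {- int K..int K})"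
    by auto
  then have "(\<Sum>n\<in>{- int (Suc K)..int (Suc K)}. g (n + 1) - g n) = 
      (g (- int K - 1 + 1) - g (- int K - 1)) + ((g (int K + 1 + 1) - g (int K + 1)) + (g (int K + 1) - g (- int K)))"
    by (simp add: Suc)
  also have "- int K - 1 = - int (Suc K)" by simp
  also have "int K + 1 = int (Suc K)" by simp
  finally show ?case by simp
qed auto

lemma infsum_int_residues:
  fixes f :: "int \<Rightarrow> 'a::banach"
  assumes N: "N > 0" and f: "f summable_on UNIV"
  shows "(\<Sum>\<^sub>\<infinity>n. f n) = (\<Sum>r\<in>{0..<N}. \<Sum>\<^sub>\<infinity>l. f (r + N * l))"
proof -
  have bij: "bij_betw (\<lambda>(r, l). r + N * l) ({0..<N} \<times> UNIV) UNIV"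
    by (rule bij_betwI[where g = "\<lambda>n. (n mod N, n div N)"]) (use N in auto)
  have "(\<lambda>x. f (case x of (r, l) \<Rightarrow> r + N * l)) summable_on ({0..<N} \<times> UNIV)"
    using summable_on_reindex_bij_betw[OF bij, of f] f by simp
  then have "(\<Sum>\<^sub>\<infinity>r\<in>{0..<N}. \<Sum>\<^sub>\<infinity>l. f (r + N * l)) = (\<Sum>\<^sub>\<infinity>x\<in>{0..<N} \<times> UNIV. f (case x of (r, l) \<Rightarrow> r + N * l))"
    by (subst infsum_Sigma_banach[symmetric]) auto
  also have "\<dots> = (\<Sum>\<^sub>\<infinity>n. f n)"
    by (rule infsum_reindex_bij_betw[OF bij])
  finally show ?thesis by simp
qed

lemma has_sum_sum:
  fixes f :: "'b \<Rightarrow> 'a \<Rightarrow> 'c::topological_comm_monoid_add"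
  assumes "finite B" and "\<And>b. b \<in> B \<Longrightarrow> (f b has_sum S b) A"
  shows "((\<lambda>x. \<Sum>b\<in>B. f b x) has_sum (\<Sum>b\<in>B. S b)) A"
  using assms by (induction B rule: finite_induct) (auto intro!: has_sum_add)

lemma infsum_int_pair_residues:
  fixes f :: "int \<Rightarrow> 'b \<Rightarrow> 'a::banach"
  assumes N: "N > 0" and f: "(\<lambda>(j, n). f j n) summable_on UNIV"
  shows "(\<Sum>\<^sub>\<infinity>(j, n). f j n) = (\<Sum>r\<in>{0..<N}. \<Sum>\<^sub>\<infinity>(l, n). f (r + N * l) n)"
proof -
  define g where "g = (\<lambda>(r, l, n). (r + N * l, n :: 'b))"
  have bij: "bij_betw g ({0..<N} \<times> UNIV) UNIV"
    by (rule bij_betwI[where g = "\<lambda>(j, n). (j mod N, j div N, n)"]) (use N in \<open>auto simp: g_def\<close>)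
  have s: "(\<lambda>x. case_prod f (g x)) summable_on ({0..<N} \<times> UNIV)"
    using summable_on_reindex_bij_betw[OF bij, of "case_prod f"] f by simp
  have "(\<Sum>\<^sub>\<infinity>(j, n). f j n) = (\<Sum>\<^sub>\<infinity>x\<in>{0..<N} \<times> UNIV. case_prod f (g x))"
    by (rule infsum_reindex_bij_betw[OF bij, symmetric])
  also have "\<dots> = (\<Sum>\<^sub>\<infinity>r\<in>{0..<N}. \<Sum>\<^sub>\<infinity>y. case_prod f (g (r, y)))"
    by (rule infsum_Sigma_banach[OF s, symmetric])
  also have "\<dots> = (\<Sum>r\<in>{0..<N}. \<Sum>\<^sub>\<infinity>(l, n). f (r + N * l) n)"
    by (simp add: g_def case_prod_unfold)
  finally show ?thesis .
qed

text \<open>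
  Scalars may be pulled out of any unordered sum of complex numbers, first on the left and then on the
  right.
\<close>

lemma infsum_cmult_infsum:
  fixes f :: "'a \<Rightarrow> complex" and g :: "'b \<Rightarrow> complex"
  shows "(\<Sum>\<^sub>\<infinity>x\<in>A. f x) * (\<Sum>\<^sub>\<infinity>y\<in>B. g y) = (\<Sum>\<^sub>\<infinity>x\<in>A. \<Sum>\<^sub>\<infinity>y\<in>B. f x * g y)"
  by (simp add: infsum_cmult_right' infsum_cmult_left')

lemma exp_eq_2pi_intI:
  fixes x y :: complex
  assumes "x = y + 2 * of_real pi * \<i> * of_int k"
  shows "exp x = exp y"
  using exp_plus_2pin[of y k] assms by (simp add: mult_ac)

lemma minus_one_powi: "(-1 :: 'a :: field) powi n = (if even n then 1 else -1)"
  by (simp add: power_int_minus_left)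

lemma exp_pi_i_int: "exp (of_real pi * \<i> * of_int n) = (-1) powi n"
proof (cases "even n")
  case True
  then obtain k where "n = 2 * k" by auto
  then show ?thesis using exp_eq_2pi_intI[of "of_real pi * \<i> * of_int n" 0 k] by (simp add: minus_one_powi)
next
  case False
  then obtain k where "n = 2 * k + 1" by (elim oddE)
  then show ?thesis using exp_eq_2pi_intI[of "of_real pi * \<i> * of_int n" "of_real pi * \<i>" k]
    by (simp add: minus_one_powi algebra_simps)
qed

text \<open>
  Connects the denominators of the Appell series with partial fractions of the cosecant.
\<close>

lemma one_minus_exp_2pi: 
  "1 - exp (2 * of_real pi * \<i> * Z) = - (2 * \<i> * exp (of_real pi * \<i> * Z) * sin (of_real pi * Z))"
proof -
  define f where "f = exp (of_real pi * \<i> * Z)"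
  have "exp (\<i> * (of_real pi * Z)) = f" unfolding f_def by (rule arg_cong[where f = exp]) (simp add: algebra_simps)
  moreover from this have "exp (- (\<i> * (of_real pi * Z))) = 1 / f" by (simp add: exp_minus divide_inverse)
  ultimately have "sin (of_real pi * Z) = (f - 1 / f) / (2 * \<i>)" unfolding sin_exp_eq by simp
  moreover have "exp (2 * of_real pi * \<i> * Z) = f * f"
    unfolding f_def mult_exp_exp by (rule arg_cong[where f = exp]) (simp add: algebra_simps)
  moreover have "f \<noteq> 0" by (simp add: f_def)
  ultimately show ?thesis unfolding f_def[symmetric] by (simp add: field_simps)
qed

section \<open>The error function\<close>

lemma E_fun_0 [simp]: "E_fun 0 = 0"
  by (simp add: E_fun_def zero_ereal_def[symmetric] flip: zero_ereal_def)

lemma has_real_derivative_E_fun: "(E_fun has_real_derivative 2 * exp (- pi * x\<^sup>2)) (at x)"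
proof -
  define a b where "a = - \<bar>x\<bar> - 1" and "b = \<bar>x\<bar> + 1"
  have "((\<lambda>u. LBINT y=ereal 0..ereal u. exp (- pi * y\<^sup>2)) has_vector_derivative exp (- pi *
      x\<^sup>2)) (at x within {a..b})"
    by (rule interval_integral_FTC2) (auto simp: a_def b_def intro!: continuous_intros)
  moreover have "at x within {a..b} = at x"
    by (rule at_within_interior) (auto simp: a_def b_def)
  ultimately have "((\<lambda>u. LBINT y=ereal 0..ereal u. exp (- pi * y\<^sup>2)) has_real_derivative exp (- pi * x\<^sup>2)) (at x)"
    by (simp add: has_real_derivative_iff_has_vector_derivative)
  from DERIV_cmult[OF this, of 2] show ?thesis
    by (simp add: E_fun_def[abs_def])
qed

lemma E_fun_minus: "E_fun (- x) = - E_fun x"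
proof -
  have "((\<lambda>x. E_fun (- x) + E_fun x) has_real_derivative 0) (at y)" for y
    by (auto intro!: derivative_eq_intros DERIV_chain2[OF has_real_derivative_E_fun] has_real_derivative_E_fun)
  then have "E_fun (- x) + E_fun x = E_fun (- 0) + E_fun 0"
    using DERIV_isconst_all[of "\<lambda>x. E_fun (- x) + E_fun x" x 0] by blast
  then show ?thesis by simp
qed

lemma E_fun_mono: "x \<le> y \<Longrightarrow> E_fun x \<le> E_fun y"
  by (rule DERIV_nonneg_imp_nondecreasing) (auto intro!: exI has_real_derivative_E_fun)

lemma E_fun_tendsto_1: "(E_fun \<longlongrightarrow> 1) at_top"
proof -
  have "has_bochner_integral lborel (\<lambda>x. indicator {0..} (0 + sqrt pi * x) *\<^sub>R exp (- (0 + sqrt pi *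
      x)\<^sup>2)) ((sqrt pi / 2) /\<^sub>R \<bar>sqrt pi\<bar>)"
    by (subst lborel_has_bochner_integral_real_affine_iff[symmetric]) (use gaussian_moment_0 in auto)
  also have "(\<lambda>x. indicator {0..} (0 + sqrt pi * x) *\<^sub>R exp (- (0 + sqrt pi * x)\<^sup>2)) =
      (\<lambda>x. indicator {0..} x *\<^sub>R exp (- pi * x\<^sup>2))"
    by (rule ext) (auto simp: indicator_def power_mult_distrib zero_le_mult_iff not_le)
  finally have hb: "has_bochner_integral lborel (\<lambda>x. indicator {0..} x *\<^sub>R exp (- pi * x\<^sup>2)) (1/2 :: real)"
    by simp
  have "((\<lambda>y. \<integral>x. indicator {..y} x *\<^sub>R (indicator {0..} x *\<^sub>R exp (- pi * x\<^sup>2)) \<partial>lborel) \<longlongrightarrow>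
      (\<integral>x. indicator {0..} x *\<^sub>R exp (- pi * x\<^sup>2) \<partial>lborel)) at_top"
    by (rule tendsto_integral_at_top) (use hb in \<open>auto simp: has_bochner_integral_iff\<close>)
  then have "((\<lambda>y. 2 * (\<integral>x. indicator {..y} x *\<^sub>R (indicator {0..} x *\<^sub>R exp (- pi * x\<^sup>2)) \<partial>lborel)) \<longlongrightarrow> 2 *
      (1/2 :: real)) at_top"
    unfolding has_bochner_integral_integral_eq[OF hb] by (intro tendsto_mult tendsto_const)
  moreover have "\<forall>\<^sub>F y in at_top. 2 * (\<integral>x. indicator {..y} x *\<^sub>R (indicator {0..} x *\<^sub>R exp (- pi *
      x\<^sup>2)) \<partial>lborel) = E_fun y"
    using eventually_ge_at_top[of 0]
  proof eventually_elim
    case (elim y)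
    have "(\<lambda>x. indicator {..y} x *\<^sub>R (indicator {0..} x *\<^sub>R exp (- pi * x\<^sup>2))) =
        (\<lambda>x. indicator {0..y} x *\<^sub>R exp (- pi * x\<^sup>2) :: real)"
      by (auto simp: indicator_def)
    then show ?case
      using elim by (simp add: E_fun_def interval_integral_Icc set_lebesgue_integral_def)
  qed
  ultimately show ?thesis
    by (simp add: filterlim_cong)
qed

lemma E_fun_le_1: "E_fun x \<le> 1"
  by (rule tendsto_lowerbound[OF E_fun_tendsto_1]) 
     (auto intro!: E_fun_mono eventually_mono[OF eventually_ge_at_top[of x]])

lemma abs_E_fun_le_1: "\<bar>E_fun x\<bar> \<le> 1"
  using E_fun_le_1[of x] E_fun_le_1[of "-x"] by (auto simp: E_fun_minus)

text \<open>
  Comparing derivatives in \<open>x\<close>, the increment \<open>E (u + x) - E u\<close> is at most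
  \<open>exp (- pi u\<^sup>2) E x\<close>; then let \<open>x\<close> tend to infinity.
\<close>

lemma E_fun_tail:
  assumes "u \<ge> 0" shows "1 - E_fun u \<le> exp (- pi * u\<^sup>2)"
proof (rule tendsto_upperbound)
  show "((\<lambda>x. E_fun (u + x) - E_fun u) \<longlongrightarrow> 1 - E_fun u) at_top"
    by (intro tendsto_diff tendsto_const filterlim_compose[OF E_fun_tendsto_1] filterlim_tendsto_add_at_top[OF
        tendsto_const] filterlim_ident)
  have "E_fun (u + x) - E_fun u \<le> exp (- pi * u\<^sup>2)" if "x \<ge> 0" for x
  proof -
    define h where "h x = exp (- pi * u\<^sup>2) * E_fun x - E_fun (u + x)" for x
    have "h 0 \<le> h x"
    proof (rule DERIV_nonneg_imp_nondecreasing[OF that])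
      fix s :: real assume s: "0 \<le> s" "s \<le> x"
      have "(h has_real_derivative exp (- pi * u\<^sup>2) * (2 * exp (- pi * s\<^sup>2)) - 2 * exp (- pi * (u + s)\<^sup>2)) (at s)"
        unfolding h_def by (auto intro!: derivative_eq_intros DERIV_chain2[OF has_real_derivative_E_fun])
      moreover have "- pi * (u + s)\<^sup>2 \<le> - pi * u\<^sup>2 + - pi * s\<^sup>2"
        using s assms by (simp add: power2_sum distrib_left)
      then have "exp (- pi * (u + s)\<^sup>2) \<le> exp (- pi * u\<^sup>2) * exp (- pi * s\<^sup>2)"
        by (simp only: mult_exp_exp exp_le_cancel_iff)
      ultimately show "\<exists>y. (h has_real_derivative y) (at s) \<and> 0 \<le> y" by (intro exI conjI) auto
    qed
    moreover have "exp (- pi * u\<^sup>2) * E_fun x \<le> exp (- pi * u\<^sup>2) * 1"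
      by (rule mult_left_mono[OF E_fun_le_1]) auto
    ultimately have "E_fun (u + x) + h 0 \<le> exp (- pi * u\<^sup>2)"
      unfolding h_def by linarith
    then show ?thesis by (simp add: h_def)
  qed
  then show "\<forall>\<^sub>F x in at_top. E_fun (u + x) - E_fun u \<le> exp (- pi * u\<^sup>2)"
    by (intro eventually_mono[OF eventually_ge_at_top[of 0]]) auto
qed auto

lemma abs_sgn_minus_E_fun_le: 
  "\<bar>sgn u - E_fun u\<bar> \<le> exp (- pi * u\<^sup>2)"
  using E_fun_tail[of u] E_fun_tail[of "-u"] E_fun_le_1[of u] E_fun_le_1[of "-u"]
  by (cases "u = 0"; auto simp: sgn_if E_fun_minus abs_if)

section \<open>Fourier series and the inversion formula of theta series\<close>

lemma integral_exp_2pi: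
  "((\<lambda>x. exp (2 * of_real pi * \<i> * of_int k * of_real x)) has_integral (if k = 0 then 1 else 0)) {0..1::real}"
proof (cases "k = 0")
  case True
  then show ?thesis using has_integral_const_real[of "1::complex" 0 1] by simp
next
  case False
  define c where "c = 2 * of_real pi * \<i> * (of_int k :: complex)"
  have c: "c \<noteq> 0" using False by (simp add: c_def)
  have "((\<lambda>x. exp (c * of_real x)) has_integral (exp (c * of_real 1) / c - exp (c * of_real 0) / c)) {0..1::real}"
    by (rule fundamental_theorem_of_calculus)
       (use c in \<open>auto intro!: derivative_eq_intros has_vector_derivative_real_field\<close>)
  moreover have "exp c = 1" 
    unfolding c_def using exp_integer_2pi[of "of_int k"] by (simp add: algebra_simps)
  ultimately show ?thesis using False by (simp add: c_def)
qed

text \<open>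
  Expand the squared distance in the mean between \<open>q\<close> and its Fourier polynomial over \<open>A\<close>.
\<close>

lemma bessel:
  fixes q :: "real \<Rightarrow> complex"
  assumes q: "continuous_on {0..1} q"
  defines "ft \<equiv> \<lambda>k::int. integral {0..1} (\<lambda>x. q x * exp (- (2 * of_real pi * \<i> * of_int k * of_real x)))"
  assumes A: "finite A"
  shows "(\<Sum>k\<in>A. (norm (ft k))\<^sup>2) \<le> integral {0..1} (\<lambda>x. (norm (q x))\<^sup>2)"
proof -
  define e where "e k x = exp (2 * of_real pi * \<i> * of_int k * complex_of_real x)" for k :: int and x :: real
  have cnj_e: "cnj (e k x) = exp (- (2 * of_real pi * \<i> * of_int k * of_real x))" for k x
    by (simp add: e_def exp_cnj) 
  have ee: "e k x * cnj (e l x) = exp (2 * of_real pi * \<i> * of_int (k - l) * complex_of_real x)" for k l x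
    unfolding cnj_e by (simp add: e_def mult_exp_exp algebra_simps)
  have ft: "((\<lambda>x. q x * cnj (e k x)) has_integral ft k) {0..1}" for k
    unfolding ft_def cnj_e
    by (intro integrable_integral integrable_continuous_real continuous_intros q)
  have ft': "((\<lambda>x. cnj (q x) * e k x) has_integral cnj (ft k)) {0..1}" for k
    using has_integral_cnj[THEN iffD2, OF ft[of k]] by (simp add: o_def)
  have qq: "((\<lambda>x. q x * cnj (q x)) has_integral of_real (integral {0..1} (\<lambda>x. (norm (q x))\<^sup>2))) {0..1}"
    unfolding complex_norm_square[symmetric]
    by (intro has_integral_of_real integrable_integral integrable_continuous_real continuous_intros q)
  define p where "p x = (\<Sum>k\<in>A. ft k * e k x)" for x
  have 1: "((\<lambda>x. q x * cnj (p x)) has_integral (\<Sum>k\<in>A. cnj (ft k) * ft k)) {0..1}"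
  proof -
    have "((\<lambda>x. \<Sum>k\<in>A. cnj (ft k) * (q x * cnj (e k x))) has_integral (\<Sum>k\<in>A. cnj (ft k) * ft k)) {0..1}"
      by (intro has_integral_sum A has_integral_mult_right ft)
    then show ?thesis by (simp add: p_def sum_distrib_left mult_ac)
  qed
  have 2: "((\<lambda>x. p x * cnj (q x)) has_integral (\<Sum>k\<in>A. ft k * cnj (ft k))) {0..1}"
  proof -
    have "((\<lambda>x. \<Sum>k\<in>A. ft k * (cnj (q x) * e k x)) has_integral (\<Sum>k\<in>A. ft k * cnj (ft k))) {0..1}"
      by (intro has_integral_sum A has_integral_mult_right ft')
    then show ?thesis by (simp add: p_def sum_distrib_left mult_ac)
  qed
  have 3: "((\<lambda>x. p x * cnj (p x)) has_integral (\<Sum>k\<in>A. ft k * cnj (ft k))) {0..1}"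
  proof -
    have "((\<lambda>x. \<Sum>k\<in>A. \<Sum>l\<in>A. ft k * cnj (ft l) * (e k x * cnj (e l x))) has_integral 
        (\<Sum>k\<in>A. \<Sum>l\<in>A. ft k * cnj (ft l) * (if k - l = 0 then 1 else 0))) {0..1}"
      unfolding ee by (intro has_integral_sum A has_integral_mult_right integral_exp_2pi)
    also have "(\<Sum>k\<in>A. \<Sum>l\<in>A. ft k * cnj (ft l) * (if k - l = 0 then 1 else 0)) = (\<Sum>k\<in>A. ft k * cnj (ft k))"
      by (rule sum.cong) (use A in \<open>auto simp: if_distrib[of "\<lambda>x. _ * x"] sum.delta' cong: if_cong\<close>)
    finally show ?thesis 
      by (simp add: p_def sum_product mult_ac)
  qed
  have "((\<lambda>x. (q x - p x) * cnj (q x - p x)) has_integral 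
      (of_real (integral {0..1} (\<lambda>x. (norm (q x))\<^sup>2)) - (\<Sum>k\<in>A. ft k * cnj (ft k)))) {0..1}"
    using has_integral_add[OF has_integral_diff[OF has_integral_diff[OF qq 1] 2] 3]
    by (simp add: algebra_simps)
  then have "((\<lambda>x. Re ((q x - p x) * cnj (q x - p x))) has_integral 
      Re (of_real (integral {0..1} (\<lambda>x. (norm (q x))\<^sup>2)) - (\<Sum>k\<in>A. ft k * cnj (ft k)))) {0..1}"
    by (rule has_integral_Re)
  then have "0 \<le> Re (of_real (integral {0..1} (\<lambda>x. (norm (q x))\<^sup>2)) - (\<Sum>k\<in>A. ft k * cnj (ft k)))"
    by (rule has_integral_nonneg) (simp only: complex_norm_square[symmetric], simp)
  then show ?thesis
    by (simp add: complex_norm_square[symmetric] flip: of_real_sum of_real_diff)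
qed

lemma riemann_lebesgue_unit_interval:
  fixes q :: "real \<Rightarrow> complex"
  assumes q: "continuous_on {0..1} q"
  defines "ft \<equiv> \<lambda>k::int. integral {0..1} (\<lambda>x. q x * exp (- (2 * of_real pi * \<i> * of_int k * of_real x)))"
  assumes "inj (s :: nat \<Rightarrow> int)"
  shows "(\<lambda>n. ft (s n)) \<longlonglongrightarrow> 0"
proof -
  have "(\<lambda>k. (norm (ft k))\<^sup>2) summable_on UNIV"
    by (rule nonneg_bdd_above_summable_on) 
       (use bessel[OF q] in \<open>auto simp: ft_def intro!: bdd_aboveI\<close>)
  then have "(\<lambda>k. (norm (ft k))\<^sup>2) summable_on range s"
    by (rule summable_on_subset) auto
  then have "((\<lambda>k. (norm (ft k))\<^sup>2) \<circ> s) summable_on UNIV"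
    by (subst (asm) summable_on_reindex[OF assms(3)])
  then have "(\<lambda>n. (norm (ft (s n)))\<^sup>2) \<longlonglongrightarrow> 0"
    by (intro summable_LIMSEQ_zero summable_on_imp_summable) (simp add: o_def)
  then have "(\<lambda>n. sqrt ((norm (ft (s n)))\<^sup>2)) \<longlonglongrightarrow> sqrt 0"
    by (rule tendsto_real_sqrt)
  then show ?thesis by (simp add: tendsto_norm_zero_iff)
qed


text \<open>
  Chernoff's proof of pointwise convergence. The quotient \<open>q\<close> of \<open>F - F 0\<close> by
  \<open>exp (2 pi \<i> w) - 1\<close> is continuous, because \<open>F\<close> is periodic and differentiable. Multiplication by
  \<open>exp (2 pi \<i> w) - 1\<close> replaces Fourier coefficients by differences of neighbours, so the partial
  sums telescope, and the boundary terms vanish in the limit by the Riemann-Lebesgue lemma.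
\<close>

lemma fourier_series_at_0:
  fixes F :: "complex \<Rightarrow> complex"
  assumes hol: "F holomorphic_on UNIV" and per: "\<And>w. F (w + 1) = F w"
  defines "c \<equiv> \<lambda>k::int. integral {0..1} (\<lambda>x. F (of_real x) * exp (- (2 * of_real pi * \<i> * of_int k * of_real x)))"
  assumes sm: "c summable_on UNIV"
  shows "(\<Sum>\<^sub>\<infinity>k. c k) = F 0"
proof -
  define H where "H w = exp (2 * of_real pi * \<i> * w) - 1" for w :: complex
  define q where "q w = (if H w = 0 then deriv F 0 / (2 * of_real pi * \<i>) else (F w - F 0) / H w)" for w
  have contF: "isCont F w" for w
    using holomorphic_on_imp_continuous_on[OF hol] by (simp add: continuous_on_eq_continuous_at)
  have H_per: "H (w + 1) = H w" for w
    by (simp add: H_def distrib_left exp_add)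
  have q_per: "q (w + 1) = q w" for w
    by (simp add: q_def H_per per)
  have H0: "H 0 = 0" by (simp add: H_def)
  have "isCont q 0"
  proof -
    have "DERIV F 0 :> deriv F 0"
      using hol by (simp add: holomorphic_derivI[OF hol open_UNIV])
    then obtain g1 where g1: "\<And>z. F z - F 0 = g1 z * z" "isCont g1 0" "g1 0 = deriv F 0"
      unfolding CARAT_DERIV by auto
    have "DERIV H 0 :> 2 * of_real pi * \<i>"
      unfolding H_def by (auto intro!: derivative_eq_intros)
    then obtain g2 where g2: "\<And>z. H z = g2 z * z" "isCont g2 0" "g2 0 = 2 * of_real pi * \<i>"
      unfolding CARAT_DERIV by (auto simp: H0)
    have "isCont (\<lambda>w. g1 w / g2 w) 0"
      by (intro continuous_intros g1 g2) (simp add: g2)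
    moreover have "\<forall>\<^sub>F w in nhds 0. g2 w \<noteq> 0"
      using tendsto_imp_eventually_ne[OF g2(2)[unfolded continuous_at], of 0] g2(3)
      by (simp add: eventually_nhds_conv_at)
    then have "\<forall>\<^sub>F w in nhds 0. q w = g1 w / g2 w"
    proof eventually_elim
      case (elim w)
      show ?case
        by (cases "w = 0") (use elim in \<open>auto simp: q_def g1 g2 H0\<close>)
    qed
    ultimately show ?thesis by (simp add: isCont_cong)
  qed
  moreover have "isCont q 1"
  proof -
    have "isCont (\<lambda>w. q (w - 1)) 1"
      by (rule continuous_at_compose[unfolded o_def, where g = q and f = "\<lambda>w. w - 1"])
         (use \<open>isCont q 0\<close> in \<open>auto intro!: continuous_intros\<close>)
    then show ?thesis using q_per[of "_ - 1"] by simp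
  qed
  moreover have H_nz: "H (of_real x) \<noteq> 0" if "0 < x" "x < 1" for x
  proof
    assume "H (of_real x) = 0"
    then obtain n :: int where "2 * pi * x = of_int (2 * n) * pi"
      unfolding H_def by (auto simp: exp_eq_1)
    then have "x = of_int n" by simp
    with that show False by auto
  qed
  moreover have "isCont q (of_real x)" if "0 < x" "x < 1" for x
  proof -
    have "isCont H (of_real x)" unfolding H_def by (intro continuous_intros)
    then have "\<forall>\<^sub>F w in nhds (of_real x). H w \<noteq> 0"
      using tendsto_imp_eventually_ne[of H "H (of_real x)" "at (of_real x)" 0] H_nz[OF that]
      by (simp add: eventually_nhds_conv_at continuous_at)
    then have "\<forall>\<^sub>F w in nhds (of_real x). q w = (F w - F 0) / H w"
      by eventually_elim (auto simp: q_def)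
    moreover have "isCont (\<lambda>w. (F w - F 0) / H w) (of_real x)"
      by (intro continuous_intros contF \<open>isCont H _\<close> H_nz that)
    ultimately show ?thesis by (simp add: isCont_cong)
  qed
  ultimately have "isCont q (of_real x)" if "x \<in> {0..1}" for x
    using that by (cases "x = 0"; cases "x = 1") auto
  then have qc: "continuous_on {0..1} (\<lambda>x. q (of_real x))"
    by (intro continuous_at_imp_continuous_on ballI continuous_at_compose[unfolded o_def, where g = q and f =
        of_real]) auto
  define ft where "ft k = integral {0..1} (\<lambda>x. q (of_real x) * exp (- (2 * of_real pi * \<i> * of_int k *
      of_real x)))" for k :: int
  have ft: "((\<lambda>x. q (of_real x) * exp (- (2 * of_real pi * \<i> * of_int k *
      of_real x))) has_integral ft k) {0..1}" for k
    unfolding ft_def by (intro integrable_integral integrable_continuous_real continuous_intros qc)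
  have Fq: "F (of_real x) = F 0 + H (of_real x) * q (of_real x)" if "x \<in> {0..1}" for x
  proof (cases "0 < x \<and> x < 1")
    case True
    then show ?thesis using H_nz[of x] by (simp add: q_def)
  next
    case False
    with that have "x = 0 \<or> x = 1" by auto
    then show ?thesis using per[of 0] H_per[of 0] by (auto simp: H0)
  qed
  have c: "c k = (if k = 0 then F 0 else 0) + (ft (k - 1) - ft k)" for k
  proof -
    have "((\<lambda>x. F 0 * exp (2 * of_real pi * \<i> * of_int (-k) * of_real x) 
        + (q (of_real x) * exp (- (2 * of_real pi * \<i> * of_int (k - 1) * of_real x)) 
          - q (of_real x) * exp (- (2 * of_real pi * \<i> * of_int k * of_real x)))) has_integral
        (F 0 * (if - k = 0 then 1 else 0) + (ft (k - 1) - ft k))) {0..1}"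
      by (intro has_integral_add has_integral_diff has_integral_mult_right integral_exp_2pi ft)
    then have "((\<lambda>x. F (of_real x) * exp (- (2 * of_real pi * \<i> * of_int k * of_real x))) has_integral
        (F 0 * (if - k = 0 then 1 else 0) + (ft (k - 1) - ft k))) {0..1}"
    proof (rule has_integral_eq[rotated])
      fix x :: real assume "x \<in> {0..1}"
      show "F 0 * exp (2 * of_real pi * \<i> * of_int (-k) * of_real x) 
        + (q (of_real x) * exp (- (2 * of_real pi * \<i> * of_int (k - 1) * of_real x)) 
          - q (of_real x) * exp (- (2 * of_real pi * \<i> * of_int k * of_real x))) = 
         F (of_real x) * exp (- (2 * of_real pi * \<i> * of_int k * of_real x))"
      proof -
        have a: "exp (- (2 * of_real pi * \<i> * of_int (k - 1) * of_real x)) = 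
            exp (2 * of_real pi * \<i> * of_real x) * exp (- (2 * of_real pi * \<i> * of_int k * of_real x))"
          unfolding mult_exp_exp by (rule arg_cong[where f = exp]) (simp add: algebra_simps)
        have b: "exp (2 * of_real pi * \<i> * of_int (-k) * of_real x) = exp (- (2 * of_real pi * \<i> * of_int k *
            of_real x))"
          by simp
        show ?thesis
          unfolding Fq[OF \<open>x \<in> _\<close>] a b H_def by (simp only: algebra_simps mult_1_left)
      qed
    qed
    then show ?thesis unfolding c_def by (simp add: integral_unique)
  qed
  have "(\<Sum>k\<in>{- int K..int K}. c k) = F 0 - (ft (int K) - ft (- int K - 1))" for K :: nat
  proof -
    have "(\<Sum>k\<in>{- int K..int K}. c k) = F 0 - (\<Sum>k\<in>{- int K..int K}. ft (k + 1 - 1) - ft (k - 1))"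
      unfolding c by (simp add: sum.distrib sum_subtractf algebra_simps)
    then show ?thesis using sum_int_telescope[of "\<lambda>k. ft (k - 1)" K] by simp
  qed
  moreover have "(\<lambda>K. F 0 - (ft (int K) - ft (- int K - 1))) \<longlonglongrightarrow> F 0 - (0 - 0)"
    unfolding ft_def
    by (intro tendsto_intros riemann_lebesgue_unit_interval[OF qc]) (auto simp: inj_def)
  ultimately have "(\<lambda>K::nat. \<Sum>k\<in>{- int K..int K}. c k) \<longlonglongrightarrow> F 0"
    by simp
  moreover have "(\<lambda>K::nat. \<Sum>k\<in>{- int K..int K}. c k) \<longlonglongrightarrow> (\<Sum>\<^sub>\<infinity>k. c k)"
    by (rule has_sum_int_tendsto) (use sm in simp)
  ultimately show ?thesis using LIMSEQ_unique by blast
qed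


text \<open>
  Multiplying the Gaussian series by a character
  shifts its argument by an imaginary amount, up to a factor, so every Fourier coefficient is a
  multiple of one mean value \<open>J\<close> over a period. This mean value does not depend on the height at
  which the period is taken, and at height 0 it is a Gaussian integral over the real line.
\<close>

lemma theta_inversion_real:
  fixes a :: real and z :: complex
  assumes a: "a > 0"
  shows "(\<Sum>\<^sub>\<infinity>n::int. exp (- of_real a * (z + of_int n)\<^sup>2)) = 
     of_real (sqrt (pi / a)) * (\<Sum>\<^sub>\<infinity>k::int. exp (- of_real (pi\<^sup>2 / a) * (of_int k)\<^sup>2 + 2 * of_real pi * \<i> *
         of_int k * z))"
proof -
  define F where "F w = (\<Sum>\<^sub>\<infinity>n::int. exp (- of_real a * (w + of_int n)\<^sup>2))" for w :: complex
  have F_per: "F (w + 1) = F w" for w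
    unfolding F_def by (rule infsum_reindex_bij_witness[of _ "\<lambda>n. n - 1" "\<lambda>n. n + 1"]) (auto simp: algebra_simps)
  have sm: "(\<lambda>n::int. exp (a * R\<^sup>2) * exp (- a * (of_int n)\<^sup>2 + 2 * a * R * \<bar>of_int n\<bar>)) summable_on UNIV" for R
    by (intro summable_on_cmult_right summable_on_gauss a)
  have F_hol: "F holomorphic_on UNIV"
    unfolding F_def
  proof (rule holomorphic_on_infsum)
    show "\<exists>r>0. \<exists>h. cball w r \<subseteq> UNIV \<and> h summable_on UNIV \<and>
        (\<forall>n::int\<in>UNIV. \<forall>v\<in>cball w r. norm (exp (- of_real a * (v + of_int n)\<^sup>2)) \<le> h n)" for w :: complex
    proof (intro exI conjI ballI)
      fix n :: int and v assume "v \<in> cball w 1"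
      then have "norm v \<le> norm w + 1"
        by (metis add.commute add_le_cancel_right dist_commute dist_norm mem_cball norm_triangle_sub order_trans
            add_mono order_refl)
      then show "norm (exp (- of_real a * (v + of_int n)\<^sup>2)) \<le> exp (a * (norm w + 1)\<^sup>2) * exp (- a *
          (of_int n)\<^sup>2 + 2 * a * (norm w + 1) * \<bar>of_int n\<bar>)"
        by (rule norm_exp_complex_sq_le[OF _ a])
    qed (use sm in auto)
  qed (auto intro!: holomorphic_intros)
  have F_cont: "continuous_on S F" for S
    using holomorphic_on_imp_continuous_on[OF F_hol] continuous_on_subset by blast
  \<comment> \<open>the mean value over a period does not depend on the height\<close>
  define J where "J w = integral {0..1} (\<lambda>x. F (of_real x + w))" for w
  obtain G where G: "\<And>w. (G has_field_derivative F w) (at w)"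
    using holomorphic_convex_primitive'[OF convex_UNIV open_UNIV F_hol] by auto
  have J_G: "J w = G (w + 1) - G w" for w
  proof -
    have "((\<lambda>x. F (of_real x + w)) has_integral (G (of_real 1 + w) - G (of_real 0 + w))) {0..1}"
    proof (rule fundamental_theorem_of_calculus)
      fix x :: real
      have "((\<lambda>u. G (u + w)) has_field_derivative F (of_real x + w)) (at (of_real x))"
        unfolding DERIV_shift[symmetric] by (rule G)
      then show "((\<lambda>x. G (of_real x + w)) has_vector_derivative F (of_real x + w)) (at x within {0..1})"
        by (rule has_vector_derivative_real_field)
    qed auto
    then show ?thesis unfolding J_def by (simp add: integral_unique add_ac)
  qed
  have J_const: "J w = J 0" for w
  proof -
    have "(J has_field_derivative 0) (at u within UNIV)" for u
    proof -
      have "((\<lambda>w. G (w + 1) - G w) has_field_derivative F (u + 1) * (1 + 0) - F u) (at u)"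
        by (intro derivative_intros DERIV_chain2[OF G] G)
      then show ?thesis by (simp add: F_per flip: J_G)
    qed
    then show ?thesis
      using has_field_derivative_zero_constant[of UNIV J] by auto
  qed
  define s where "s = sqrt (a / pi)"
  have s: "s > 0" "s\<^sup>2 = a / pi" using a by (auto simp: s_def)
  have J0: "J 0 = of_real (sqrt (pi / a))"
  proof -
    define g where "g n = E_fun (of_int n * s) / (2 * s)" for n :: int
    have int: "((\<lambda>x. exp (- of_real a * (of_real x + of_int n)\<^sup>2)) has_integral complex_of_real (g (n + 1) -
        g n)) {0..1}" for n
    proof -
      have "((\<lambda>x. exp (- a * (x + of_int n)\<^sup>2)) has_integral (E_fun ((1 + of_int n) * s) / (2 * s) - E_fun ((0 +
          of_int n) * s) / (2 * s))) {0..1}"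
      proof (rule fundamental_theorem_of_calculus)
        fix x :: real
        have "((\<lambda>x. E_fun ((x + of_int n) * s) / (2 * s)) has_real_derivative (2 * exp (- pi * ((x + of_int n) *
            s)\<^sup>2) * s) / (2 * s)) (at x)"
          by (auto intro!: derivative_eq_intros DERIV_chain2[OF has_real_derivative_E_fun])
        also have "(2 * exp (- pi * ((x + of_int n) * s)\<^sup>2) * s) / (2 * s) = exp (- a * (x + of_int n)\<^sup>2)"
          using s by (simp add: power_mult_distrib)
        finally show "((\<lambda>x. E_fun ((x + of_int n) * s) / (2 * s)) has_vector_derivative exp (- a * (x +
            of_int n)\<^sup>2)) (at x within {0..1})"
          using has_real_derivative_iff_has_vector_derivative has_vector_derivative_at_within by blast
      qed auto
      then have "((\<lambda>x. complex_of_real (exp (- a * (x + of_int n)\<^sup>2))) has_integral 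
          complex_of_real (E_fun ((1 + of_int n) * s) / (2 * s) - E_fun ((0 + of_int n) * s) / (2 * s))) {0..1}"
        by (rule has_integral_of_real)
      then show ?thesis
        by (simp add: g_def add_ac exp_of_real[symmetric])
    qed
    have "((\<lambda>n. integral {0..1} (\<lambda>x. exp (- of_real a * (complex_of_real x + of_int n)\<^sup>2))) has_sum J 0) UNIV"
      unfolding J_def F_def add_0_right
    proof (rule has_integral_infsum(1))
      show "norm (exp (- of_real a * (complex_of_real x + of_int n)\<^sup>2)) \<le> exp (a * 1\<^sup>2) * exp (- a *
          (of_int n)\<^sup>2 + 2 * a * 1 * \<bar>of_int n\<bar>)" 
        if "x \<in> {0..1}" for n x
        by (rule norm_exp_complex_sq_le) (use a that in auto)
    qed (use sm[of 1] in \<open>auto intro!: continuous_intros\<close>)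
    then have "(\<lambda>K::nat. \<Sum>n\<in>{- int K..int K}. integral {0..1} (\<lambda>x. exp (- of_real a * (complex_of_real x +
        of_int n)\<^sup>2))) \<longlonglongrightarrow> J 0"
      by (rule has_sum_int_tendsto)
    also have "(\<lambda>K::nat. \<Sum>n\<in>{- int K..int K}. integral {0..1} (\<lambda>x. exp (- of_real a * (complex_of_real x +
        of_int n)\<^sup>2))) =
        (\<lambda>K. of_real (g (int K + 1) - g (- int K)))"
      unfolding integral_unique[OF int] of_real_sum[symmetric] sum_int_telescope ..
    finally have 1: "(\<lambda>K. complex_of_real (g (int K + 1) - g (- int K))) \<longlonglongrightarrow> J 0" .
    have "(\<lambda>K. complex_of_real (g (int K + 1) - g (- int K))) \<longlonglongrightarrow> of_real (1 / (2 * s) - - 1 / (2 * s))"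
    proof (intro tendsto_of_real tendsto_diff)
      have *: "filterlim (\<lambda>K. (real K + c) * s) at_top sequentially" for c
        using s by real_asymp
      show "(\<lambda>K. g (int K + 1)) \<longlonglongrightarrow> 1 / (2 * s)"
        unfolding g_def using s filterlim_compose[OF E_fun_tendsto_1 *[of 1]] 
        by (intro tendsto_divide tendsto_const) auto
      show "(\<lambda>K. g (- int K)) \<longlonglongrightarrow> - 1 / (2 * s)"
        unfolding g_def using s filterlim_compose[OF E_fun_tendsto_1 *[of 0]] 
        by (intro tendsto_divide tendsto_const) (auto simp: E_fun_minus intro!: tendsto_minus)
    qed
    with 1 have "J 0 = of_real (1 / (2 * s) - - 1 / (2 * s))" using LIMSEQ_unique by blast
    also have "1 / (2 * s) - - 1 / (2 * s) = sqrt (pi / a)"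
      using a by (simp add: s_def real_sqrt_divide)
    finally show ?thesis .
  qed
  define C where "C = (\<lambda>k::int. of_real (sqrt (pi / a)) * exp (- of_real (pi\<^sup>2 / a) * (of_int k)\<^sup>2 + 2 *
      of_real pi * \<i> * of_int k * z))"
  have coeff: "integral {0..1} (\<lambda>x. F (of_real x + z) * exp (- (2 * of_real pi * \<i> * of_int k * of_real x))) =
      C k" for k :: int
  proof -
    define K :: complex where "K = exp (- of_real (pi\<^sup>2 / a) * (of_int k)\<^sup>2 + 2 * of_real pi * \<i> * of_int k * z)"
    \<comment> \<open>completing the square in each term\<close>
    have "F (of_real x + z) * exp (- (2 * of_real pi * \<i> * of_int k * of_real x)) = K * F (of_real x + (z + \<i> *
        of_real pi * of_int k / of_real a))" for x :: real
      unfolding F_def infsum_cmult_left'[symmetric] infsum_cmult_right'[symmetric]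
    proof (rule infsum_cong)
      fix n :: int
      have e: "exp (- (2 * of_real pi * \<i> * of_int k * of_real x)) = exp (- (2 * of_real pi * \<i> * of_int k *
          (of_real x + of_int n)))"
        using exp_plus_2pin[of "- (2 * of_real pi * \<i> * of_int k * (of_real x + of_int n))" "k * n"]
        by (simp add: algebra_simps)
      show "exp (- of_real a * (of_real x + z + of_int n)\<^sup>2) * exp (- (2 * of_real pi * \<i> * of_int k * of_real x)) =
        K * exp (- of_real a * (of_real x + (z + \<i> * of_real pi * of_int k / of_real a) + of_int n)\<^sup>2)"
        unfolding e K_def mult_exp_exp using a
        by (intro arg_cong[where f = exp]) (simp add: field_simps power2_eq_square)
    qed
    then have "integral {0..1} (\<lambda>x. F (of_real x + z) * exp (- (2 * of_real pi * \<i> * of_int k * of_real x))) =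
        K * J (z + \<i> * of_real pi * of_int k / of_real a)"
      by (simp add: J_def)
    then show ?thesis by (simp add: J_const[of "_ + _"] J0 C_def K_def)
  qed
  have Csum: "C summable_on UNIV"
  proof -
    have "(\<lambda>k::int. norm (exp (of_real pi * \<i> * (of_int k)\<^sup>2 * (\<i> * of_real (pi / a)) + 2 * of_real pi * \<i> *
        of_int k * z))) summable_on UNIV"
      by (rule summable_on_gauss_complex) (use a in auto)
    then have "(\<lambda>k::int. exp (of_real pi * \<i> * (of_int k)\<^sup>2 * (\<i> * of_real (pi / a)) + 2 * of_real pi * \<i> *
        of_int k * z)) summable_on UNIV"
      by (rule abs_summable_summable)
    from summable_on_cmult_right[OF this, of "of_real (sqrt (pi / a))"] show ?thesis
      by (simp add: C_def power2_eq_square mult_ac)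
  qed
  have "(\<Sum>\<^sub>\<infinity>k. integral {0..1} (\<lambda>x. F (of_real x + z) * exp (- (2 * of_real pi * \<i> * of_int k * of_real x)))) =
      F (0 + z)"
  proof (rule fourier_series_at_0)
    have "F \<circ> (\<lambda>w. w + z) holomorphic_on UNIV"
      by (rule holomorphic_on_compose) (auto intro!: holomorphic_intros holomorphic_on_subset[OF F_hol])
    then show "(\<lambda>w. F (w + z)) holomorphic_on UNIV" by (simp add: o_def)
    show "F (w + 1 + z) = F (w + z)" for w using F_per[of "w + z"] by (simp add: add_ac)
  qed (use Csum in \<open>simp add: coeff\<close>)
  then show ?thesis
    unfolding coeff by (simp add: C_def infsum_cmult_right' F_def)
qed


text \<open>
  Both sides are holomorphic in \<open>\<tau>\<close> on the upper half plane and agree on the imaginary axis.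
\<close>

theorem theta_inversion:
  fixes \<tau> z :: complex
  assumes \<tau>: "Im \<tau> > 0"
  shows "(\<Sum>\<^sub>\<infinity>n::int. exp (- (of_real pi * \<i> * (z + of_int n)\<^sup>2 / \<tau>))) = 
     csqrt (- \<i> * \<tau>) * (\<Sum>\<^sub>\<infinity>n::int. exp (of_real pi * \<i> * (of_int n)\<^sup>2 * \<tau> + 2 * of_real pi * \<i> * of_int n * z))"
proof -
  define A where "A \<tau> = (\<Sum>\<^sub>\<infinity>n::int. exp (of_real pi * \<i> * (of_int n)\<^sup>2 * \<tau> + 2 * of_real pi * \<i> * of_int n *
      z))" for \<tau>
  define B where "B \<tau> = (\<Sum>\<^sub>\<infinity>n::int. exp (- (of_real pi * \<i> * (z + of_int n)\<^sup>2 / \<tau>)))" for \<tau>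
  define H where "H = {\<tau>. Im \<tau> > 0}"
  have oH: "open H" unfolding H_def by (rule open_halfspace_Im_gt)
  have cH: "connected H" unfolding H_def by (rule convex_connected[OF convex_halfspace_Im_gt])
  have near: "cball t (Im t / 2) \<subseteq> H \<and> (\<forall>u\<in>cball t (Im t / 2). Im t / 2 \<le> Im u \<and> norm u \<le> 2 *
      norm t)" if "t \<in> H" for t
  proof -
    have *: "Im t / 2 \<le> Im u \<and> norm u \<le> 2 * norm t" if "u \<in> cball t (Im t / 2)" for u
    proof -
      have "norm (t - u) \<le> Im t / 2" using that by (simp add: dist_norm)
      then show ?thesis
        using abs_Im_le_cmod[of "t - u"] abs_Im_le_cmod[of t] norm_triangle_ineq2[of u t] norm_minus_commute[of
            u t] by auto
    qed
    then show ?thesis using \<open>t \<in> H\<close> by (force simp: H_def)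
  qed
  have A_hol: "A holomorphic_on H"
    unfolding A_def
  proof (rule holomorphic_on_infsum[OF oH])
    fix t assume t: "t \<in> H"
    then have y: "Im t > 0" by (simp add: H_def)
    show "\<exists>r>0. \<exists>h. cball t r \<subseteq> H \<and> h summable_on UNIV \<and>
        (\<forall>n::int\<in>UNIV. \<forall>u\<in>cball t r. norm (exp (of_real pi * \<i> * (of_int n)\<^sup>2 * u + 2 * of_real pi * \<i> *
            of_int n * z)) \<le> h n)"
    proof (intro exI conjI ballI)
      fix n :: int and u assume "u \<in> cball t (Im t / 2)"
      with near[OF t] have u: "Im t / 2 \<le> Im u" by auto
      have "(of_int n)\<^sup>2 * (Im t / 2) \<le> (of_int n)\<^sup>2 * Im u" by (rule mult_left_mono[OF u]) auto
      then show "norm (exp (of_real pi * \<i> * (of_int n)\<^sup>2 * u + 2 * of_real pi * \<i> * of_int n * z)) \<le> 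
          norm (exp (of_real pi * \<i> * (of_int n)\<^sup>2 * (\<i> * of_real (Im t / 2)) + 2 * of_real pi * \<i> * of_int n * z))"
        by (simp flip: of_int_power)
    qed (use y near[OF t] summable_on_gauss_complex[of "\<i> * of_real (Im t / 2)" z] in auto)
  qed (auto intro!: holomorphic_intros)
  have B_hol: "B holomorphic_on H"
    unfolding B_def
  proof (rule holomorphic_on_infsum[OF oH])
    fix t assume t: "t \<in> H"
    then have y: "Im t > 0" by (simp add: H_def)
    then have t0: "norm t > 0" by auto
    define a where "a = Im t / (8 * (norm t)\<^sup>2)"
    define b where "b = 2 / Im t"
    have ab: "a > 0" "b > 0" using y t0 by (auto simp: a_def b_def)
    show "\<exists>r>0. \<exists>h. cball t r \<subseteq> H \<and> h summable_on UNIV \<and>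
        (\<forall>n::int\<in>UNIV. \<forall>u\<in>cball t r. norm (exp (- (of_real pi * \<i> * (z + of_int n)\<^sup>2 / u))) \<le> h n)"
    proof (intro exI conjI ballI)
      fix n :: int and u assume "u \<in> cball t (Im t / 2)"
      with near[OF t] have u: "Im t / 2 \<le> Im u" "norm u \<le> 2 * norm t" by auto
      then have u0: "Im u > 0" "norm u > 0" using y by auto
      have "a \<le> (Im t / 2) / (norm u)\<^sup>2"
      proof -
        have "(norm u)\<^sup>2 \<le> (2 * norm t)\<^sup>2" using u by (intro power_mono) auto
        then have "(Im t / 2) / (2 * norm t)\<^sup>2 \<le> (Im t / 2) / (norm u)\<^sup>2"
          using u0 y t0 by (intro divide_left_mono) auto
        then show ?thesis by (simp add: a_def power_mult_distrib)
      qed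
      also have "\<dots> \<le> Im u / (norm u)\<^sup>2" using u by (intro divide_right_mono) auto
      finally have a: "a \<le> Im u / (norm u)\<^sup>2" .
      have b: "1 / norm u \<le> b"
      proof -
        have "Im t / 2 \<le> norm u" using u abs_Im_le_cmod[of u] by linarith
        then have "1 / norm u \<le> 1 / (Im t / 2)" using y by (intro divide_left_mono) (use u0 in auto)
        then show ?thesis by (simp add: b_def)
      qed
      have e: "- (of_real pi * \<i> * (z + of_int n)\<^sup>2 / u) = of_real (pi * (of_int n)\<^sup>2) * (- \<i> / u) +
          of_real pi * (- \<i> * (2 * z * of_int n + z\<^sup>2) / u)"
        by (simp add: power2_eq_square add_divide_distrib diff_divide_distrib algebra_simps)
      have 1: "Re (- \<i> / u) \<le> - a"
        using a by (simp add: Re_divide cmod_power2 algebra_simps)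
      have "Re (- \<i> * (2 * z * of_int n + z\<^sup>2) / u) \<le> norm (- \<i> * (2 * z * of_int n + z\<^sup>2) / u)"
        by (rule complex_Re_le_cmod)
      also have "\<dots> = norm (2 * z * of_int n + z\<^sup>2) * (1 / norm u)"
        by (simp add: norm_divide norm_mult)
      also have "\<dots> \<le> (2 * norm z * \<bar>of_int n\<bar> + (norm z)\<^sup>2) * b"
        by (intro mult_mono b order_trans[OF norm_triangle_ineq]) (auto simp: norm_mult norm_power)
      finally have 2: "Re (- \<i> * (2 * z * of_int n + z\<^sup>2) / u) \<le> (2 * norm z * \<bar>of_int n\<bar> + (norm z)\<^sup>2) * b" .
      have "Re (- (of_real pi * \<i> * (z + of_int n)\<^sup>2 / u)) \<le> (pi * (of_int n)\<^sup>2) * (- a) + pi * ((2 * norm z *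
          \<bar>of_int n\<bar> + (norm z)\<^sup>2) * b)"
        unfolding e plus_complex.simps Re_complex_of_real times_complex.simps Im_complex_of_real mult_zero_left
            diff_zero
        by (intro add_mono mult_left_mono 1 2) auto
      also have "\<dots> = pi * (norm z)\<^sup>2 * b + (- (pi * a) * (of_int n)\<^sup>2 + (2 * pi * norm z * b) * \<bar>of_int n\<bar>)"
        by (simp add: algebra_simps)
      finally show "norm (exp (- (of_real pi * \<i> * (z + of_int n)\<^sup>2 / u))) \<le> 
          exp (pi * (norm z)\<^sup>2 * b) * exp (- (pi * a) * (of_int n)\<^sup>2 + (2 * pi * norm z * b) * \<bar>of_int n\<bar>)"
        by (simp add: mult_exp_exp)
    next
      show "(\<lambda>n::int. exp (pi * (norm z)\<^sup>2 * b) * exp (- (pi * a) * (of_int n)\<^sup>2 + (2 * pi * norm z * b) *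
          \<bar>of_int n\<bar>)) summable_on UNIV"
        by (intro summable_on_cmult_right summable_on_gauss) (use ab in auto)
    qed (use y near[OF t] in auto)
  qed (auto intro!: holomorphic_intros simp: H_def)
  have hol: "(\<lambda>t. B t - csqrt (- \<i> * t) * A t) holomorphic_on H"
    by (intro holomorphic_intros A_hol B_hol) (auto simp: H_def complex_nonpos_Reals_iff)
  have zero: "B t - csqrt (- \<i> * t) * A t = 0" if "t \<in> (\<lambda>s. \<i> * of_real s) ` {0<..}" for t
  proof -
    from that obtain s where s: "s > 0" "t = \<i> * of_real s" by auto
    have "B t = (\<Sum>\<^sub>\<infinity>n::int. exp (- of_real (pi / s) * (z + of_int n)\<^sup>2))"
      unfolding B_def using s by (intro infsum_cong arg_cong[where f = exp]) (simp add: field_simps)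
    also have "\<dots> = of_real (sqrt s) * (\<Sum>\<^sub>\<infinity>k::int. exp (- of_real (pi * s) * (of_int k)\<^sup>2 + 2 * of_real pi * \<i> *
        of_int k * z))"
      using theta_inversion_real[of "pi / s" z] s by (simp add: power2_eq_square)
    also have "(\<Sum>\<^sub>\<infinity>k::int. exp (- of_real (pi * s) * (of_int k)\<^sup>2 + 2 * of_real pi * \<i> * of_int k * z)) = A t"
      unfolding A_def using s by (intro infsum_cong arg_cong[where f = exp]) (simp add: algebra_simps)
    also have "of_real (sqrt s) = csqrt (- \<i> * t)"
    proof -
      have "- \<i> * t = of_real s" using s by (simp flip: mult.assoc)
      then show ?thesis using s by simp
    qed
    finally show ?thesis by simp
  qed
  have lp: "\<i> islimpt ((\<lambda>s. \<i> * of_real s) ` {0<..})"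
    unfolding islimpt_sequential
  proof (intro exI conjI allI)
    show "\<i> * of_real (1 + 1 / real (Suc n)) \<in> (\<lambda>s. \<i> * of_real s) ` {0<..} - {\<i>}" for n
      by (auto intro!: imageI add_pos_pos simp del: of_real_add of_real_divide)
    have "(\<lambda>n. 1 / real (Suc n)) \<longlonglongrightarrow> 0" by real_asymp
    then have "(\<lambda>n. \<i> * of_real (1 + 1 / real (Suc n))) \<longlonglongrightarrow> \<i> * of_real (1 + 0)"
      by (intro tendsto_intros)
    then show "(\<lambda>n. \<i> * of_real (1 + 1 / real (Suc n))) \<longlonglongrightarrow> \<i>" by simp
  qed
  have "B \<tau> - csqrt (- \<i> * \<tau>) * A \<tau> = 0"
    by (rule analytic_continuation[OF hol oH cH _ _ lp zero]) (use \<tau> in \<open>auto simp: H_def\<close>)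
  then show ?thesis by (simp add: A_def B_def)
qed

section \<open>Jacobi theta functions\<close>

text \<open>
  Completing the square turns the series on the left into the Gaussian series of the inversion
  formula at the point \<open>a/2 - z - b \<tau>/2\<close>. The two characteristics change places; the phase comes
  from the cross term \<open>a b\<close>.
\<close>

lemma jacobi_theta_S:
  assumes \<tau>: "Im \<tau> > 0" and ab: "a \<in> {0, 1}"
  shows "jacobi_theta a b (- 1 / \<tau>) (z / \<tau>) = 
    exp (- (of_real pi * \<i> / 2 * of_real (a * b))) * csqrt (- \<i> * \<tau>) * exp (of_real pi * \<i> * z\<^sup>2 / \<tau>) *
        jacobi_theta b a \<tau> z"
proof -
  have \<tau>0: "\<tau> \<noteq> 0" using \<tau> by auto
  obtain a' :: int where a': "a = of_int a'" using ab by (metis insertE of_int_0 of_int_1 singletonD)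
  define w where "w = of_real a / 2 - z - of_real b * \<tau> / 2"
  define E where "E = exp (of_real pi * \<i> * (z + of_real b * \<tau> / 2)\<^sup>2 / \<tau>)"
  have "jacobi_theta a b (- 1 / \<tau>) (z / \<tau>) = (\<Sum>\<^sub>\<infinity>n::int. E * exp (- (of_real pi * \<i> * (w + of_int n)\<^sup>2 / \<tau>)))"
    unfolding jacobi_theta_def E_def w_def mult_exp_exp using \<tau>0
    by (intro infsum_cong arg_cong[where f = exp]) (simp add: field_simps power2_eq_square)
  also have "\<dots> = E * (csqrt (- \<i> * \<tau>) * (\<Sum>\<^sub>\<infinity>n::int. exp (of_real pi * \<i> * (of_int n)\<^sup>2 * \<tau> + 2 * of_real pi *
      \<i> * of_int n * w)))"
    unfolding infsum_cmult_right' theta_inversion[OF \<tau>] ..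
  also have "(\<Sum>\<^sub>\<infinity>n::int. exp (of_real pi * \<i> * (of_int n)\<^sup>2 * \<tau> + 2 * of_real pi * \<i> * of_int n * w)) = 
     (\<Sum>\<^sub>\<infinity>n::int. exp (of_real pi * \<i> * (of_int n)\<^sup>2 * \<tau> - 2 * of_real pi * \<i> * of_int n * w))"
    by (rule infsum_reindex_bij_witness[of _ uminus uminus]) auto
  also have "E * (csqrt (- \<i> * \<tau>) * \<dots>) = csqrt (- \<i> * \<tau>) * (\<Sum>\<^sub>\<infinity>n::int. E * exp (of_real pi * \<i> * (of_int n)\<^sup>2 *
      \<tau> - 2 * of_real pi * \<i> * of_int n * w))"
    by (simp add: infsum_cmult_right')
  also have "(\<Sum>\<^sub>\<infinity>n::int. E * exp (of_real pi * \<i> * (of_int n)\<^sup>2 * \<tau> - 2 * of_real pi * \<i> * of_int n * w)) =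
     (\<Sum>\<^sub>\<infinity>n::int. (exp (- (of_real pi * \<i> / 2 * of_real (a * b))) * exp (of_real pi * \<i> * z\<^sup>2 / \<tau>)) * 
        exp (of_real pi * \<i> * \<tau> * (of_int n + of_real b / 2)\<^sup>2 + 2 * of_real pi * \<i> * (of_int n + of_real b /
            2) * (z + of_real a / 2)))"
    unfolding E_def w_def mult_exp_exp using \<tau>0
    by (intro infsum_cong, rule_tac k = "- (x * a')" in exp_eq_2pi_intI) (simp add: field_simps power2_eq_square a')
  finally show ?thesis
    by (simp add: infsum_cmult_right' jacobi_theta_def)
qed

lemma jacobi_theta_1_T: "jacobi_theta 1 b (\<tau> + 1) z = exp (of_real pi * \<i> / 4) * jacobi_theta 1 b \<tau> z"
  unfolding jacobi_theta_def infsum_cmult_right'[symmetric] mult_exp_exp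
proof (rule infsum_cong)
  fix n :: int
  have "even (n * (n + 1))" by simp
  then obtain k where k: "n * (n + 1) = 2 * k" by (elim evenE)
  then have k': "complex_of_int n * of_int n = 2 * of_int k - of_int n"
    by (metis add_diff_cancel_right' distrib_left mult.right_neutral of_int_diff of_int_mult of_int_numeral)
  show "exp (of_real pi * \<i> * (\<tau> + 1) * (of_int n + of_real 1 / 2)\<^sup>2 + 2 * of_real pi * \<i> * (of_int n +
      of_real 1 / 2) * (z + of_real b / 2)) =
     exp (of_real pi * \<i> / 4 + (of_real pi * \<i> * \<tau> * (of_int n + of_real 1 / 2)\<^sup>2 + 2 * of_real pi * \<i> *
         (of_int n + of_real 1 / 2) * (z + of_real b / 2)))"
  proof (rule exp_eq_2pi_intI[where k = k])
    have "of_real pi * \<i> * (of_int n * of_int n + of_int n) = 2 * of_real pi * \<i> * of_int k"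
      by (simp add: k')
    then show "of_real pi * \<i> * (\<tau> + 1) * (of_int n + of_real 1 / 2)\<^sup>2 + 2 * of_real pi * \<i> * (of_int n +
        of_real 1 / 2) * (z + of_real b / 2) =
      of_real pi * \<i> / 4 + (of_real pi * \<i> * \<tau> * (of_int n + of_real 1 / 2)\<^sup>2 + 2 * of_real pi * \<i> * (of_int n +
          of_real 1 / 2) * (z + of_real b / 2)) + 2 * of_real pi * \<i> * of_int k"
      by (simp add: power2_eq_square algebra_simps)
  qed
qed

lemma jacobi_theta_0_T: 
  assumes "b \<in> {0, 1}"
  shows "jacobi_theta 0 b (\<tau> + 1) z = jacobi_theta 0 (1 - b) \<tau> z"
  unfolding jacobi_theta_def
proof (rule infsum_cong)
  fix n :: int
  obtain b' :: int where b': "b = of_int b'" using assms by (metis insertE of_int_0 of_int_1 singletonD)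
  have "even (n * (n - 1))" by simp
  then obtain k where k: "n * (n - 1) = 2 * k" by (elim evenE)
  then have k': "complex_of_int n * of_int n = 2 * of_int k + of_int n"
    by (metis diff_add_cancel right_diff_distrib mult.right_neutral of_int_add of_int_mult of_int_numeral)
  show "exp (of_real pi * \<i> * (\<tau> + 1) * (of_int n + of_real 0 / 2)\<^sup>2 + 2 * of_real pi * \<i> * (of_int n +
      of_real 0 / 2) * (z + of_real b / 2)) =
     exp (of_real pi * \<i> * \<tau> * (of_int n + of_real 0 / 2)\<^sup>2 + 2 * of_real pi * \<i> * (of_int n + of_real 0 / 2) *
         (z + of_real (1 - b) / 2))"
  proof (rule exp_eq_2pi_intI[where k = "k + b' * n"])
    have "of_real pi * \<i> * (of_int n * of_int n) = 2 * of_real pi * \<i> * of_int k + of_real pi * \<i> * of_int n"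
      by (simp add: k' algebra_simps)
    then show "of_real pi * \<i> * (\<tau> + 1) * (of_int n + of_real 0 / 2)\<^sup>2 + 2 * of_real pi * \<i> * (of_int n +
        of_real 0 / 2) * (z + of_real b / 2) =
      of_real pi * \<i> * \<tau> * (of_int n + of_real 0 / 2)\<^sup>2 + 2 * of_real pi * \<i> * (of_int n + of_real 0 / 2) * (z +
          of_real (1 - b) / 2) + 2 * of_real pi * \<i> * of_int (k + b' * n)"
      by (simp add: power2_eq_square field_simps b')
  qed
qed

text \<open>
  Reflecting the summation index about the point where the quadratic exponent is symmetric changes
  the sign of every term.
\<close>

lemma jacobi_theta_eq_0:
  assumes z: "z = of_real e + of_real e' * \<tau> + of_int p + of_int r * \<tau>"
  shows "jacobi_theta (1 - 2 * e') (1 - 2 * e) \<tau> z = 0"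
proof -
  define f where "f n = exp (of_real pi * \<i> * \<tau> * (of_int n + of_real (1 - 2 * e') / 2)\<^sup>2 + 2 * of_real pi * \<i> *
      (of_int n + of_real (1 - 2 * e') / 2) * (z + of_real (1 - 2 * e) / 2))" for n :: int
  have "f n = - f (- n - 2 * r - 1)" for n
  proof -
    have "- f (- n - 2 * r - 1) = exp (of_real pi * \<i>) * f (- n - 2 * r - 1)" by simp
    also have "\<dots> = f n"
      unfolding f_def mult_exp_exp z
      by (rule exp_eq_2pi_intI[where k = "- (n + r) * (1 + 2 * p) - p"]) (simp add: field_simps power2_eq_square)
    finally show ?thesis by simp
  qed
  then have "(\<Sum>\<^sub>\<infinity>n. f n) = (\<Sum>\<^sub>\<infinity>n. - f (- n - 2 * r - 1))" by (rule infsum_cong)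
  also have "\<dots> = (\<Sum>\<^sub>\<infinity>n. - f n)"
    by (rule infsum_reindex_bij_witness[of _ "\<lambda>n. - n - 2 * r - 1" "\<lambda>n. - n - 2 * r - 1"]) auto
  also have "\<dots> = - (\<Sum>\<^sub>\<infinity>n. f n)" by (rule infsum_uminus)
  finally have "(\<Sum>\<^sub>\<infinity>n. f n) = 0" by simp
  then show ?thesis by (simp add: jacobi_theta_def f_def)
qed

section \<open>Pentagonal numbers and the eta function\<close>

lemma qpow_mult: "qpow \<tau> x * qpow \<tau> y = qpow \<tau> (x + y)"
  by (simp add: qpow_def mult_exp_exp algebra_simps)

lemma norm_qpow_real: "norm (qpow \<tau> (of_real x)) = exp (- 2 * pi * Im \<tau> * x)"
  by (simp add: qpow_def)

text \<open>
  Shanks' finite form of Euler's pentagonal number theorem. Passing from \<open>n\<close> to \<open>Suc n\<close> changes the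
  terms on the left by differences \<open>W (s - 1) - W s\<close>, so the total change is a single boundary term;
  together with the new term it gives the two new terms on the right.
\<close>

lemma pentagonal_finite:
  fixes \<tau> :: complex
  defines "Q \<equiv> \<lambda>s n. \<Prod>i\<in>{s<..n}. 1 - qpow \<tau> (of_nat i)"
  shows "(\<Sum>s\<le>n. (-1) ^ s * Q s n * qpow \<tau> (of_nat s * of_nat n + of_nat s * (of_nat s + 1) / 2)) = 
         (\<Sum>s\<in>{- int n..int n}. (-1) powi s * qpow \<tau> (of_int s * (3 * of_int s + 1) / 2))"
proof (induction n)
  case 0
  show ?case by (simp add: Q_def qpow_def)
next
  case (Suc n)
  define T where "T n s = (-1) ^ s * Q s n * qpow \<tau> (of_nat s * of_nat n + of_nat s * (of_nat s + 1) / 2)" for n s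
  define W where "W s = T n s * qpow \<tau> (of_nat s + of_nat n + 1)" for s
  have Q_Suc: "Q s (Suc n) = Q s n * (1 - qpow \<tau> (of_nat n + 1))" if "s \<le> n" for s
  proof -
    have "{s<..Suc n} = insert (Suc n) {s<..n}" using that by auto
    then show ?thesis by (simp add: Q_def add.commute)
  qed
  have Q_below: "Q s n = (1 - qpow \<tau> (of_nat s + 1)) * Q (Suc s) n" if "Suc s \<le> n" for s
  proof -
    have "{s<..n} = insert (Suc s) {Suc s<..n}" using that by auto
    then show ?thesis by (simp add: Q_def add.commute)
  qed
  have Tstep: "T (Suc n) s = T n s * (qpow \<tau> (of_nat s) - qpow \<tau> (of_nat s + of_nat n + 1))" if "s \<le> n" for s
  proof -
    have "qpow \<tau> (of_nat s * of_nat (Suc n) + of_nat s * (of_nat s + 1) / 2) = 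
        qpow \<tau> (of_nat s * of_nat n + of_nat s * (of_nat s + 1) / 2) * qpow \<tau> (of_nat s)"
      by (simp add: qpow_mult algebra_simps)
    moreover have "qpow \<tau> (of_nat s + of_nat n + 1) = qpow \<tau> (of_nat s) * qpow \<tau> (of_nat n + 1)"
      by (simp add: qpow_mult add_ac)
    ultimately show ?thesis by (simp add: T_def Q_Suc[OF that] algebra_simps)
  qed
  have TW: "T n (Suc s) * (1 - qpow \<tau> (of_nat (Suc s))) = - W s" if "Suc s \<le> n" for s
  proof -
    have "qpow \<tau> (of_nat (Suc s) * of_nat n + of_nat (Suc s) * (of_nat (Suc s) + 1) / 2) = 
        qpow \<tau> (of_nat s * of_nat n + of_nat s * (of_nat s + 1) / 2) * qpow \<tau> (of_nat s + of_nat n + 1)"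
      unfolding qpow_mult by (rule arg_cong[where f = "qpow \<tau>"]) (simp add: field_simps)
    then show ?thesis
      by (simp add: T_def W_def Q_below[OF that] add.commute[of 1])
  qed
  have diff: "T (Suc n) s - T n s = - W s - T n s * (1 - qpow \<tau> (of_nat s))" if "s \<le> n" for s
    unfolding Tstep[OF that] W_def by (simp add: algebra_simps)
  have tel: "(\<Sum>s\<le>k. T (Suc n) s - T n s) = - W k" if "k \<le> n" for k
    using that
  proof (induction k)
    case 0
    show ?case using diff[of 0] by (simp add: qpow_def)
  next
    case (Suc k)
    then show ?case using diff[of "Suc k"] TW[of k] by simp
  qed
  have Wn: "- W n = (-1) ^ Suc n * qpow \<tau> (of_int (- int (Suc n)) * (3 * of_int (- int (Suc n)) + 1) / 2)"
  proof -
    have "W n = (-1) ^ n * (qpow \<tau> (of_nat n * of_nat n + of_nat n * (of_nat n + 1) / 2) * qpow \<tau> (of_nat n +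
        of_nat n + 1))"
      by (simp add: W_def T_def Q_def)
    also have "qpow \<tau> (of_nat n * of_nat n + of_nat n * (of_nat n + 1) / 2) * qpow \<tau> (of_nat n + of_nat n + 1) = 
       qpow \<tau> (of_int (- int (Suc n)) * (3 * of_int (- int (Suc n)) + 1) / 2)"
      unfolding qpow_mult by (rule arg_cong[where f = "qpow \<tau>"]) (simp add: field_simps)
    finally show ?thesis by simp
  qed
  have Tn: "T (Suc n) (Suc n) = (-1) ^ Suc n * qpow \<tau> (of_int (int (Suc n)) * (3 * of_int (int (Suc n)) + 1) / 2)"
    unfolding T_def Q_def by (simp, intro arg_cong[where f = "qpow \<tau>"]) (simp add: field_simps)
  have "(\<Sum>s\<le>Suc n. T (Suc n) s) = (\<Sum>s\<le>n. T n s) + (\<Sum>s\<le>n. T (Suc n) s - T n s) + T (Suc n) (Suc n)"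
    by (simp add: sum_subtractf)
  also have "\<dots> = (\<Sum>s\<le>n. T n s) + - W n + T (Suc n) (Suc n)" by (simp add: tel)
  also have "(\<Sum>s\<le>n. T n s) = (\<Sum>s\<in>{- int n..int n}. (-1) powi s * qpow \<tau> (of_int s * (3 * of_int s + 1) / 2))"
    using Suc.IH by (simp add: T_def)
  also have "\<dots> + - W n + T (Suc n) (Suc n) = (\<Sum>s\<in>{- int (Suc n)..int (Suc n)}. (-1) powi s * qpow \<tau> (of_int s *
      (3 * of_int s + 1) / 2))"
  proof -
    have ins: "{- int (Suc n)..int (Suc n)} = insert (- int (Suc n)) (insert (int (Suc n)) {- int n..int n})" by auto
    have pow: "(-1 :: complex) powi (- int (Suc n)) = (-1) ^ Suc n" "(-1 :: complex) powi (int (Suc n)) =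
        (-1) ^ Suc n"
      by (simp_all add: minus_one_powi) 
    show ?thesis
      unfolding ins by (subst sum.insert, simp, simp, subst sum.insert, simp, simp) (simp only: pow Wn Tn, simp)
  qed
  finally show ?case by (simp add: T_def)
qed

text \<open>
  In the finite pentagonal identity the term with \<open>s = 0\<close> is the partial product of the eta function,
  and each of the other \<open>n\<close> terms is at most a constant times \<open>\<bar>q\<bar>\<^sup>n\<close>.
\<close>

lemma dedekind_eta_series:
  assumes \<tau>: "Im \<tau> > 0"
  shows "dedekind_eta \<tau> = (\<Sum>\<^sub>\<infinity>n::int. exp (3 * of_real pi * \<i> * \<tau> * (of_int n + 1/6)\<^sup>2 + of_real pi * \<i> * of_int n))"
proof -
  define x where "x = norm (qpow \<tau> 1)"
  have x: "0 < x" "x < 1"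
    using norm_qpow_real[of \<tau> 1] \<tau> by (auto simp: x_def)
  have nq: "norm (qpow \<tau> (of_nat k)) = x ^ k" for k
    using norm_qpow_real[of \<tau> "real k"] norm_qpow_real[of \<tau> 1] by (simp add: x_def exp_of_nat_mult[symmetric] mult_ac)
  have nq1: "norm (qpow \<tau> (of_real y)) \<le> 1" if "y \<ge> 0" for y
    using that \<tau> by (simp add: norm_qpow_real)
  define P where "P n = (\<Prod>i\<in>{0<..n}. 1 - qpow \<tau> (of_nat i))" for n :: nat
  define Q where "Q s n = (\<Prod>i\<in>{s<..n}. 1 - qpow \<tau> (of_nat i))" for s n :: nat
  have geo: "summable (\<lambda>n. x ^ Suc n)" using x by (intro summable_Suc_iff[THEN iffD2] summable_geometric) auto
  have P_lim: "P \<longlonglongrightarrow> (\<Prod>n. 1 - qpow \<tau> (of_nat (Suc n)))"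
  proof -
    have "summable (\<lambda>n. norm (1 - qpow \<tau> (of_nat (Suc n)) - 1))"
    proof -
      have "norm (1 - qpow \<tau> (of_nat (Suc n)) - 1) = x ^ Suc n" for n
        using nq[of "Suc n"] by (simp del: of_nat_Suc power_Suc)
      then show ?thesis using geo by (simp del: of_nat_Suc power_Suc)
    qed
    then have "convergent_prod (\<lambda>n. 1 - qpow \<tau> (of_nat (Suc n)))"
      by (intro abs_convergent_prod_imp_convergent_prod) (simp add: abs_convergent_prod_conv_summable)
    then have "(\<lambda>n. \<Prod>i\<le>n. 1 - qpow \<tau> (of_nat (Suc i))) \<longlonglongrightarrow> (\<Prod>n. 1 - qpow \<tau> (of_nat (Suc n)))"
      by (rule convergent_prod_LIMSEQ)
    moreover have "(\<Prod>i\<le>n. 1 - qpow \<tau> (of_nat (Suc i))) = P (Suc n)" for n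
      unfolding P_def by (rule prod.reindex_bij_witness[of _ "\<lambda>i. i - 1" Suc]) auto
    ultimately show ?thesis by (simp add: filterlim_sequentially_Suc[of P] flip: of_nat_Suc)
  qed
  define C where "C = exp (\<Sum>n. x ^ Suc n)"
  have Q_bd: "norm (Q s n) \<le> C" for s n
  proof -
    have "norm (Q s n) = (\<Prod>i\<in>{s<..n}. norm (1 - qpow \<tau> (of_nat i)))" by (simp add: Q_def prod_norm)
    also have "\<dots> \<le> (\<Prod>i\<in>{s<..n}. exp (x ^ i))"
    proof (rule prod_mono, intro conjI)
      fix i
      have "norm (1 - qpow \<tau> (of_nat i)) \<le> 1 + x ^ i" using norm_triangle_ineq4[of 1 "qpow \<tau> (of_nat i)"] by
          (simp add: nq)
      also have "\<dots> \<le> exp (x ^ i)" by (rule exp_ge_add_one_self)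
      finally show "norm (1 - qpow \<tau> (of_nat i)) \<le> exp (x ^ i)" .
    qed auto
    also have "\<dots> = exp (\<Sum>i\<in>{s<..n}. x ^ i)" by (simp add: exp_sum)
    also have "(\<Sum>i\<in>{s<..n}. x ^ i) \<le> (\<Sum>i\<in>{0<..n}. x ^ i)" using x by (intro sum_mono2) auto
    also have "(\<Sum>i\<in>{0<..n}. x ^ i) = (\<Sum>i<n. x ^ Suc i)"
      by (rule sum.reindex_bij_witness[of _ Suc "\<lambda>i. i - 1"]) auto
    also have "\<dots> \<le> (\<Sum>n. x ^ Suc n)" using x by (intro sum_le_suminf geo) auto
    finally show ?thesis by (simp add: C_def)
  qed
  define T where "T n s = (-1) ^ s * Q s n * qpow \<tau> (of_nat s * of_nat n + of_nat s * (of_nat s + 1) /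
      2)" for n s :: nat
  have T_bd: "norm (T n s) \<le> C * x ^ n" if "1 \<le> s" for n s
  proof -
    have "norm (T n s) = norm (Q s n) * (norm (qpow \<tau> (of_nat (s * n))) * norm (qpow \<tau> (of_real (real s *
        (real s + 1) / 2))))"
    proof -
      have "T n s = (-1) ^ s * (Q s n * (qpow \<tau> (of_nat (s * n)) * qpow \<tau> (of_real (real s * (real s + 1) / 2))))"
        by (simp add: T_def qpow_mult)
      then show ?thesis by (simp only: norm_mult norm_power norm_minus_cancel norm_one power_one mult_1_left)
    qed
    also have "\<dots> \<le> C * (x ^ n * 1)"
    proof (intro mult_mono Q_bd nq1)
      show "norm (qpow \<tau> (of_nat (s * n))) \<le> x ^ n"
        unfolding nq using x that by (intro power_decreasing) auto
    qed (use x in \<open>auto simp: C_def\<close>)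
    finally show ?thesis by simp
  qed
  have R_lim: "(\<lambda>n. \<Sum>s\<in>{1..n}. T n s) \<longlonglongrightarrow> 0"
  proof (rule Lim_null_comparison)
    show "\<forall>\<^sub>F n in sequentially. norm (\<Sum>s\<in>{1..n}. T n s) \<le> C * (real n * x ^ n)"
    proof (rule always_eventually, rule allI)
      fix n
      have "norm (\<Sum>s\<in>{1..n}. T n s) \<le> of_nat (card {1..n}) * (C * x ^ n)"
        by (rule sum_norm_bound) (use T_bd in auto)
      then show "norm (\<Sum>s\<in>{1..n}. T n s) \<le> C * (real n * x ^ n)" by (simp add: mult_ac)
    qed
    have "(\<lambda>n. real n * x ^ n) \<longlonglongrightarrow> 0" using powser_times_n_limit_0[of x] x by simp
    from tendsto_mult_right_zero[OF this, of C] show "(\<lambda>n. C * (real n * x ^ n)) \<longlonglongrightarrow> 0" .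
  qed
  have "(\<lambda>n. P n + (\<Sum>s\<in>{1..n}. T n s)) \<longlonglongrightarrow> (\<Prod>n. 1 - qpow \<tau> (of_nat (Suc n))) + 0"
    by (intro tendsto_add P_lim R_lim)
  also have "(\<lambda>n. P n + (\<Sum>s\<in>{1..n}. T n s)) = (\<lambda>n. \<Sum>s\<in>{- int n..int n}. (-1) powi s * qpow \<tau> (of_int s * (3 *
      of_int s + 1) / 2))"
  proof
    fix n :: nat
    have "{..n} = insert 0 {1..n}" by auto
    then have "(\<Sum>s\<le>n. T n s) = P n + (\<Sum>s\<in>{1..n}. T n s)"
      by (simp add: T_def P_def Q_def qpow_def)
    then show "P n + (\<Sum>s\<in>{1..n}. T n s) = (\<Sum>s\<in>{- int n..int n}. (-1) powi s * qpow \<tau> (of_int s * (3 * of_int s +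
        1) / 2))"
      using pentagonal_finite[of \<tau> n] by (simp add: T_def Q_def)
  qed
  finally have 1: "(\<lambda>n. \<Sum>s\<in>{- int n..int n}. (-1) powi s * qpow \<tau> (of_int s * (3 * of_int s + 1) /
      2)) \<longlonglongrightarrow> (\<Prod>n. 1 - qpow \<tau> (of_nat (Suc n)))"
    by simp
  have trm: "(-1) powi s * qpow \<tau> (of_int s * (3 * of_int s + 1) / 2) = exp (of_real pi * \<i> * (of_int s)\<^sup>2 *
      (3 * \<tau>) + 2 * of_real pi * \<i> * of_int s * (\<tau> / 2 + 1 / 2))" for s :: int
    unfolding exp_pi_i_int[symmetric] qpow_def mult_exp_exp
    by (rule arg_cong[where f = exp]) (simp add: field_simps power2_eq_square)
  have "(\<lambda>s. (-1) powi s * qpow \<tau> (of_int s * (3 * of_int s + 1) / 2)) summable_on UNIV"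
    unfolding trm by (rule abs_summable_summable, rule summable_on_gauss_complex) (use \<tau> in auto)
  then have "(\<lambda>n. \<Sum>s\<in>{- int n..int n}. (-1) powi s * qpow \<tau> (of_int s * (3 * of_int s + 1) / 2)) \<longlonglongrightarrow>
      (\<Sum>\<^sub>\<infinity>s. (-1) powi s * qpow \<tau> (of_int s * (3 * of_int s + 1) / 2))"
    by (intro has_sum_int_tendsto) simp
  with 1 have "(\<Prod>n. 1 - qpow \<tau> (of_nat (Suc n))) = (\<Sum>\<^sub>\<infinity>s. (-1) powi s * qpow \<tau> (of_int s * (3 * of_int s + 1) / 2))"
    by (rule LIMSEQ_unique)
  then have "dedekind_eta \<tau> = (\<Sum>\<^sub>\<infinity>s::int. qpow \<tau> (1/24) * ((-1) powi s * qpow \<tau> (of_int s * (3 * of_int s + 1) / 2)))"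
    by (simp add: dedekind_eta_def infsum_cmult_right')
  also have "\<dots> = (\<Sum>\<^sub>\<infinity>n::int. exp (3 * of_real pi * \<i> * \<tau> * (of_int n + 1/6)\<^sup>2 + of_real pi * \<i> * of_int n))"
    unfolding exp_pi_i_int[symmetric] qpow_def mult_exp_exp
    by (intro infsum_cong arg_cong[where f = exp]) (simp add: field_simps power2_eq_square)
  finally show ?thesis .
qed

text \<open>
  The inversion formula at \<open>\<tau>/3\<close> gives a series over half-integers, which splits into the three
  residue classes modulo 3: one of them is odd and cancels, the other two are multiples of the eta
  series by \<open>exp (\<plusminus> pi \<i>/6)\<close>, and the sum of these two factors is the square root of 3.
\<close>

lemma dedekind_eta_S:
  assumes \<tau>: "Im \<tau> > 0"
  shows "dedekind_eta (- 1 / \<tau>) = csqrt (- \<i> * \<tau>) * dedekind_eta \<tau>"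
proof -
  have \<tau>0: "\<tau> \<noteq> 0" using \<tau> by auto
  define \<sigma> where "\<sigma> = \<tau> / 3"
  have \<sigma>: "Im \<sigma> > 0" "\<sigma> \<noteq> 0" using \<tau> \<tau>0 by (auto simp: \<sigma>_def)
  define w where "w = 1/6 - \<sigma> / 2"
  define E where "E = exp (of_real pi * \<i> * \<sigma> / 4 - of_real pi * \<i> / 6)"
  define g where "g k = exp (of_real pi * \<i> * \<sigma> * (of_int k - 1/2)\<^sup>2 + of_real pi * \<i> / 3 * (of_int k -
      1/2))" for k :: int
  define h where "h n = exp (3 * of_real pi * \<i> * \<tau> * (of_int n + 1/6)\<^sup>2 + of_real pi * \<i> * of_int n)" for n :: int
  have Im_S: "Im (- 1 / \<tau>) > 0" using \<tau> \<tau>0 by (simp add: Im_divide power2_eq_square add_pos_nonneg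
      sum_squares_gt_zero_iff complex_eq_iff)
  have g: "g k = E * exp (of_real pi * \<i> * (of_int k)\<^sup>2 * \<sigma> + 2 * of_real pi * \<i> * of_int k * w)" for k
    unfolding g_def E_def w_def mult_exp_exp by (rule arg_cong[where f =
        exp]) (simp add: field_simps power2_eq_square)
  have g_sm: "g summable_on UNIV"
    unfolding g[abs_def] by (rule summable_on_cmult_right[OF abs_summable_summable[OF
        summable_on_gauss_complex[OF \<sigma>(1)]]])
  have "dedekind_eta (- 1 / \<tau>) = (\<Sum>\<^sub>\<infinity>n::int. E * exp (- (of_real pi * \<i> * (w + of_int n)\<^sup>2 / \<sigma>)))"
    unfolding dedekind_eta_series[OF Im_S] E_def w_def mult_exp_exp using \<tau>0 
    by (intro infsum_cong arg_cong[where f = exp]) (simp add: \<sigma>_def field_simps power2_eq_square)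
  also have "\<dots> = csqrt (- \<i> * \<sigma>) * (\<Sum>\<^sub>\<infinity>n::int. g n)"
    unfolding g infsum_cmult_right' theta_inversion[OF \<sigma>(1)] by simp
  also have "(\<Sum>\<^sub>\<infinity>n::int. g n) = (\<Sum>\<^sub>\<infinity>l. g (0 + 3 * l)) + (\<Sum>\<^sub>\<infinity>l. g (1 + 3 * l)) + (\<Sum>\<^sub>\<infinity>l. g (2 + 3 * l))"
  proof -
    have "{0..<3} = {0, 1, 2 :: int}" by auto
    then show ?thesis using infsum_int_residues[OF _ g_sm, of 3] by (simp add: add_ac)
  qed
  also have "(\<Sum>\<^sub>\<infinity>l. g (0 + 3 * l)) = (\<Sum>\<^sub>\<infinity>l. exp (- (of_real pi * \<i> / 6)) * h l)"
  proof -
    have "(\<Sum>\<^sub>\<infinity>l. g (0 + 3 * l)) = (\<Sum>\<^sub>\<infinity>l. g (- (3 * l)))"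
      by (rule infsum_reindex_bij_witness[of _ uminus uminus]) auto
    also have "\<dots> = (\<Sum>\<^sub>\<infinity>l. exp (- (of_real pi * \<i> / 6)) * h l)"
      unfolding g_def h_def mult_exp_exp
      by (intro infsum_cong, rule_tac k = "- x" in exp_eq_2pi_intI) (simp add: \<sigma>_def field_simps power2_eq_square)
    finally show ?thesis .
  qed
  also have "(\<Sum>\<^sub>\<infinity>l. g (1 + 3 * l)) = (\<Sum>\<^sub>\<infinity>l. exp (of_real pi * \<i> / 6) * h l)"
    unfolding g_def h_def mult_exp_exp
    by (intro infsum_cong arg_cong[where f = exp]) (simp add: \<sigma>_def field_simps power2_eq_square)
  \<comment> \<open>this class is antisymmetric under \<open>l \<mapsto> - 1 - l\<close>\<close>
  also have "(\<Sum>\<^sub>\<infinity>l. g (2 + 3 * l)) = 0"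
  proof -
    have "g (2 + 3 * (- 1 - l)) = - g (2 + 3 * l)" for l
    proof -
      have "g (2 + 3 * (- 1 - l)) = exp (of_real pi * \<i>) * g (2 + 3 * l)"
        unfolding g_def mult_exp_exp
        by (rule exp_eq_2pi_intI[where k = "- l - 1"]) (simp add: field_simps power2_eq_square)
      then show ?thesis by simp
    qed
    then have "(\<Sum>\<^sub>\<infinity>l. g (2 + 3 * l)) = (\<Sum>\<^sub>\<infinity>l. - g (2 + 3 * l))"
      by (intro infsum_reindex_bij_witness[of _ "\<lambda>l. - 1 - l" "\<lambda>l. - 1 - l"]) auto
    then show ?thesis by (simp add: infsum_uminus)
  qed
  finally have "dedekind_eta (- 1 / \<tau>) = csqrt (- \<i> * \<sigma>) * (exp (- (of_real pi * \<i> / 6)) + exp (of_real pi * \<i> /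
      6)) * dedekind_eta \<tau>"
    unfolding dedekind_eta_series[OF \<tau>] h_def[symmetric] infsum_cmult_right' by (simp add: algebra_simps)
  also have "exp (- (of_real pi * \<i> / 6)) + exp (of_real pi * \<i> / 6) = complex_of_real (sqrt 3)"
  proof -
    have "exp (- (of_real pi * \<i> / 6)) + exp (of_real pi * \<i> / 6) = of_real (2 * cos (pi / 6))"
      by (simp add: complex_eq_iff Re_exp Im_exp)
    then show ?thesis by (simp add: cos_30)
  qed
  also have "csqrt (- \<i> * \<sigma>) * complex_of_real (sqrt 3) = csqrt (- \<i> * \<tau>)"
  proof -
    have "csqrt (- \<i> * \<tau>) = csqrt (of_real 3 * (- \<i> * \<sigma>))" by (simp add: \<sigma>_def)
    also have "\<dots> = of_real (sqrt 3) * csqrt (- \<i> * \<sigma>)"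
    proof (rule csqrt_unique)
      show "(of_real (sqrt 3) * csqrt (- \<i> * \<sigma>))\<^sup>2 = of_real 3 * (- \<i> * \<sigma>)"
        by (simp add: power_mult_distrib flip: of_real_power)
      show "0 < Re (of_real (sqrt 3) * csqrt (- \<i> * \<sigma>)) \<or> Re (of_real (sqrt 3) * csqrt (- \<i> * \<sigma>)) = 0 \<and> 0 \<le>
          Im (of_real (sqrt 3) * csqrt (- \<i> * \<sigma>))"
      proof -
        have "0 < Re (of_real (sqrt 3) * d) \<or> Re (of_real (sqrt 3) * d) = 0 \<and> 0 \<le> Im (of_real (sqrt 3) * d)"
          if "0 < Re d \<or> Re d = 0 \<and> 0 \<le> Im d" for d
          using that by auto
        then show ?thesis using csqrt_principal by blast
      qed
    qed
    finally show ?thesis by simp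
  qed
  finally show ?thesis .
qed


lemma dedekind_eta_T: "dedekind_eta (\<tau> + 1) = exp (of_real pi * \<i> / 12) * dedekind_eta \<tau>"
proof -
  have "qpow (\<tau> + 1) (of_nat n) = qpow \<tau> (of_nat n)" for n
    unfolding qpow_def by (rule exp_eq_2pi_intI[where k = "int n"]) (simp add: algebra_simps)
  moreover have "qpow (\<tau> + 1) (1/24) = exp (of_real pi * \<i> / 12) * qpow \<tau> (1/24)"
    unfolding qpow_def mult_exp_exp by (rule arg_cong[where f = exp]) (simp add: field_simps)
  ultimately show ?thesis
    by (simp add: dedekind_eta_def del: of_nat_Suc)
qed

section \<open>The denominators\<close>

text \<open>
  The five square roots of \<open>- \<i> \<tau>\<close> in the numerator against three in the denominator leave
  \<open>- \<i> \<tau>\<close>. With \<open>w = z1 + z2\<close> and \<open>v = (z1 - z2)/2\<close>, the Gaussian factors combine to the exponent of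
  \<open>w\<^sup>2 + v\<^sup>2 - z1\<^sup>2 - z2\<^sup>2 - w\<^sup>2/4 = z1 z2\<close>, which the shift of \<open>t\<close> removes.
\<close>

lemma R_hat_S:
  assumes \<tau>: "Im \<tau> > 0" and e: "eps \<in> {0, 1/2}" and e': "eps' \<in> {0, 1/2}"
  shows "\<i> powi \<lfloor>4 * eps * eps' + 2 * eps - 2 * eps'\<rfloor> * R_hat eps eps' (- 1 / \<tau>) (z1 / \<tau>) (z2 / \<tau>) (t - z1 * z2 / \<tau>)
     = (-1) powi \<lfloor>2 * eps'\<rfloor> * \<tau> * R_hat eps' eps \<tau> z1 z2 t"
proof -
  have \<tau>0: "\<tau> \<noteq> 0" using \<tau> by auto
  define c where "c = csqrt (- \<i> * \<tau>)"
  have c2: "c * c = - \<i> * \<tau>" unfolding c_def by (metis power2_csqrt power2_eq_square)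
  have c0: "c \<noteq> 0" using \<tau>0 by (simp add: c_def)
  define E where "E z = exp (of_real pi * \<i> * z\<^sup>2 / \<tau>)" for z
  define p where "p = exp (- (of_real pi * \<i> / 2 * of_real (1 * 1)))"
  define r where "r = exp (- (of_real pi * \<i> / 2 * of_real ((1 - 2 * eps') * (1 - 2 * eps))))"
  define X where "X z = jacobi_theta 1 1 \<tau> z" for z
  define Y where "Y z = jacobi_theta (1 - 2 * eps) (1 - 2 * eps') \<tau> z" for z
  define H where "H = dedekind_eta \<tau>"
  have X: "jacobi_theta 1 1 (- 1 / \<tau>) (z / \<tau>) = p * c * E z * X z" for z
    unfolding p_def c_def E_def X_def by (rule jacobi_theta_S[OF \<tau>]) auto
  have Y: "jacobi_theta (1 - 2 * eps') (1 - 2 * eps) (- 1 / \<tau>) (z / \<tau>) = r * c * E z * Y z" for z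
    unfolding r_def c_def E_def Y_def by (rule jacobi_theta_S[OF \<tau>]) (use e' in auto)
  have H: "dedekind_eta (- 1 / \<tau>) = c * H" unfolding c_def H_def by (rule dedekind_eta_S[OF \<tau>])
  have nz: "r \<noteq> 0" "E z \<noteq> 0" for z by (auto simp: r_def E_def)
  define w v u where "w = z1 + z2" and "v = (z1 - z2) / 2" and "u = (z1 + z2) / 2"
  have args: "z1 / \<tau> + z2 / \<tau> = w / \<tau>" "(z1 / \<tau> - z2 / \<tau>) / 2 = v / \<tau>" "w / \<tau> / 2 = u / \<tau>"
    using \<tau>0 by (auto simp: w_def v_def u_def field_simps)
  define L where "L = R_hat eps eps' (- 1 / \<tau>) (z1 / \<tau>) (z2 / \<tau>) (t - z1 * z2 / \<tau>)"
  have "L = c_osp eps eps' * exp (of_real pi * \<i> * (t - z1 * z2 / \<tau>)) * ((c * H) ^ 3 * (p * c * E w * X w) *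
      (p * c * E v * X v))
       / ((r * c * E z1 * Y z1) * (r * c * E z2 * Y z2) * (r * c * E u * Y u))"
    unfolding L_def R_hat_def args X Y H ..
  also have "\<dots> = c_osp eps eps' * (p * p * (c * c) / r ^ 3) * (exp (of_real pi * \<i> * (t - z1 * z2 / \<tau>)) * E w *
      E v / (E z1 * E z2 * E u)) * 
       (H ^ 3 * X w * X v / (Y z1 * Y z2 * Y u))"
  proof (cases "Y z1 * Y z2 * Y u = 0")
    case False
    then show ?thesis using c0 nz by (simp add: field_simps power3_eq_cube)
  qed auto
  also have "exp (of_real pi * \<i> * (t - z1 * z2 / \<tau>)) * E w * E v / (E z1 * E z2 * E u) = exp (of_real pi * \<i> * t)"
    unfolding E_def mult_exp_exp exp_diff[symmetric] w_def v_def u_def using \<tau>0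
    by (intro arg_cong[where f = exp]) (simp add: field_simps power2_eq_square)
  finally have L: "L = (c_osp eps eps' * (p * p * (c * c) / r ^ 3)) * exp (of_real pi * \<i> * t) * (H ^ 3 * X w *
      X v / (Y z1 * Y z2 * Y u))" .
  have "p = - \<i>" by (simp add: p_def exp_minus exp_Euler[of "_ * _"] | simp add: complex_eq_iff Re_exp Im_exp p_def)+
  then have pp: "p * p = -1" by simp
  have half: "exp (of_real pi * \<i> / 2) = \<i>" "exp (- (of_real pi * \<i> / 2)) = - \<i>" "exp (- (of_real pi * \<i>)) =
      -1" "exp (of_real pi * \<i> / 2 * - 2) = -1"
    by (simp_all add: complex_eq_iff Re_exp Im_exp)
  have fl: "\<lfloor>- 1 :: real\<rfloor> = - 1" by (metis floor_of_int of_int_1 of_int_minus)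
  have "\<i> powi \<lfloor>4 * eps * eps' + 2 * eps - 2 * eps'\<rfloor> * (c_osp eps eps' * (p * p * (c * c) / r ^ 3)) =
      (-1) powi \<lfloor>2 * eps'\<rfloor> * \<tau> * c_osp eps' eps"
    using e e' unfolding pp c2 c_osp_def r_def
    by (elim insertE emptyE; hypsubst; simp add: half fl complex_eq_iff Re_exp Im_exp power3_eq_cube)
  then have "\<i> powi \<lfloor>4 * eps * eps' + 2 * eps - 2 * eps'\<rfloor> * L = ((-1) powi \<lfloor>2 * eps'\<rfloor> * \<tau> * c_osp eps' eps) *
      exp (of_real pi * \<i> * t) * (H ^ 3 * X w * X v / (Y z1 * Y z2 * Y u))"
    unfolding L by (simp only: mult.assoc[symmetric])
  also have "\<dots> = (-1) powi \<lfloor>2 * eps'\<rfloor> * \<tau> * R_hat eps' eps \<tau> z1 z2 t"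
    by (simp add: R_hat_def X_def Y_def H_def w_def v_def u_def)
  finally show ?thesis unfolding L_def .
qed

lemma R_hat_T_untwisted:
  "R_hat eps 0 (\<tau> + 1) z1 z2 t = R_hat eps 0 \<tau> z1 z2 t"
proof -
  define x where "x = exp (of_real pi * \<i> / 12)"
  have y: "exp (of_real pi * \<i> / 4) = x ^ 3" by (simp add: x_def exp_of_nat_mult[symmetric] mult_ac)
  have "x \<noteq> 0" by (simp add: x_def)
  then show ?thesis
    by (simp add: R_hat_def jacobi_theta_1_T dedekind_eta_T y x_def[symmetric] power_mult_distrib divide_simps)
qed

lemma R_hat_T_twisted:
  assumes "eps \<in> {0, 1/2}"
  shows "R_hat eps (1/2) (\<tau> + 1) z1 z2 t = exp (3 * of_real pi * \<i> / 4) * R_hat \<bar>eps - 1/2\<bar> (1/2) \<tau> z1 z2 t"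
proof -
  define x where "x = exp (of_real pi * \<i> / 12)"
  have y: "exp (of_real pi * \<i> / 4) = x ^ 3" "exp (3 * of_real pi * \<i> / 4) = x ^ 9"
    by (simp_all add: x_def exp_of_nat_mult[symmetric] mult_ac)
  have th: "jacobi_theta 0 (1 - 2 * eps) (\<tau> + 1) z = jacobi_theta 0 (1 - 2 * \<bar>eps - 1/2\<bar>) \<tau> z" for z
    using assms jacobi_theta_0_T[of 0 \<tau> z] jacobi_theta_0_T[of 1 \<tau> z] by (elim insertE emptyE; hypsubst; simp)
  have c: "c_osp eps (1/2) = c_osp \<bar>eps - 1/2\<bar> (1/2)"
    using assms unfolding c_osp_def by (elim insertE emptyE; hypsubst; simp add: complex_eq_iff Re_exp Im_exp)
  have "x ^ 9 = x ^ 3 * x ^ 3 * x ^ 3" by (simp flip: power_add)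
  then show ?thesis
    by (simp add: R_hat_def th c jacobi_theta_1_T dedekind_eta_T y x_def[symmetric] power_mult_distrib)
qed

section \<open>Sums of a Gaussian over simple fractions\<close>

lemma Ints_separated:
  assumes "(Z :: complex) \<notin> \<int>"
  obtains \<delta> where "\<delta> > 0" "\<And>n::int. \<delta> \<le> norm (Z + of_int n)"
proof -
  obtain d where d: "d > 0" "\<And>x. x \<in> \<int> \<Longrightarrow> d \<le> dist Z x"
    using separate_point_closed[OF closed_Ints assms] by auto
  have "d \<le> norm (Z + of_int n)" for n :: int
    using d(2)[of "- of_int n"] by (simp add: dist_norm)
  with d(1) show ?thesis by (rule that)
qed

text \<open>
  In the completed Appell function the summand with index \<open>(j, n)\<close> is \<open>appell_term\<close> at
  \<open>Z = z1 + j \<tau>\<close>, up to a factor depending on \<open>j\<close>; the parameter \<open>x\<close> then equals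
  \<open>2 c Im (z1 - z2)\<close>, and \<open>erf_term\<close> is a summand of the non-holomorphic correction.
\<close>

definition appell_term :: "real \<Rightarrow> complex \<Rightarrow> real \<Rightarrow> int \<Rightarrow> complex" where
  "appell_term c Z x n = (-1) powi n * exp (- of_real c * (Z + of_int n)\<^sup>2 + \<i> * of_real x * (Z + of_int n)) /
      (Z + of_int n)"

definition erf_term :: "real \<Rightarrow> complex \<Rightarrow> real \<Rightarrow> int \<Rightarrow> complex" where
  "erf_term c Z x n = of_real (E_fun ((x + 2 * pi * (of_int n + 1/2)) / (2 * sqrt (pi * c))) - sgn (of_int n +
      1/2)) * exp (- (2 * of_real pi * \<i> * (of_int n + 1/2) * Z))"

context
  fixes c :: real assumes c: "c > 0"
begin

lemma appell_term_bound:
  assumes "norm Z \<le> R" "\<delta> > 0" "\<delta> \<le> norm (Z + of_int n)" "\<bar>x\<bar> \<le> X"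
  shows "norm (appell_term c Z x n) \<le> exp (X * R) / \<delta> * (exp (c * R\<^sup>2) * exp (- c * (of_int n)\<^sup>2 + 2 * c * R *
      \<bar>of_int n\<bar>))"
proof -
  have "norm (exp (\<i> * of_real x * (Z + of_int n))) = exp (- x * Im Z)" by simp
  also have "\<dots> \<le> exp (X * R)"
  proof -
    have "- x * Im Z \<le> \<bar>x\<bar> * \<bar>Im Z\<bar>" by (metis abs_ge_self abs_mult abs_minus_cancel mult_minus_left)
    also have "\<dots> \<le> X * R" using assms abs_Im_le_cmod[of Z] by (intro mult_mono) auto
    finally show ?thesis by simp
  qed
  finally have 1: "norm (exp (\<i> * of_real x * (Z + of_int n))) \<le> exp (X * R)" .
  have "norm (appell_term c Z x n) = norm (exp (- of_real c * (Z + of_int n)\<^sup>2)) * norm (exp (\<i> * of_real x *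
      (Z + of_int n))) / norm (Z + of_int n)"
    unfolding appell_term_def exp_add norm_mult norm_divide by (simp add: norm_power_int)
  also have "\<dots> \<le> (exp (c * R\<^sup>2) * exp (- c * (of_int n)\<^sup>2 + 2 * c * R * \<bar>of_int n\<bar>)) * exp (X * R) / \<delta>"
    by (intro frac_le mult_mono norm_exp_complex_sq_le[OF assms(1) c] 1) (use assms in auto)
  finally show ?thesis by (simp add: mult_ac)
qed

lemma appell_term_summable:
  assumes "Z \<notin> \<int>" shows "appell_term c Z x summable_on UNIV"
proof -
  obtain \<delta> where d: "\<delta> > 0" "\<And>n::int. \<delta> \<le> norm (Z + of_int n)" using Ints_separated[OF assms] by blast
  show ?thesis
  proof (rule abs_summable_summable, rule Infinite_Sum.abs_summable_on_comparison_test')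
    show "norm (appell_term c Z x n) \<le> exp (\<bar>x\<bar> * norm Z) / \<delta> * (exp (c * (norm Z)\<^sup>2) * exp (- c *
        (of_int n)\<^sup>2 + 2 * c * norm Z * \<bar>of_int n\<bar>))" for n
      by (rule appell_term_bound) (use d in auto)
  qed (intro summable_on_cmult_right summable_on_gauss c)
qed

text \<open>
  If the argument of \<open>E\<close> has the sign of \<open>n + 1/2\<close>, the tail estimate applies. Otherwise
  \<open>2 pi \<bar>n + 1/2\<bar> \<le> \<bar>x\<bar>\<close>, and the factor \<open>exp (x\<^sup>2/c)\<close> makes up for the missing decay.
\<close>

lemma E_fun_minus_sgn_bound:
  "\<bar>E_fun ((x + 2 * pi * (of_int n + 1/2)) / (2 * sqrt (pi * c))) - sgn (of_int n + 1/2)\<bar> \<le> 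
     2 * exp (x\<^sup>2 / c) * exp (- (x + 2 * pi * (of_int n + 1/2))\<^sup>2 / (4 * c))"
proof -
  define n' where "n' = (of_int n + 1/2 :: real)"
  have n'0: "n' \<noteq> 0" 
  proof
    assume "n' = 0"
    then have "2 * n + 1 = 0" unfolding n'_def by linarith
    then show False by presburger
  qed
  define u where "u = (x + 2 * pi * n') / (2 * sqrt (pi * c))"
  have u2: "pi * u\<^sup>2 = (x + 2 * pi * n')\<^sup>2 / (4 * c)"
    using c by (simp add: u_def power_divide power_mult_distrib)
  have "\<bar>E_fun u - sgn n'\<bar> \<le> 2 * exp (x\<^sup>2 / c) * exp (- pi * u\<^sup>2)"
  proof (cases "sgn u = sgn n'")
    case True
    then have "\<bar>E_fun u - sgn n'\<bar> \<le> 1 * exp (- pi * u\<^sup>2)" using abs_sgn_minus_E_fun_le[of u] by (simp add: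
        abs_minus_commute)
    also have "\<dots> \<le> 2 * exp (x\<^sup>2 / c) * exp (- pi * u\<^sup>2)"
    proof (rule mult_right_mono)
      have "1 \<le> exp (x\<^sup>2 / c)" using c by simp
      then show "1 \<le> 2 * exp (x\<^sup>2 / c)" by linarith
    qed simp
    finally show ?thesis .
  next
    case False
    have "\<bar>2 * pi * n'\<bar> \<le> \<bar>x\<bar>"
    proof (rule ccontr)
      assume "\<not> ?thesis"
      then have "sgn (x + 2 * pi * n') = sgn n'" using n'0 
        by (cases "n' > 0") (auto simp: sgn_if abs_if mult_less_0_iff not_less split: if_splits)
      then have "sgn u = sgn n'" using c by (simp add: u_def sgn_divide sgn_mult)
      with False show False by simp
    qed
    then have "\<bar>x + 2 * pi * n'\<bar> \<le> \<bar>2 * x\<bar>" by linarith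
    then have "(x + 2 * pi * n')\<^sup>2 \<le> (2 * x)\<^sup>2" by (simp only: abs_le_square_iff)
    then have "pi * u\<^sup>2 \<le> x\<^sup>2 / c" unfolding u2 using c by (simp add: field_simps)
    then have "1 \<le> exp (x\<^sup>2 / c + - pi * u\<^sup>2)" by simp
    moreover have "\<bar>E_fun u - sgn n'\<bar> \<le> 2" using abs_E_fun_le_1[of u] by (auto simp: sgn_if abs_if split: if_splits)
    ultimately show ?thesis unfolding exp_add by linarith
  qed
  also have "- pi * u\<^sup>2 = - (x + 2 * pi * n')\<^sup>2 / (4 * c)" using u2 by simp
  finally show ?thesis unfolding u_def n'_def .
qed

lemma erf_term_bound:
  "norm (erf_term c Z x n) \<le> 2 * exp (x\<^sup>2 / c) * exp (- (pi\<^sup>2 / c) * (of_int n)\<^sup>2 + (2 * pi * Im Z - pi * (x +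
      pi) / c) * of_int n + (pi * Im Z - (x + pi)\<^sup>2 / (4 * c)))"
proof -
  have "norm (erf_term c Z x n) = \<bar>E_fun ((x + 2 * pi * (of_int n + 1/2)) / (2 * sqrt (pi * c))) -
      sgn (of_int n + 1/2)\<bar> * exp (2 * pi * (of_int n + 1/2) * Im Z)"
    unfolding erf_term_def norm_mult norm_of_real by simp
  also have "\<dots> \<le> 2 * exp (x\<^sup>2 / c) * exp (- (x + 2 * pi * (of_int n + 1/2))\<^sup>2 / (4 * c)) * exp (2 * pi *
      (of_int n + 1/2) * Im Z)"
    by (intro mult_right_mono E_fun_minus_sgn_bound) auto
  also have "\<dots> = 2 * exp (x\<^sup>2 / c) * exp (- (pi\<^sup>2 / c) * (of_int n)\<^sup>2 + (2 * pi * Im Z - pi * (x + pi) / c) *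
      of_int n + (pi * Im Z - (x + pi)\<^sup>2 / (4 * c)))"
    unfolding mult.assoc mult_exp_exp using c
    by (intro arg_cong2[where f = "(*)"] arg_cong[where f = exp] refl) (simp add: field_simps power2_eq_square)
  finally show ?thesis .
qed

lemma erf_term_summable: "erf_term c Z x summable_on UNIV"
  by (rule abs_summable_summable, rule Infinite_Sum.abs_summable_on_comparison_test'[OF _ erf_term_bound])
     (intro summable_on_cmult_right summable_on_gauss_affine, use c in auto)

text \<open>
  The inversion formula at \<open>Z - \<i> (x + pi)/(2 c)\<close>; the alternating sign shifts the dual summation by a
  half.
\<close>

lemma twisted_poisson:
  "(\<Sum>\<^sub>\<infinity>n::int. (-1) powi n * exp (- of_real c * (Z + of_int n)\<^sup>2 + \<i> * of_real x * (Z + of_int n))) = 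
   of_real (sqrt (pi / c)) * (\<Sum>\<^sub>\<infinity>n::int. exp (- of_real ((x + 2 * pi * (of_int n + 1/2))\<^sup>2 / (4 * c)) - 2 *
       of_real pi * \<i> * (of_int n + 1/2) * Z))"
proof -
  define w where "w = Z - \<i> * of_real ((x + pi) / (2 * c))"
  define P where "P = exp (- of_real ((x + pi)\<^sup>2 / (4 * c)) - of_real pi * \<i> * Z)"
  have "(\<Sum>\<^sub>\<infinity>n::int. (-1) powi n * exp (- of_real c * (Z + of_int n)\<^sup>2 + \<i> * of_real x * (Z + of_int n))) = 
      (\<Sum>\<^sub>\<infinity>n::int. P * exp (- of_real c * (w + of_int n)\<^sup>2))"
    unfolding exp_pi_i_int[symmetric] P_def mult_exp_exp w_def using c
    by (intro infsum_cong arg_cong[where f = exp]) (simp add: field_simps power2_eq_square)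
  also have "\<dots> = of_real (sqrt (pi / c)) * (\<Sum>\<^sub>\<infinity>k::int. P * exp (- of_real (pi\<^sup>2 / c) * (of_int k)\<^sup>2 + 2 *
      of_real pi * \<i> * of_int k * w))"
    unfolding infsum_cmult_right' theta_inversion_real[OF c] by (simp only: mult_ac)
  also have "(\<Sum>\<^sub>\<infinity>k::int. P * exp (- of_real (pi\<^sup>2 / c) * (of_int k)\<^sup>2 + 2 * of_real pi * \<i> * of_int k * w)) =
     (\<Sum>\<^sub>\<infinity>k::int. P * exp (- of_real (pi\<^sup>2 / c) * (of_int (-k))\<^sup>2 + 2 * of_real pi * \<i> * of_int (-k) * w))"
    by (rule infsum_reindex_bij_witness[of _ uminus uminus]) auto
  also have "\<dots> = (\<Sum>\<^sub>\<infinity>n::int. exp (- of_real ((x + 2 * pi * (of_int n + 1/2))\<^sup>2 / (4 * c)) - 2 * of_real pi * \<i> *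
      (of_int n + 1/2) * Z))"
    unfolding P_def mult_exp_exp w_def using c
    by (intro infsum_cong arg_cong[where f = exp]) (simp add: field_simps power2_eq_square)
  finally show ?thesis .
qed


text \<open>
  Differentiation in \<open>x\<close> removes the denominator \<open>Z + n\<close> on one side and turns the error function
  into a Gaussian on the other; the two resulting series agree by Poisson summation.
\<close>

lemma appell_term_minus_erf_term_const:
  assumes Z: "Z \<notin> \<int>" and xy: "x \<le> y"
  shows "(\<Sum>\<^sub>\<infinity>n. appell_term c Z y n) - \<i> * of_real pi * (\<Sum>\<^sub>\<infinity>n. erf_term c Z y n) = 
         (\<Sum>\<^sub>\<infinity>n. appell_term c Z x n) - \<i> * of_real pi * (\<Sum>\<^sub>\<infinity>n. erf_term c Z x n)"
proof -
  obtain \<delta> where d: "\<delta> > 0" "\<And>n::int. \<delta> \<le> norm (Z + of_int n)" using Ints_separated[OF Z] by blast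
  have nz: "Z + of_int n \<noteq> 0" for n :: int using d by (metis norm_zero not_le)
  define X where "X = max \<bar>x\<bar> \<bar>y\<bar>"
  have X: "\<bar>t\<bar> \<le> X" if "t \<in> {x..y}" for t using that by (auto simp: X_def)
  define l' where "l' n t = \<i> * ((-1) powi n * exp (- of_real c * (Z + of_int n)\<^sup>2 + \<i> * of_real t * (Z +
      of_int n)))" for n :: int and t :: real
  define r' where "r' n t = of_real (1 / sqrt (pi * c)) * exp (- of_real ((t + 2 * pi * (of_int n + 1/2))\<^sup>2 /
      (4 * c)) - 2 * of_real pi * \<i> * (of_int n + 1/2) * Z)" for n :: int and t :: real
  have l: "(\<Sum>\<^sub>\<infinity>n. appell_term c Z y n) - (\<Sum>\<^sub>\<infinity>n. appell_term c Z x n) = integral {x..y} (\<lambda>t. \<Sum>\<^sub>\<infinity>n. l' n t)"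
  proof (rule infsum_increment[OF xy])
    fix n :: int and t :: real
    define zn where "zn = Z + of_int n"
    have zn: "zn \<noteq> 0" using nz by (simp add: zn_def)
    have "((\<lambda>t. (-1) powi n * exp (- of_real c * zn\<^sup>2 + \<i> * t * zn) / zn) has_field_derivative 
        (-1) powi n * (exp (- of_real c * zn\<^sup>2 + \<i> * of_real t * zn) * (\<i> * zn)) / zn) (at (of_real t))"
      using zn by (auto intro!: derivative_eq_intros)
    also have "(-1) powi n * (exp (- of_real c * zn\<^sup>2 + \<i> * of_real t * zn) * (\<i> * zn)) / zn = l' n t"
      using zn by (simp add: l'_def zn_def)
    finally show "((\<lambda>t. appell_term c Z t n) has_vector_derivative l' n t) (at t)"
      unfolding appell_term_def zn_def by (rule has_vector_derivative_real_field)
  next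
    fix n :: int and t :: real assume t: "t \<in> {x..y}"
    have "norm (l' n t) = norm (exp (- of_real c * (Z + of_int n)\<^sup>2)) * exp (- t * Im Z)"
      unfolding l'_def exp_add norm_mult by (simp add: norm_power_int)
    also have "\<dots> \<le> (exp (c * (norm Z)\<^sup>2) * exp (- c * (of_int n)\<^sup>2 + 2 * c * norm Z * \<bar>of_int n\<bar>)) * exp (X * norm Z)"
    proof (intro mult_mono norm_exp_complex_sq_le c)
      have "- t * Im Z \<le> \<bar>t\<bar> * \<bar>Im Z\<bar>" by (metis abs_ge_self abs_mult abs_minus_cancel mult_minus_left)
      also have "\<dots> \<le> X * norm Z" using X[OF t] abs_Im_le_cmod[of Z] by (intro mult_mono) auto
      finally show "exp (- t * Im Z) \<le> exp (X * norm Z)" by simp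
    qed auto
    finally show "norm (l' n t) \<le> (exp (c * (norm Z)\<^sup>2) * exp (- c * (of_int n)\<^sup>2 + 2 * c * norm Z *
        \<bar>of_int n\<bar>)) * exp (X * norm Z)" .
  next
    show "(\<lambda>n::int. (exp (c * (norm Z)\<^sup>2) * exp (- c * (of_int n)\<^sup>2 + 2 * c * norm Z * \<bar>of_int n\<bar>)) * exp (X *
        norm Z)) summable_on UNIV"
      by (intro summable_on_cmult_right summable_on_cmult_left summable_on_gauss c)
    show "continuous_on {x..y} (l' n)" for n
      unfolding l'_def[abs_def] by (intro continuous_intros)
  qed (use appell_term_summable[OF Z] in \<open>simp_all add: eta_contract_eq\<close>)
  have r: "(\<Sum>\<^sub>\<infinity>n. erf_term c Z y n) - (\<Sum>\<^sub>\<infinity>n. erf_term c Z x n) = integral {x..y} (\<lambda>t. \<Sum>\<^sub>\<infinity>n. r' n t)"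
  proof (rule infsum_increment[OF xy])
    fix n :: int and t :: real
    define K where "K = exp (- (2 * of_real pi * \<i> * (of_int n + 1/2) * Z))"
    have "((\<lambda>t. E_fun ((t + 2 * pi * (of_int n + 1/2)) / (2 * sqrt (pi * c))) - sgn (of_int n +
        1/2)) has_real_derivative
        (2 * exp (- pi * ((t + 2 * pi * (of_int n + 1/2)) / (2 * sqrt (pi * c)))\<^sup>2) * (1 / (2 * sqrt (pi *
            c))) - 0)) (at t)"
      by (intro DERIV_diff DERIV_const DERIV_chain2[OF has_real_derivative_E_fun]) (rule DERIV_cdivide, rule
          DERIV_add[where E = 0, simplified, OF DERIV_ident DERIV_const])
    also have "(2 * exp (- pi * ((t + 2 * pi * (of_int n + 1/2)) / (2 * sqrt (pi * c)))\<^sup>2) * (1 / (2 *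
        sqrt (pi * c))) - 0) = 
       1 / sqrt (pi * c) * exp (- (t + 2 * pi * (of_int n + 1/2))\<^sup>2 / (4 * c))"
      using c by (simp add: power_divide power_mult_distrib)
    finally have "((\<lambda>t. complex_of_real (E_fun ((t + 2 * pi * (of_int n + 1/2)) / (2 * sqrt (pi * c))) -
        sgn (of_int n + 1/2)) * K) has_vector_derivative
        of_real (1 / sqrt (pi * c) * exp (- (t + 2 * pi * (of_int n + 1/2))\<^sup>2 / (4 * c))) * K) (at t)"
      by (intro has_vector_derivative_mult_left has_vector_derivative_of_real) (simp add:
          has_real_derivative_iff_has_vector_derivative)
    also have "of_real (1 / sqrt (pi * c) * exp (- (t + 2 * pi * (of_int n + 1/2))\<^sup>2 / (4 * c))) * K = r' n t"
      unfolding r'_def K_def of_real_mult exp_of_real[symmetric] mult.assoc mult_exp_exp by simp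
    finally show "((\<lambda>t. erf_term c Z t n) has_vector_derivative r' n t) (at t)"
      unfolding erf_term_def K_def .
  next
    fix n :: int and t :: real assume t: "t \<in> {x..y}"
    have n1: "norm (r' n t) = 1 / sqrt (pi * c) * exp (- ((t + 2 * pi * (of_int n + 1/2))\<^sup>2 / (4 * c)) + 2 *
        pi * (of_int n + 1/2) * Im Z)"
    proof -
      have *: "Re (- of_real A - 2 * of_real pi * \<i> * (of_int n + 1/2) * Z) = - A + 2 * pi * (of_int n + 1/2) *
          Im Z" for A
        by (simp add: algebra_simps)
      have "\<bar>1 / sqrt (pi * c)\<bar> = 1 / sqrt (pi * c)" using c by simp
      then show ?thesis unfolding r'_def norm_mult norm_of_real norm_exp_eq_Re * by simp
    qed
    have "- ((t + 2 * pi * (of_int n + 1/2))\<^sup>2 / (4 * c)) + 2 * pi * (of_int n + 1/2) * Im Z = 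
        - (pi\<^sup>2 / c) * (of_int n)\<^sup>2 + (2 * pi * Im Z - pi\<^sup>2 / c) * of_int n + (pi * Im Z) + (- (pi * t *
            of_int n) / c - (t + pi)\<^sup>2 / (4 * c))"
      using c by (simp add: field_simps power2_eq_square)
    also have "\<dots> \<le> - (pi\<^sup>2 / c) * (of_int n)\<^sup>2 + \<bar>2 * pi * Im Z - pi\<^sup>2 / c\<bar> * \<bar>of_int n\<bar> + (pi * Im Z) + (pi *
        X * \<bar>of_int n\<bar> / c - 0)"
    proof (intro add_mono diff_mono divide_right_mono)
      show "(2 * pi * Im Z - pi\<^sup>2 / c) * of_int n \<le> \<bar>2 * pi * Im Z - pi\<^sup>2 / c\<bar> *
          \<bar>of_int n\<bar>" by (metis abs_ge_self abs_mult)
      have "- (t * of_int n) \<le> \<bar>t\<bar> * \<bar>of_int n\<bar>" by (metis abs_ge_minus_self abs_mult)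
      also have "\<dots> \<le> X * \<bar>of_int n\<bar>" using X[OF t] by (intro mult_right_mono) auto
      finally have "pi * - (t * of_int n) \<le> pi * (X * \<bar>of_int n\<bar>)" by (intro mult_left_mono) auto
      then show "- (pi * t * of_int n) \<le> pi * X * \<bar>of_int n\<bar>" by (simp add: mult_ac)
    qed (use c in auto)
    also have "\<dots> = (pi * Im Z) + (- (pi\<^sup>2 / c) * (of_int n)\<^sup>2 + (\<bar>2 * pi * Im Z - pi\<^sup>2 / c\<bar> + pi * X / c) *
        \<bar>of_int n\<bar>)"
      by (simp add: algebra_simps)
    finally show "norm (r' n t) \<le> 1 / sqrt (pi * c) * exp (pi * Im Z) * exp (- (pi\<^sup>2 / c) * (of_int n)\<^sup>2 + (\<bar>2 *
        pi * Im Z - pi\<^sup>2 / c\<bar> + pi * X / c) * \<bar>of_int n\<bar>)"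
      unfolding n1 mult.assoc mult_exp_exp using c by (intro mult_left_mono) auto
  next
    show "(\<lambda>n::int. 1 / sqrt (pi * c) * exp (pi * Im Z) * exp (- (pi\<^sup>2 / c) * (of_int n)\<^sup>2 + (\<bar>2 * pi * Im Z -
        pi\<^sup>2 / c\<bar> + pi * X / c) * \<bar>of_int n\<bar>)) summable_on UNIV"
      by (intro summable_on_cmult_right summable_on_gauss) (use c in auto)
    show "continuous_on {x..y} (r' n)" for n
      unfolding r'_def[abs_def] using c by (intro continuous_intros) auto
  qed (use erf_term_summable in \<open>simp_all add: eta_contract_eq\<close>)
  have "(\<Sum>\<^sub>\<infinity>n. l' n t) = \<i> * of_real pi * (\<Sum>\<^sub>\<infinity>n. r' n t)" for t
  proof -
    have "sqrt (pi / c) = pi * (1 / sqrt (pi * c))"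
      using c by (simp add: real_sqrt_divide real_sqrt_mult field_simps)
    then show ?thesis
      unfolding l'_def r'_def infsum_cmult_right' twisted_poisson by (simp add: mult_ac)
  qed
  then have "integral {x..y} (\<lambda>t. \<Sum>\<^sub>\<infinity>n. l' n t) = \<i> * of_real pi * integral {x..y} (\<lambda>t. \<Sum>\<^sub>\<infinity>n. r' n t)"
    by (simp only: integral_mult_right)
  with l r show ?thesis by (simp add: algebra_simps)
qed

text \<open>
  The difference of the two series does not depend on \<open>x\<close>. As \<open>x\<close> tends to infinity, the first
  series tends to 0 because \<open>Im Z > 0\<close>, and in the second one \<open>E\<close> tends to 1, which leaves a geometric
  series over the negative indices.
\<close>

lemma appell_expansion_upper:
  assumes Z: "Im Z > 0"
  shows "(\<Sum>\<^sub>\<infinity>n. appell_term c Z x n) = of_real pi / sin (of_real pi * Z) + \<i> * of_real pi * (\<Sum>\<^sub>\<infinity>n. erf_term c Z x n)"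
proof -
  have Zn: "Z \<notin> \<int>" using Z by (auto elim!: Ints_cases)
  define D where "D x = (\<Sum>\<^sub>\<infinity>n. appell_term c Z x n) - \<i> * of_real pi * (\<Sum>\<^sub>\<infinity>n. erf_term c Z x n)" for x
  have D_const: "D y = D x" if "x \<le> y" for y
    unfolding D_def by (rule appell_term_minus_erf_term_const[OF Zn that])
  have L_lim: "((\<lambda>x. \<Sum>\<^sub>\<infinity>n. appell_term c Z x n) \<longlongrightarrow> (\<Sum>\<^sub>\<infinity>n::int. 0)) at_top"
  proof (rule tendsto_infsum_dominated)
    have nl: "norm (appell_term c Z x n) = norm (appell_term c Z 0 n) * exp (- x * Im Z)" for x n
      unfolding appell_term_def exp_add norm_mult norm_divide by (simp add: norm_power_int)
    have "((\<lambda>x. exp (- x * Im Z)) \<longlongrightarrow> 0) at_top"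
      using Z by real_asymp
    then show "((\<lambda>x. appell_term c Z x n) \<longlongrightarrow> 0) at_top" for n
    proof (intro tendsto_norm_zero_cancel[of "\<lambda>x. appell_term c Z x n"])
      have "(\<lambda>x. norm (appell_term c Z x n)) = (\<lambda>x. norm (appell_term c Z 0 n) * exp (- x * Im Z))"
        by (rule ext) (rule nl)
      then show "((\<lambda>x. norm (appell_term c Z x n)) \<longlongrightarrow> 0) at_top"
        using tendsto_mult_right_zero[OF \<open>((\<lambda>x. exp (- x * Im Z)) \<longlongrightarrow> 0) at_top\<close>] by metis
    qed
    show "\<forall>\<^sub>F x in at_top. \<forall>n\<in>UNIV. norm (appell_term c Z x n) \<le> norm (appell_term c Z 0 n)"
      using eventually_ge_at_top[of 0]
    proof eventually_elim
      case (elim x)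
      then show ?case using Z by (auto simp: nl[of x] intro!: mult_left_le)
    qed
    show "(\<lambda>n. norm (appell_term c Z 0 n)) summable_on UNIV"
      using appell_term_summable[OF Zn, of 0] by (simp add: summable_on_iff_abs_summable_on_complex)
  qed
  define g where "g n = of_real (1 - sgn (of_int n + 1/2)) * exp (- (2 * of_real pi * \<i> * (of_int n + 1/2) *
      Z))" for n :: int
  have R_lim: "((\<lambda>x. \<Sum>\<^sub>\<infinity>n. erf_term c Z x n) \<longlongrightarrow> (\<Sum>\<^sub>\<infinity>n. g n)) at_top"
  proof (rule tendsto_infsum_dominated)
    show "((\<lambda>x. erf_term c Z x n) \<longlongrightarrow> g n) at_top" for n
      unfolding erf_term_def g_def
    proof (intro tendsto_mult tendsto_of_real tendsto_diff tendsto_const filterlim_compose[OF E_fun_tendsto_1])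
      show "LIM x at_top. (x + 2 * pi * (of_int n + 1/2)) / (2 * sqrt (pi * c)) :> at_top"
        using c by real_asymp
    qed
    define h where "h n = exp (- (pi\<^sup>2 / c) * (of_int n)\<^sup>2 + (2 * pi * Im Z - pi\<^sup>2 / c) * of_int n + (pi *
        Im Z - pi\<^sup>2 / (4 * c))) + 2 * exp (pi * Im Z) * exp (- (2 * pi * Im Z) * \<bar>of_int n\<bar>)" for n :: int
    show "h summable_on UNIV"
      unfolding h_def using c Z by (intro summable_on_add summable_on_cmult_right summable_on_gauss_affine
          summable_on_exp_neg_abs_mult) auto
    show "\<forall>\<^sub>F x in at_top. \<forall>n\<in>UNIV. norm (erf_term c Z x n) \<le> h n"
      using eventually_ge_at_top[of 0]
    proof (eventually_elim, intro ballI)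
      fix x :: real and n :: int assume x: "0 \<le> x"
      define n' where "n' = (of_int n + 1/2 :: real)"
      define u where "u = (x + 2 * pi * n') / (2 * sqrt (pi * c))"
      have nr: "norm (erf_term c Z x n) = \<bar>E_fun u - sgn n'\<bar> * exp (2 * pi * n' * Im Z)"
        unfolding erf_term_def norm_mult norm_of_real by (simp add: u_def n'_def)
      show "norm (erf_term c Z x n) \<le> h n"
      proof (cases "n \<ge> 0")
        case True
        then have n': "n' > 0" by (simp add: n'_def)
        define u0 where "u0 = (2 * pi * n') / (2 * sqrt (pi * c))"
        have u0: "0 \<le> u0" using n' c by (simp add: u0_def)
        have u0u: "u0 \<le> u" unfolding u0_def u_def by (rule divide_right_mono) (use x c in auto)
        have "\<bar>E_fun u - sgn n'\<bar> = 1 - E_fun u" using n' E_fun_le_1[of u] by simp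
        also have "\<dots> \<le> 1 - E_fun u0" using E_fun_mono[OF u0u] by simp
        also have "\<dots> \<le> exp (- pi * u0\<^sup>2)" by (rule E_fun_tail[OF u0])
        also have "- pi * u0\<^sup>2 = - (pi\<^sup>2 / c) * n'\<^sup>2" using c by (simp add: u0_def power_divide power_mult_distrib)
        finally have "norm (erf_term c Z x n) \<le> exp (- (pi\<^sup>2 / c) * n'\<^sup>2) * exp (2 * pi * n' * Im Z)"
          unfolding nr by (rule mult_right_mono) auto
        also have "\<dots> = exp (- (pi\<^sup>2 / c) * (of_int n)\<^sup>2 + (2 * pi * Im Z - pi\<^sup>2 / c) * of_int n + (pi * Im Z -
            pi\<^sup>2 / (4 * c)))"
          unfolding mult_exp_exp n'_def using c by (intro arg_cong[where f =
              exp]) (simp add: field_simps power2_eq_square)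
        also have "\<dots> \<le> h n" by (simp add: h_def)
        finally show ?thesis .
      next
        case False
        have "\<bar>E_fun u - sgn n'\<bar> \<le> 2" using abs_E_fun_le_1[of u] by (auto simp: sgn_if abs_if split: if_splits)
        then have "norm (erf_term c Z x n) \<le> 2 * exp (2 * pi * n' * Im Z)" unfolding nr by (rule mult_right_mono) auto
        also have "\<dots> = 2 * exp (pi * Im Z) * exp (- (2 * pi * Im Z) * \<bar>of_int n\<bar>)"
          unfolding mult.assoc mult_exp_exp using False by (simp add: n'_def algebra_simps)
        also have "\<dots> \<le> h n" by (simp add: h_def)
        finally show ?thesis .
      qed
    qed
  qed
  have g_sum: "(\<Sum>\<^sub>\<infinity>n. g n) = 2 * exp (of_real pi * \<i> * Z) / (1 - exp (2 * of_real pi * \<i> * Z))"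
  proof -
    define e where "e = exp (2 * of_real pi * \<i> * Z)"
    have e1: "norm e < 1" using Z by (simp add: e_def)
    have e0: "norm (e ^ k) = (norm e) ^ k" for k by (simp add: norm_power)
    have "(\<Sum>\<^sub>\<infinity>n. g n) = (\<Sum>\<^sub>\<infinity>n\<in>{..<0}. g n)"
    proof (rule infsum_cong_neutral)
      fix n :: int assume "n \<in> UNIV - {..<0}"
      then show "g n = 0" by (simp add: g_def)
    qed auto
    also have "\<dots> = (\<Sum>\<^sub>\<infinity>k::nat. 2 * exp (of_real pi * \<i> * Z) * e ^ k)"
    proof (rule infsum_reindex_bij_witness[of _ "\<lambda>k. - 1 - int k" "\<lambda>n. nat (- 1 - n)"])
      fix n :: int assume n: "n \<in> {..<0}"
      define k where "k = nat (- 1 - n)"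
      have nk: "n = - 1 - int k" using n by (simp add: k_def)
      have "sgn (of_int n + 1/2 :: real) = - 1" using n by (simp add: sgn_if)
      then have "g n = 2 * exp (- (2 * of_real pi * \<i> * (of_int n + 1/2) * Z))" by (simp add: g_def)
      also have "exp (- (2 * of_real pi * \<i> * (of_int n + 1/2) * Z)) = exp (of_real pi * \<i> * Z) * e ^ k"
        unfolding e_def exp_of_nat_mult[symmetric] mult_exp_exp nk
        by (rule arg_cong[where f = exp]) (simp add: algebra_simps)
      finally show "2 * exp (of_real pi * \<i> * Z) * e ^ nat (- 1 - n) = g n" by (simp add: k_def)
    qed auto
    also have "\<dots> = 2 * exp (of_real pi * \<i> * Z) * (\<Sum>\<^sub>\<infinity>k::nat. e ^ k)" by (rule infsum_cmult_right')
    also have "(\<Sum>\<^sub>\<infinity>k::nat. e ^ k) = 1 / (1 - e)"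
    proof -
      have "((\<lambda>k. e ^ k) has_sum (1 / (1 - e))) UNIV"
        by (rule norm_summable_imp_has_sum) (use e1 geometric_sums[of e] in \<open>auto simp: norm_power intro!:
            summable_geometric\<close>)
      then show ?thesis by (rule infsumI)
    qed
    finally show ?thesis by (simp add: e_def)
  qed
  have "((\<lambda>y. D y) \<longlongrightarrow> (\<Sum>\<^sub>\<infinity>n::int. 0) - \<i> * of_real pi * (\<Sum>\<^sub>\<infinity>n. g n)) at_top"
    unfolding D_def by (intro tendsto_intros L_lim R_lim)
  moreover have "((\<lambda>y. D y) \<longlongrightarrow> D x) at_top"
    by (rule tendsto_eventually, rule eventually_mono[OF eventually_ge_at_top[of x]]) (rule D_const)
  ultimately have "D x = - \<i> * of_real pi * (\<Sum>\<^sub>\<infinity>n. g n)"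
    using tendsto_unique[OF trivial_limit_at_top_linorder] by fastforce
  also have "\<dots> = of_real pi / sin (of_real pi * Z)"
  proof -
    have "norm (exp (2 * of_real pi * \<i> * Z)) < 1" using Z by simp
    then have "exp (2 * of_real pi * \<i> * Z) \<noteq> 1" by (metis less_irrefl norm_one)
    then have "sin (of_real pi * Z) \<noteq> 0" using one_minus_exp_2pi[of Z] by auto
    then show ?thesis unfolding g_sum one_minus_exp_2pi by simp
  qed
  finally show ?thesis by (simp add: D_def algebra_simps)
qed


lemma appell_term_minus: "appell_term c (- Z) (- x) (- n) = - appell_term c Z x n"
proof -
  have "- Z + of_int (- n) = - (Z + of_int n)" by simp
  then show ?thesis unfolding appell_term_def
    by (simp only: power2_minus mult_minus_left mult_minus_right of_real_minus minus_minus divide_minus_right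
        power_int_minus_one_minus)
qed

lemma erf_term_minus: "erf_term c (- Z) (- x) (- 1 - n) = - erf_term c Z x n"
proof -
  have e: "(of_int (- 1 - n) + 1/2 :: real) = - (of_int n + 1/2)" "(of_int (- 1 - n) + 1/2 :: complex) = -
      (of_int n + 1/2)"
    by simp_all
  have "(- x + 2 * pi * - (of_int n + 1/2)) / (2 * sqrt (pi * c)) = - ((x + 2 * pi * (of_int n + 1/2)) / (2 *
      sqrt (pi * c)))"
  proof -
    have "- x + 2 * pi * - (of_int n + 1/2) = - (x + 2 * pi * (of_int n + 1/2))" by (simp add: algebra_simps)
    then show ?thesis by (simp only: minus_divide_left)
  qed
  then show ?thesis unfolding erf_term_def e
    by (simp only: E_fun_minus sgn_minus mult_minus_left mult_minus_right minus_minus) (simp add: algebra_simps)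
qed

text \<open>
  Changing the signs of \<open>Z\<close> and \<open>x\<close> reverses the sign of both sides and exchanges the half planes.
\<close>

lemma appell_expansion_nonreal:
  assumes Z: "Im Z \<noteq> 0"
  shows "(\<Sum>\<^sub>\<infinity>n. appell_term c Z x n) = of_real pi / sin (of_real pi * Z) + \<i> * of_real pi * (\<Sum>\<^sub>\<infinity>n. erf_term c Z x n)"
proof (cases "Im Z > 0")
  case True
  then show ?thesis by (rule appell_expansion_upper)
next
  case False
  then have "Im (- Z) > 0" using Z by simp
  from appell_expansion_upper[OF this, of "- x"]
  have 1: "(\<Sum>\<^sub>\<infinity>n. appell_term c (- Z) (- x) n) = of_real pi / sin (of_real pi * - Z) + \<i> * of_real pi *
      (\<Sum>\<^sub>\<infinity>n. erf_term c (- Z) (- x) n)" .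
  have 2: "(\<Sum>\<^sub>\<infinity>n. appell_term c (- Z) (- x) n) = (\<Sum>\<^sub>\<infinity>n. - appell_term c Z x n)"
    by (rule infsum_reindex_bij_witness[of _ uminus uminus]) (use appell_term_minus[of Z x "- n" for n] in auto)
  have 3: "(\<Sum>\<^sub>\<infinity>n. erf_term c (- Z) (- x) n) = (\<Sum>\<^sub>\<infinity>n. - erf_term c Z x n)"
    by (rule infsum_reindex_bij_witness[of _ "\<lambda>n. - 1 - n" "\<lambda>n. - 1 - n"]) (use erf_term_minus[of Z x "- 1 -
        n" for n] in auto)
  show ?thesis using 1 unfolding 2 3 infsum_uminus
    by (simp add: algebra_simps add_eq_0_iff neg_eq_iff_add_eq_0)
qed

text \<open>
  For real \<open>Z\<close> neither series decays as \<open>x\<close> tends to infinity, but both sides are limits of their values at \<open>Z +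
      \<i> s\<close> for small \<open>s > 0\<close>.
\<close>

theorem appell_expansion:
  assumes Z: "Z \<notin> \<int>"
  shows "(\<Sum>\<^sub>\<infinity>n. appell_term c Z x n) = of_real pi / sin (of_real pi * Z) + \<i> * of_real pi * (\<Sum>\<^sub>\<infinity>n. erf_term c Z x n)"
proof (cases "Im Z = 0")
  case False
  then show ?thesis by (rule appell_expansion_nonreal)
next
  case True
  then have Zr: "Z = of_real (Re Z)" by (simp add: complex_eq_iff)
  obtain \<delta> where d: "\<delta> > 0" "\<And>n::int. \<delta> \<le> norm (Z + of_int n)" using Ints_separated[OF Z] by blast
  define W where "W s = Z + \<i> * of_real s" for s :: real
  have W: "(W \<longlongrightarrow> Z) (at_right 0)"
    unfolding W_def by (auto intro!: tendsto_eq_intros)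
  have nz: "Z + of_int n \<noteq> 0" for n :: int using d by (metis norm_zero not_le)
  have small: "\<forall>\<^sub>F s in at_right (0::real). 0 < s \<and> s < 1"
    using eventually_at_right_field[of "\<lambda>s. 0 < s \<and> s < 1" "0::real"] zero_less_one by blast
  have L: "((\<lambda>s. \<Sum>\<^sub>\<infinity>n. appell_term c (W s) x n) \<longlongrightarrow> (\<Sum>\<^sub>\<infinity>n. appell_term c Z x n)) (at_right 0)"
  proof (rule tendsto_infsum_dominated)
    show "((\<lambda>s. appell_term c (W s) x n) \<longlongrightarrow> appell_term c Z x n) (at_right 0)" for n
      unfolding appell_term_def by (intro tendsto_intros W nz)
    define R where "R = norm Z + 1"
    show "\<forall>\<^sub>F s in at_right 0. \<forall>n\<in>UNIV. norm (appell_term c (W s) x n) \<le> exp (\<bar>x\<bar> * R) / \<delta> * (exp (c * R\<^sup>2) *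
        exp (- c * (of_int n)\<^sup>2 + 2 * c * R * \<bar>of_int n\<bar>))"
      using small
    proof (eventually_elim, intro ballI appell_term_bound d(1) order_refl)
      fix s :: real and n :: int assume s: "0 < s \<and> s < 1"
      show "norm (W s) \<le> R" unfolding W_def R_def using norm_triangle_ineq[of Z "\<i> *
          of_real s"] s by (simp add: norm_mult)
      have "\<delta> \<le> norm (Z + of_int n)" by (rule d)
      also have "Z + of_int n = of_real (Re (W s + of_int n))" using Zr by (simp add: W_def)
      also have "norm (of_real (Re (W s + of_int n)) :: complex) \<le> norm (W s + of_int n)" 
        unfolding norm_of_real by (rule abs_Re_le_cmod)
      finally show "\<delta> \<le> norm (W s + of_int n)" .
    qed
    show "(\<lambda>n::int. exp (\<bar>x\<bar> * R) / \<delta> * (exp (c * R\<^sup>2) * exp (- c * (of_int n)\<^sup>2 + 2 * c * R *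
        \<bar>of_int n\<bar>))) summable_on UNIV"
      by (intro summable_on_cmult_right summable_on_gauss c)
  qed
  have R: "((\<lambda>s. \<Sum>\<^sub>\<infinity>n. erf_term c (W s) x n) \<longlongrightarrow> (\<Sum>\<^sub>\<infinity>n. erf_term c Z x n)) (at_right 0)"
  proof (rule tendsto_infsum_dominated)
    show "((\<lambda>s. erf_term c (W s) x n) \<longlongrightarrow> erf_term c Z x n) (at_right 0)" for n
      unfolding erf_term_def by (intro tendsto_intros W)
    define B where "B = (2 * pi + \<bar>pi * (x + pi) / c\<bar>)"
    show "\<forall>\<^sub>F s in at_right 0. \<forall>n\<in>UNIV. norm (erf_term c (W s) x n) \<le> 2 * exp (x\<^sup>2 / c) * (exp pi *
        exp (- (pi\<^sup>2 / c) * (of_int n)\<^sup>2 + B * \<bar>of_int n\<bar>))"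
      using small
    proof (eventually_elim, intro ballI)
      fix s :: real and n :: int assume s: "0 < s \<and> s < 1"
      have ImW: "Im (W s) = s" using True by (simp add: W_def)
      have "(2 * pi * s - pi * (x + pi) / c) * of_int n \<le> \<bar>2 * pi * s - pi * (x + pi) / c\<bar> * \<bar>of_int n\<bar>"
        by (metis abs_ge_self abs_mult)
      also have "\<dots> \<le> B * \<bar>of_int n\<bar>"
      proof (rule mult_right_mono)
        have "2 * pi * s \<le> 2 * pi * 1" using s by (intro mult_left_mono) auto
        moreover have "0 \<le> 2 * pi * s" using s by simp
        ultimately show "\<bar>2 * pi * s - pi * (x + pi) / c\<bar> \<le> B" unfolding B_def by linarith
      qed simp
      finally have 1: "(2 * pi * s - pi * (x + pi) / c) * of_int n \<le> B * \<bar>of_int n\<bar>" .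
      have "pi * s \<le> pi * 1" using s by (intro mult_left_mono) auto
      moreover have "0 \<le> (x + pi)\<^sup>2 / (4 * c)" using c by simp
      ultimately have 2: "pi * s - (x + pi)\<^sup>2 / (4 * c) \<le> pi" by linarith
      have "norm (erf_term c (W s) x n) \<le> 2 * exp (x\<^sup>2 / c) * exp (- (pi\<^sup>2 / c) * (of_int n)\<^sup>2 + (2 * pi * s -
          pi * (x + pi) / c) * of_int n + (pi * s - (x + pi)\<^sup>2 / (4 * c)))"
        using erf_term_bound[of "W s" x n] unfolding ImW .
      also have "\<dots> \<le> 2 * exp (x\<^sup>2 / c) * exp (pi + (- (pi\<^sup>2 / c) * (of_int n)\<^sup>2 + B * \<bar>of_int n\<bar>))"
        using 1 2 by (intro mult_left_mono) (simp_all add: algebra_simps)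
      finally show "norm (erf_term c (W s) x n) \<le> 2 * exp (x\<^sup>2 / c) * (exp pi * exp (- (pi\<^sup>2 / c) *
          (of_int n)\<^sup>2 + B * \<bar>of_int n\<bar>))"
        unfolding exp_add[of pi] .
    qed
    show "(\<lambda>n::int. 2 * exp (x\<^sup>2 / c) * (exp pi * exp (- (pi\<^sup>2 / c) * (of_int n)\<^sup>2 + B *
        \<bar>of_int n\<bar>))) summable_on UNIV"
      by (intro summable_on_cmult_right summable_on_gauss) (use c in auto)
  qed
  have sin0: "sin (of_real pi * Z) \<noteq> 0"
  proof
    assume "sin (of_real pi * Z) = 0"
    then obtain n :: int where "of_real pi * Z = of_int n * of_real pi" by (auto simp: sin_eq_0)
    then have "Z = of_int n" by simp
    with Z show False by simp
  qed
  have "((\<lambda>s. of_real pi / sin (of_real pi * W s) + \<i> * of_real pi * (\<Sum>\<^sub>\<infinity>n. erf_term c (W s) x n)) \<longlongrightarrow>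
     of_real pi / sin (of_real pi * Z) + \<i> * of_real pi * (\<Sum>\<^sub>\<infinity>n. erf_term c Z x n)) (at_right 0)"
    by (intro tendsto_intros W R sin0)
  moreover have "\<forall>\<^sub>F s in at_right 0. of_real pi / sin (of_real pi * W s) + \<i> * of_real pi *
      (\<Sum>\<^sub>\<infinity>n. erf_term c (W s) x n) = (\<Sum>\<^sub>\<infinity>n. appell_term c (W s) x n)"
    using small by eventually_elim (rule appell_expansion_nonreal[symmetric], use True in \<open>auto simp: W_def\<close>)
  ultimately have "((\<lambda>s. \<Sum>\<^sub>\<infinity>n. appell_term c (W s) x n) \<longlongrightarrow>
     of_real pi / sin (of_real pi * Z) + \<i> * of_real pi * (\<Sum>\<^sub>\<infinity>n. erf_term c Z x n)) (at_right 0)"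
    by (simp add: filterlim_cong)
  from tendsto_unique[OF _ L this] show ?thesis by simp
qed

end

section \<open>The completed Appell function as a lattice sum\<close>

definition in_lattice :: "complex \<Rightarrow> complex \<Rightarrow> bool" where
  "in_lattice \<tau> z \<longleftrightarrow> (\<exists>j n::int. z = of_int j * \<tau> + of_int n)"

lemma lattice_norm_lower_bound:
  assumes \<tau>: "Im \<tau> > 0"
  obtains K where "K > 0" "\<And>j n::int. (of_int j)\<^sup>2 + (of_int n)\<^sup>2 \<le> K * (norm (of_int j * \<tau> + of_int n))\<^sup>2"
proof
  define K where "K = 2 + (2 * (Re \<tau>)\<^sup>2 + 1) / (Im \<tau>)\<^sup>2"
  show "K > 0" using \<tau> by (auto simp: K_def intro!: add_pos_nonneg)
  fix j n :: int
  define a where "a = of_int j * Re \<tau> + of_int n"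
  have K: "2 \<le> K" "(2 * (Re \<tau>)\<^sup>2 + 1) \<le> K * (Im \<tau>)\<^sup>2" using \<tau> by (auto simp: K_def field_simps)
  have "0 \<le> (2 * (of_int j * Re \<tau>) + of_int n)\<^sup>2" by simp
  then have "(of_int n)\<^sup>2 \<le> 2 * a\<^sup>2 + 2 * (of_int j)\<^sup>2 * (Re \<tau>)\<^sup>2"
    by (simp add: a_def power2_eq_square algebra_simps)
  then have "(of_int j)\<^sup>2 + (of_int n)\<^sup>2 \<le> 2 * a\<^sup>2 + (2 * (Re \<tau>)\<^sup>2 + 1) * (of_int j)\<^sup>2"
    by (simp add: algebra_simps)
  also have "\<dots> \<le> K * a\<^sup>2 + (K * (Im \<tau>)\<^sup>2) * (of_int j)\<^sup>2"
    using K by (intro add_mono mult_right_mono) auto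
  also have "\<dots> = K * (norm (of_int j * \<tau> + of_int n))\<^sup>2"
    by (simp add: cmod_power2 a_def algebra_simps power_mult_distrib)
  finally show "(of_int j)\<^sup>2 + (of_int n)\<^sup>2 \<le> K * (norm (of_int j * \<tau> + of_int n))\<^sup>2" .
qed

lemma summable_on_lattice_gauss:
  assumes \<tau>: "Im \<tau> > 0" and c: "c > 0"
  shows "(\<lambda>(j::int, n::int). exp (- c * (norm (z + of_int j * \<tau> + of_int n))\<^sup>2)) summable_on UNIV"
proof -
  obtain K where K: "K > 0" "\<And>j n::int. (of_int j)\<^sup>2 + (of_int n)\<^sup>2 \<le> K * (norm (of_int j * \<tau> + of_int n))\<^sup>2"
    using lattice_norm_lower_bound[OF \<tau>] by blast
  show ?thesis
  proof (rule summable_on_comparison_test[OF summable_on_gauss_product[of "c / (2 * K)" "c / (2 * K)" 0 0 "c *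
      (norm z)\<^sup>2"]])
    fix jn :: "int \<times> int"
    obtain j n where jn: "jn = (j, n)" by (cases jn)
    define s where "s = of_int j * \<tau> + of_int n"
    have "norm s \<le> norm (z + s) + norm z" using norm_triangle_ineq4[of "z + s" z] by simp
    then have "(norm s)\<^sup>2 \<le> (norm (z + s) + norm z)\<^sup>2" by (intro power_mono) auto
    also have "\<dots> \<le> 2 * (norm (z + s))\<^sup>2 + 2 * (norm z)\<^sup>2"
      using zero_le_power2[of "norm (z + s) - norm z"] by (simp add: power2_eq_square algebra_simps)
    finally have "(of_int j)\<^sup>2 + (of_int n)\<^sup>2 \<le> K * (2 * (norm (z + s))\<^sup>2 + 2 * (norm z)\<^sup>2)"
      using K(2)[of j n] K(1) unfolding s_def[symmetric] by (meson mult_left_mono order_trans less_imp_le)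
    then have "c / (2 * K) * ((of_int j)\<^sup>2 + (of_int n)\<^sup>2) \<le> c / (2 * K) * (K * (2 * (norm (z + s))\<^sup>2 + 2 *
        (norm z)\<^sup>2))"
      using c K by (intro mult_left_mono) auto
    also have "\<dots> = c * (norm (z + s))\<^sup>2 + c * (norm z)\<^sup>2" using K by (simp add: field_simps)
    finally show "(case jn of (j, n) \<Rightarrow> exp (- c * (norm (z + of_int j * \<tau> + of_int n))\<^sup>2)) \<le>
       (case jn of (j, n) \<Rightarrow> exp (- (c / (2 * K)) * (of_int j)\<^sup>2 - c / (2 * K) * (of_int n)\<^sup>2 + 0 * of_int j +
           0 * of_int n + c * (norm z)\<^sup>2))"
      by (simp add: jn s_def add.assoc algebra_simps)
  qed (use c K in auto)
qed

text \<open>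
  Only finitely many lattice translates of \<open>z\<close> lie in the unit disc.
\<close>

lemma lattice_separated:
  assumes \<tau>: "Im \<tau> > 0" and z: "\<not> in_lattice \<tau> z"
  obtains \<delta> where "\<delta> > 0" "\<And>j n::int. \<delta> \<le> norm (z + of_int j * \<tau> + of_int n)"
proof -
  obtain K where K: "K > 0" "\<And>j n::int. (of_int j)\<^sup>2 + (of_int n)\<^sup>2 \<le> K * (norm (of_int j * \<tau> + of_int n))\<^sup>2"
    using lattice_norm_lower_bound[OF \<tau>] by blast
  define S where "S = {(j, n). norm (z + of_int j * \<tau> + of_int n) \<le> 1}"
  define B where "B = \<lceil>K * (1 + norm z)\<^sup>2\<rceil>"
  have "S \<subseteq> {- B..B} \<times> {- B..B}"
  proof
    fix x assume "x \<in> S"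
    then obtain j n where x: "x = (j, n)" and le: "norm (z + of_int j * \<tau> + of_int n) \<le> 1" by (auto simp: S_def)
    have "norm (of_int j * \<tau> + of_int n) \<le> 1 + norm z"
      using norm_triangle_ineq4[of "z + (of_int j * \<tau> + of_int n)" z] le by (simp add: add.assoc)
    then have "(norm (of_int j * \<tau> + of_int n))\<^sup>2 \<le> (1 + norm z)\<^sup>2" by (intro power_mono) auto
    then have "(of_int j)\<^sup>2 + (of_int n)\<^sup>2 \<le> K * (1 + norm z)\<^sup>2"
      using K(2)[of j n] K(1) by (meson mult_left_mono order_trans less_imp_le)
    then have "real_of_int (j\<^sup>2 + n\<^sup>2) \<le> of_int B" unfolding B_def by (simp add: le_ceiling_iff) linarith
    then have "j\<^sup>2 + n\<^sup>2 \<le> B" by linarith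
    moreover have "\<bar>k\<bar> \<le> k\<^sup>2" for k :: int
    proof (cases "k = 0")
      case False
      then have "\<bar>k\<bar> * 1 \<le> \<bar>k\<bar> * \<bar>k\<bar>" by (intro mult_left_mono) auto
      then show ?thesis by (simp add: power2_eq_square)
    qed auto
    note this[of j] this[of n]
    moreover have "0 \<le> j\<^sup>2" "0 \<le> n\<^sup>2" by auto
    ultimately show "x \<in> {- B..B} \<times> {- B..B}" unfolding x by auto
  qed
  then have fin: "finite S" by (rule finite_subset) auto
  define \<delta> where "\<delta> = Min (insert 1 ((\<lambda>(j, n). norm (z + of_int j * \<tau> + of_int n)) ` S))"
  have nz: "norm (z + of_int j * \<tau> + of_int n) > 0" for j n
  proof -
    have "z + of_int j * \<tau> + of_int n \<noteq> 0"
    proof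
      assume "z + of_int j * \<tau> + of_int n = 0"
      then have "z = of_int (- j) * \<tau> + of_int (- n)" by (simp add: algebra_simps eq_neg_iff_add_eq_0)
      with z show False unfolding in_lattice_def by blast
    qed
    then show ?thesis by simp
  qed
  show ?thesis
  proof
    show "\<delta> > 0" unfolding \<delta>_def using fin nz by (subst Min_gr_iff) auto
    show "\<delta> \<le> norm (z + of_int j * \<tau> + of_int n)" for j n
    proof (cases "(j, n) \<in> S")
      case True
      then show ?thesis unfolding \<delta>_def using fin by (intro Min_le) force+
    next
      case False
      have "\<delta> \<le> 1" unfolding \<delta>_def using fin by (intro Min_le) auto
      with False show ?thesis by (simp add: S_def)
    qed
  qed
qed

text \<open>
  A translate of the kernel \<open>exp (- c z1 (cnj z1 + 2 \<i> Im z2)) / z1\<close> with \<open>c = pi (2m + 1)/(2 Im \<tau>)\<close>.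
  Its modulus is \<open>exp (2 c Im z1 Im z2)\<close> times that of \<open>exp (- c \<bar>\<zeta>\<bar>\<^sup>2)/\<zeta>\<close>, so the terms form a rapidly
  converging series of Eisenstein-Kronecker type. The sign
  \<open>(-1)^(j + n + j n)\<close> depends only on the class of \<open>(j, n)\<close> modulo 2, being 1 exactly at 0, and is
  therefore invariant under every change of basis of the lattice.
\<close>

definition kron_term :: "nat \<Rightarrow> complex \<Rightarrow> complex \<Rightarrow> complex \<Rightarrow> int \<Rightarrow> int \<Rightarrow> complex" where
  "kron_term m \<tau> z1 z2 j n = (let \<zeta> = z1 + of_int j * \<tau> + of_int n in
     (-1) powi (j + n + j * n) * 
     exp (of_real pi * \<i> * (2 * of_nat m + 1) * of_int j * z2 
       - of_real (pi * (2 * of_nat m + 1) / (2 * Im \<tau>)) * \<zeta> * (cnj \<zeta> + 2 * \<i> * of_real (Im z2))) / \<zeta>)"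

definition kron_sum :: "nat \<Rightarrow> complex \<Rightarrow> complex \<Rightarrow> complex \<Rightarrow> complex" where
  "kron_sum m \<tau> z1 z2 = (\<Sum>\<^sub>\<infinity>(j, n). kron_term m \<tau> z1 z2 j n)"

lemma norm_kron_term:
  fixes m :: nat
  assumes \<tau>: "Im \<tau> > 0"
  defines "c \<equiv> pi * (2 * of_nat m + 1) / (2 * Im \<tau>)"
  shows "norm (kron_term m \<tau> z1 z2 j n) = 
    exp (2 * c * Im z1 * Im z2) * exp (- c * (norm (z1 + of_int j * \<tau> + of_int n))\<^sup>2) / norm (z1 + of_int j *
        \<tau> + of_int n)"
proof -
  define \<zeta> where "\<zeta> = z1 + of_int j * \<tau> + of_int n"
  have Im: "Im \<zeta> = Im z1 + of_int j * Im \<tau>" by (simp add: \<zeta>_def)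
  have weight_mult_Im: "c * (2 * Im \<tau>) = pi * (2 * of_nat m + 1)" using \<tau> by (simp add: c_def)
  have "Re (of_real pi * \<i> * (2 * of_nat m + 1) * of_int j * z2 - of_real c * \<zeta> * (cnj \<zeta> + 2 * \<i> *
      of_real (Im z2))) = 
     - (pi * (2 * of_nat m + 1) * of_int j * Im z2) - c * (norm \<zeta>)\<^sup>2 + 2 * c * Im \<zeta> * Im z2"
    unfolding cmod_power2 by (simp add: power2_eq_square algebra_simps)
  also have "\<dots> = 2 * c * Im z1 * Im z2 + - c * (norm \<zeta>)\<^sup>2"
    unfolding Im weight_mult_Im[symmetric] by (simp add: algebra_simps)
  finally show ?thesis
    unfolding kron_term_def Let_def c_def[symmetric] \<zeta>_def[symmetric]
    by (simp add: norm_mult norm_divide norm_power_int mult_exp_exp)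
qed

lemma kron_term_summable:
  assumes \<tau>: "Im \<tau> > 0" and z: "\<not> in_lattice \<tau> z1"
  shows "(\<lambda>(j, n). kron_term m \<tau> z1 z2 j n) summable_on UNIV"
proof -
  define c where "c = pi * (2 * of_nat m + 1) / (2 * Im \<tau>)"
  have c: "c > 0" using \<tau> by (simp add: c_def add_nonneg_pos)
  obtain \<delta> where d: "\<delta> > 0" "\<And>j n::int. \<delta> \<le> norm (z1 + of_int j * \<tau> + of_int n)"
    using lattice_separated[OF assms] by blast
  have "(\<lambda>x. exp (2 * c * Im z1 * Im z2) / \<delta> * (case x of (j::int, n::int) \<Rightarrow> exp (- c * (norm (z1 + of_int j *
      \<tau> + of_int n))\<^sup>2))) summable_on UNIV"
    by (intro summable_on_cmult_right summable_on_lattice_gauss \<tau> c)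
  then show ?thesis
  proof (rule abs_summable_summable[OF Infinite_Sum.abs_summable_on_comparison_test'])
    fix x :: "int \<times> int"
    obtain j n where x: "x = (j, n)" by (cases x)
    show "norm (case x of (j, n) \<Rightarrow> kron_term m \<tau> z1 z2 j n) \<le> exp (2 * c * Im z1 * Im z2) / \<delta> *
        (case x of (j, n) \<Rightarrow> exp (- c * (norm (z1 + of_int j * \<tau> + of_int n))\<^sup>2))"
      using d(1) d(2)[of j n] unfolding x by (simp add: norm_kron_term[OF \<tau>] c_def[symmetric] frac_le)
  qed
qed


text \<open>
  The product of a summand of \<^const>\<open>R_B\<close> at \<open>(z1 - z2)/2\<close> and of a summand of
  \<^const>\<open>Theta_minus\<close> at \<open>z1 + z2\<close>.
\<close>

definition corr_term :: "nat \<Rightarrow> complex \<Rightarrow> complex \<Rightarrow> complex \<Rightarrow> int \<Rightarrow> int \<Rightarrow> complex" where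
  "corr_term m \<tau> z1 z2 j n = (-1) powi j * 
     of_real (sgn (of_int n + 1/2) - E_fun ((of_int n + 1/2 + (2 * of_nat m + 1) * (Im ((z1 - z2) / 2) /
         Im \<tau>)) * sqrt (Im \<tau> / (of_nat m + 1/2)))) *
     exp (of_real pi * \<i> * (2 * of_nat m + 1) * of_int j * (z1 + z2) + of_real pi * \<i> * (2 * of_nat m + 1) *
         (of_int j)\<^sup>2 * \<tau>
        - 2 * of_real pi * \<i> * (of_int n + 1/2) * (z1 + of_int j * \<tau>))"

context
  fixes m :: nat and \<tau> z1 z2 :: complex and N y c x :: real and pref :: "int \<Rightarrow> complex"
  assumes \<tau>: "Im \<tau> > 0"
  defines "N \<equiv> 2 * of_nat m + 1" and "y \<equiv> Im \<tau>"
  defines "c \<equiv> pi * N / (2 * y)"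
  defines "x \<equiv> 2 * c * Im (z1 - z2)"
  defines "pref \<equiv> \<lambda>j. (-1) powi j * exp (of_real pi * \<i> * (2 * of_nat m + 1) * of_int j * (z1 + z2) +
      of_real pi * \<i> * (2 * of_nat m + 1) * (of_int j)\<^sup>2 * \<tau>)"
begin

lemma degree_pos: "N > 0" and Im_tau_pos: "y > 0" and weight_pos: "c > 0"
  using \<tau> by (auto simp: N_def y_def c_def)

lemma weight_mult_Im: "2 * c * y = pi * N"
  using Im_tau_pos by (simp add: c_def)

lemma kron_term_eq_appell_term:
  "kron_term m \<tau> z1 z2 j n = pref j * appell_term c (z1 + of_int j * \<tau>) x n"
proof -
  define \<zeta> where "\<zeta> = z1 + of_int j * \<tau> + of_int n"
  have cnj: "cnj \<zeta> = \<zeta> - 2 * \<i> * of_real (Im z1 + of_int j * y)"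
    by (simp add: \<zeta>_def complex_eq_iff y_def)
  have cy': "of_real c * of_real y = of_real pi * (2 * of_nat m + 1 :: complex) / 2"
  proof -
    have "complex_of_real (2 * (c * y)) = of_real (pi * N)" using weight_mult_Im by (simp add: mult.assoc)
    then have "2 * (of_real c * of_real y) = of_real pi * (2 * of_nat m + 1 :: complex)" by (simp add: N_def)
    then show ?thesis by (simp add: eq_divide_eq mult.commute)
  qed
  have "of_real pi * \<i> * (2 * of_nat m + 1) * of_int j * z2 - of_real c * \<zeta> * (cnj \<zeta> + 2 * \<i> * of_real (Im z2)) = 
     of_real pi * \<i> * (2 * of_nat m + 1) * of_int j * z2 - of_real c * \<zeta>\<^sup>2 + \<i> * of_real x * \<zeta> + 2 * \<i> *
         (of_real c * of_real y) * of_int j * \<zeta>"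
    unfolding cnj x_def by (simp add: power2_eq_square algebra_simps)
  also have "\<dots> = of_real pi * \<i> * of_int ((2 * int m + 1) * (j * n)) + ((of_real pi * \<i> * (2 * of_nat m + 1) *
      of_int j * (z1 + z2) + of_real pi * \<i> * (2 * of_nat m + 1) * (of_int j)\<^sup>2 * \<tau>) +
      (- of_real c * \<zeta>\<^sup>2 + \<i> * of_real x * \<zeta>))"
    unfolding cy' by (simp add: \<zeta>_def power2_eq_square algebra_simps)
  finally have e: "exp (of_real pi * \<i> * (2 * of_nat m + 1) * of_int j * z2 - of_real c * \<zeta> * (cnj \<zeta> + 2 * \<i> *
      of_real (Im z2))) = 
     (-1) powi ((2 * int m + 1) * (j * n)) * (exp (of_real pi * \<i> * (2 * of_nat m + 1) * of_int j * (z1 + z2) +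
         of_real pi * \<i> * (2 * of_nat m + 1) * (of_int j)\<^sup>2 * \<tau>) * exp (- of_real c * \<zeta>\<^sup>2 + \<i> * of_real x * \<zeta>))"
    unfolding mult_exp_exp exp_pi_i_int[symmetric] by (rule arg_cong[where f = exp])
  have sgn: "(-1) powi (j + n + j * n) * (-1) powi ((2 * int m + 1) * (j * n)) = (-1) powi j *
      ((-1) powi n :: complex)"
    by (simp add: minus_one_powi)
  have "c = pi * (2 * real m + 1) / (2 * Im \<tau>)" by (simp add: c_def N_def y_def)
  then have "kron_term m \<tau> z1 z2 j n = (-1) powi (j + n + j * n) * exp (of_real pi * \<i> * (2 * of_nat m + 1) *
      of_int j * z2 - of_real c * \<zeta> * (cnj \<zeta> + 2 * \<i> * of_real (Im z2))) / \<zeta>"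
    unfolding kron_term_def Let_def \<zeta>_def by simp
  also have "\<dots> = ((-1) powi (j + n + j * n) * (-1) powi ((2 * int m + 1) * (j * n))) * exp (of_real pi * \<i> *
      (2 * of_nat m + 1) * of_int j * (z1 + z2) + of_real pi * \<i> * (2 * of_nat m + 1) * (of_int j)\<^sup>2 * \<tau>) *
      exp (- of_real c * \<zeta>\<^sup>2 + \<i> * of_real x * \<zeta>) / \<zeta>"
    unfolding e by (simp only: mult.assoc)
  also have "\<dots> = pref j * appell_term c (z1 + of_int j * \<tau>) x n"
    unfolding sgn pref_def appell_term_def \<zeta>_def[symmetric] by (simp add: mult_ac)
  finally show ?thesis .
qed

lemma corr_term_eq_erf_term:
  "corr_term m \<tau> z1 z2 j n = - (pref j * erf_term c (z1 + of_int j * \<tau>) x n)"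
proof -
  define n' where "n' = (of_int n + 1/2 :: real)"
  have xx: "x = 2 * pi * (N * (Im ((z1 - z2) / 2) / Im \<tau>))"
    using Im_tau_pos by (simp add: x_def c_def y_def field_simps)
  have s: "sqrt (pi * c) * sqrt (Im \<tau> / (of_nat m + 1/2)) = pi"
  proof -
    have "pi * c * (Im \<tau> / (of_nat m + 1/2)) = pi\<^sup>2"
    proof -
      have "real m + 1/2 = N / 2" by (simp add: N_def)
      show ?thesis unfolding \<open>real m + 1/2 = N / 2\<close> using Im_tau_pos degree_pos by (simp add: c_def y_def
          power2_eq_square)
    qed
    then show ?thesis by (metis real_sqrt_mult real_sqrt_pow2_iff real_sqrt_abs abs_of_pos pi_gt_zero)
  qed
  have "sqrt (pi * c) > 0" using weight_pos by simp
  have E: "(x + 2 * pi * n') / (2 * sqrt (pi * c)) = (n' + (2 * of_nat m + 1) * (Im ((z1 - z2) / 2) / Im \<tau>)) *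
      sqrt (Im \<tau> / (of_nat m + 1/2))"
  proof -
    have "(x + 2 * pi * n') / (2 * sqrt (pi * c)) = (n' + N * (Im ((z1 - z2) / 2) / Im \<tau>)) * (pi / sqrt (pi * c))"
    proof -
      have "(2 * pi * q + 2 * pi * n') / (2 * s) = (n' + q) * (pi / s)" for q s
      proof -
        have "2 * pi * q + 2 * pi * n' = 2 * ((n' + q) * pi)" by (simp add: algebra_simps)
        then show ?thesis by simp
      qed
      then show ?thesis unfolding xx .
    qed
    also have "pi / sqrt (pi * c) = sqrt (Im \<tau> / (of_nat m + 1/2))"
    proof -
      have "(a * b) / a = b" if "a > 0" for a b :: real using that by simp
      from this[OF \<open>sqrt (pi * c) > 0\<close>, of "sqrt (Im \<tau> / (of_nat m + 1/2))"] show ?thesis unfolding s .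
    qed
    finally show ?thesis by (simp add: N_def)
  qed
  have "exp (of_real pi * \<i> * (2 * of_nat m + 1) * of_int j * (z1 + z2) + of_real pi * \<i> * (2 * of_nat m + 1) *
      (of_int j)\<^sup>2 * \<tau>
        - 2 * of_real pi * \<i> * (of_int n + 1/2) * (z1 + of_int j * \<tau>)) = 
     exp (of_real pi * \<i> * (2 * of_nat m + 1) * of_int j * (z1 + z2) + of_real pi * \<i> * (2 * of_nat m + 1) *
         (of_int j)\<^sup>2 * \<tau>) * 
     exp (- (2 * of_real pi * \<i> * (of_int n + 1/2) * (z1 + of_int j * \<tau>)))"
    unfolding mult_exp_exp by simp
  then show ?thesis
    unfolding corr_term_def erf_term_def pref_def n'_def[symmetric] E
    by (simp add: algebra_simps)
qed

text \<open>
  The moduli of the factors depending on \<open>j\<close> and on \<open>n\<close> combine to a Gaussian of the quadratic form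
  \<open>N j\<^sup>2 - 2 j n + 2 n\<^sup>2/N\<close>, which is positive definite; the inequality
  \<open>2 j n \<le> 3/4 N j\<^sup>2 + 4/(3 N) n\<^sup>2\<close> splits it.
\<close>

lemma corr_term_summable: "(\<lambda>(j, n). corr_term m \<tau> z1 z2 j n) summable_on UNIV"
proof -
  define B1 where "B1 = pi * y - pi * N * Im (z1 + z2)"
  define B2 where "B2 = 2 * pi * Im z1 - pi * (x + pi) / c"
  define B3 where "B3 = pi * Im z1 - (x + pi)\<^sup>2 / (4 * c)"
  have "(\<lambda>p. 2 * exp (x\<^sup>2 / c) * (case p of (j::int, n::int) \<Rightarrow> exp (- (pi * y * N / 4) * (of_int j)\<^sup>2 - (2 *
      pi * y / (3 * N)) * (of_int n)\<^sup>2 + B1 * of_int j + B2 * of_int n + B3))) summable_on UNIV"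
    by (intro summable_on_cmult_right summable_on_gauss_product) (use degree_pos Im_tau_pos in auto)
  then show ?thesis
  proof (rule abs_summable_summable[OF Infinite_Sum.abs_summable_on_comparison_test'])
    fix p :: "int \<times> int"
    obtain j n where p: "p = (j, n)" by (cases p)
    have npref: "norm (pref j) = exp (- (pi * N * of_int j * Im (z1 + z2)) - pi * N * (of_int j)\<^sup>2 * y)"
    proof -
      have "Re (of_real pi * \<i> * (2 * of_nat m + 1) * of_int j * (z1 + z2) + of_real pi * \<i> * (2 * of_nat m +
          1) * (of_int j)\<^sup>2 * \<tau>) =
         - (pi * N * of_int j * Im (z1 + z2)) - pi * N * (of_int j)\<^sup>2 * y"
        by (simp add: N_def y_def power2_eq_square algebra_simps)
      then show ?thesis by (simp add: pref_def norm_mult norm_power_int)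
    qed
    define Q where "Q = - (pi\<^sup>2 / c) * (of_int n)\<^sup>2 + (2 * pi * Im (z1 + of_int j * \<tau>) - pi * (x + pi) / c) *
        of_int n + (pi * Im (z1 + of_int j * \<tau>) - (x + pi)\<^sup>2 / (4 * c))"
    have pc: "pi\<^sup>2 / c = 2 * pi * y / N" using degree_pos Im_tau_pos by (simp add: c_def power2_eq_square)
    have ineq: "2 * (real_of_int j * of_int n) \<le> 3 / 4 * N * (of_int j)\<^sup>2 + 4 / (3 * N) * (of_int n)\<^sup>2"
    proof -
      have "0 \<le> (3 * N * of_int j - 4 * of_int n)\<^sup>2 / (12 * N)" using degree_pos by simp
      also have "\<dots> = 3 / 4 * N * (of_int j)\<^sup>2 + 4 / (3 * N) * (of_int n)\<^sup>2 - 2 * (of_int j * of_int n)"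
        using degree_pos by (simp add: field_simps power2_eq_square)
      finally show ?thesis by simp
    qed
    have "(- (pi * N * of_int j * Im (z1 + z2)) - pi * N * (of_int j)\<^sup>2 * y) + Q = 
      - (pi * y * N) * (of_int j)\<^sup>2 - (2 * pi * y / N) * (of_int n)\<^sup>2 + pi * y * (2 * (of_int j * of_int n)) +
          B1 * of_int j + B2 * of_int n + B3"
      unfolding Q_def pc B1_def B2_def B3_def by (simp add: y_def algebra_simps)
    also have "\<dots> \<le> - (pi * y * N) * (of_int j)\<^sup>2 - (2 * pi * y / N) * (of_int n)\<^sup>2 + pi * y * (3 / 4 * N *
        (of_int j)\<^sup>2 + 4 / (3 * N) * (of_int n)\<^sup>2) + B1 * of_int j + B2 * of_int n + B3"
      using ineq Im_tau_pos by (intro add_mono order_refl mult_left_mono) auto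
    also have "\<dots> = - (pi * y * N / 4) * (of_int j)\<^sup>2 - (2 * pi * y / (3 * N)) * (of_int n)\<^sup>2 + B1 * of_int j +
        B2 * of_int n + B3"
      using degree_pos by (simp add: field_simps)
    finally have le: "(- (pi * N * of_int j * Im (z1 + z2)) - pi * N * (of_int j)\<^sup>2 * y) + Q \<le> 
        - (pi * y * N / 4) * (of_int j)\<^sup>2 - (2 * pi * y / (3 * N)) * (of_int n)\<^sup>2 + B1 * of_int j + B2 *
            of_int n + B3" .
    have "norm (corr_term m \<tau> z1 z2 j n) = norm (pref j) * norm (erf_term c (z1 + of_int j * \<tau>) x n)"
      by (simp add: corr_term_eq_erf_term norm_mult)
    also have "\<dots> \<le> norm (pref j) * (2 * exp (x\<^sup>2 / c) * exp Q)"
      unfolding Q_def by (intro mult_left_mono erf_term_bound[OF weight_pos]) auto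
    also have "\<dots> = 2 * exp (x\<^sup>2 / c) * exp ((- (pi * N * of_int j * Im (z1 + z2)) - pi * N * (of_int j)\<^sup>2 * y) + Q)"
      unfolding npref exp_add by (simp only: mult_ac)
    also have "\<dots> \<le> 2 * exp (x\<^sup>2 / c) * exp (- (pi * y * N / 4) * (of_int j)\<^sup>2 - (2 * pi * y / (3 * N)) *
        (of_int n)\<^sup>2 + B1 * of_int j + B2 * of_int n + B3)"
      using le by (intro mult_left_mono) auto
    finally show "norm (case p of (j, n) \<Rightarrow> corr_term m \<tau> z1 z2 j n) \<le> 2 * exp (x\<^sup>2 / c) *
        (case p of (j, n) \<Rightarrow> exp (- (pi * y * N / 4) * (of_int j)\<^sup>2 - (2 * pi * y / (3 * N)) * (of_int n)\<^sup>2 +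
        B1 * of_int j + B2 * of_int n + B3))"
      by (simp add: p)
  qed
qed

text \<open>
  Summing over \<open>n\<close> first, the expansion of the Gaussian over simple fractions splits the row with
  index \<open>j\<close> into the summand of \<^const>\<open>Phi1_B\<close>, coming from the cosecant, and a series of error
  functions.
\<close>

theorem kron_sum_expansion:
  assumes z1: "\<not> in_lattice \<tau> z1"
  shows "\<i> / (2 * of_real pi) * kron_sum m \<tau> z1 z2 = Phi1_B m \<tau> z1 z2 0 + 1/2 * (\<Sum>\<^sub>\<infinity>(j, n). corr_term m \<tau> z1 z2 j n)"
proof -
  define Z where "Z j = z1 + of_int j * \<tau>" for j :: int
  have Z: "Z j \<notin> \<int>" for j
  proof
    assume "Z j \<in> \<int>"
    then obtain n where "Z j = of_int n" by (elim Ints_cases)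
    then have "z1 = of_int (- j) * \<tau> + of_int n" by (simp add: Z_def algebra_simps)
    with z1 show False unfolding in_lattice_def by blast
  qed
  define P where "P j = (-1) powi j *
        (exp (of_real pi * \<i> * of_int j * (2 * of_nat m + 1) * (z1 + z2) + of_real pi * \<i> * z1)
           * qpow \<tau> ((of_nat m + 1/2) * (of_int j)\<^sup>2 + of_int j / 2))
        / (1 - exp (2 * of_real pi * \<i> * z1) * qpow \<tau> (of_int j))" for j :: int
  define K where "K j = (\<Sum>\<^sub>\<infinity>n. kron_term m \<tau> z1 z2 j n)" for j
  define D where "D j = (\<Sum>\<^sub>\<infinity>n. corr_term m \<tau> z1 z2 j n)" for j
  have P: "P j = \<i> / (2 * of_real pi) * (pref j * (of_real pi / sin (of_real pi * Z j)))" for j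
  proof -
    define f where "f = exp (of_real pi * \<i> * Z j)"
    have f0: "f \<noteq> 0" by (simp add: f_def)
    have f2: "exp (2 * of_real pi * \<i> * z1) * qpow \<tau> (of_int j) = f * f"
      unfolding f_def qpow_def mult_exp_exp by (rule arg_cong[where f = exp]) (simp add: Z_def algebra_simps)
    have e1: "exp (of_real pi * \<i> * of_int j * (2 * of_nat m + 1) * (z1 + z2) + of_real pi * \<i> * z1) *
        qpow \<tau> ((of_nat m + 1/2) * (of_int j)\<^sup>2 + of_int j / 2)
       = exp (of_real pi * \<i> * (2 * of_nat m + 1) * of_int j * (z1 + z2) + of_real pi * \<i> * (2 * of_nat m + 1) *
           (of_int j)\<^sup>2 * \<tau>) * f"
      unfolding f_def qpow_def mult_exp_exp by (rule arg_cong[where f =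
          exp]) (simp add: Z_def power2_eq_square field_simps)
    have "exp (2 * of_real pi * \<i> * Z j) = f * f"
      unfolding f_def mult_exp_exp by (rule arg_cong[where f = exp]) (simp add: algebra_simps)
    then have s: "1 - f * f = - (2 * \<i> * f * sin (of_real pi * Z j))"
      using one_minus_exp_2pi[of "Z j"] by (simp add: f_def)
    have "P j = pref j * (f / (1 - f * f))"
      unfolding P_def e1 f2 pref_def by (simp add: algebra_simps)
    also have "f / (1 - f * f) = \<i> / 2 / sin (of_real pi * Z j)"
    proof -
      have "f / (- (2 * \<i> * f * S)) = \<i> / 2 / S" for S
        by (cases "S = 0") (simp_all add: f0 field_simps)
      then show ?thesis unfolding s .
    qed
    finally show ?thesis by simp
  qed
  have K_sum: "K summable_on UNIV" and K_tot: "(\<Sum>\<^sub>\<infinity>j. K j) = kron_sum m \<tau> z1 z2"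
    using summable_on_Sigma_banach[of "kron_term m \<tau> z1 z2" UNIV "\<lambda>_. UNIV"] infsum_Sigma'_banach[of "kron_term
        m \<tau> z1 z2" UNIV "\<lambda>_. UNIV"] kron_term_summable[OF \<tau> z1, of m z2]
    by (simp_all add: K_def[abs_def] kron_sum_def)
  have D_sum: "D summable_on UNIV" and D_tot: "(\<Sum>\<^sub>\<infinity>j. D j) = (\<Sum>\<^sub>\<infinity>(j, n). corr_term m \<tau> z1 z2 j n)"
    using summable_on_Sigma_banach[of "corr_term m \<tau> z1 z2" UNIV "\<lambda>_. UNIV"] infsum_Sigma'_banach[of "corr_term
        m \<tau> z1 z2" UNIV "\<lambda>_. UNIV"] corr_term_summable
    by (simp_all add: D_def[abs_def])
  have PK: "P j = \<i> / (2 * of_real pi) * K j + (- 1/2) * D j" for j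
  proof -
    have "K j = pref j * (\<Sum>\<^sub>\<infinity>n. appell_term c (Z j) x n)"
      by (simp add: K_def kron_term_eq_appell_term Z_def infsum_cmult_right')
    also have "\<dots> = pref j * (of_real pi / sin (of_real pi * Z j)) + \<i> * of_real pi * (pref j *
        (\<Sum>\<^sub>\<infinity>n. erf_term c (Z j) x n))"
      unfolding appell_expansion[OF weight_pos Z] by (simp add: algebra_simps)
    also have "pref j * (\<Sum>\<^sub>\<infinity>n. erf_term c (Z j) x n) = - D j"
      by (simp add: D_def corr_term_eq_erf_term Z_def infsum_uminus infsum_cmult_right')
    finally have K: "K j = pref j * (of_real pi / sin (of_real pi * Z j)) + \<i> * of_real pi * - D j" .
    have "\<i> / (2 * of_real pi) * K j = P j + 1/2 * D j"
      unfolding K P distrib_left by simp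
    then show ?thesis by simp
  qed
  have "(\<Sum>\<^sub>\<infinity>j. P j) = (\<Sum>\<^sub>\<infinity>j. \<i> / (2 * of_real pi) * K j) + (\<Sum>\<^sub>\<infinity>j. (- 1/2) * D j)"
    unfolding PK by (intro infsum_add summable_on_cmult_right K_sum D_sum)
  then have "(\<Sum>\<^sub>\<infinity>j. P j) = \<i> / (2 * of_real pi) * kron_sum m \<tau> z1 z2 + (- 1/2) * (\<Sum>\<^sub>\<infinity>(j, n). corr_term m \<tau> z1 z2 j n)"
    unfolding infsum_cmult_right' K_tot D_tot .
  moreover have "Phi1_B m \<tau> z1 z2 0 = (\<Sum>\<^sub>\<infinity>j. P j)"
    by (simp add: Phi1_B_def P_def)
  ultimately show ?thesis by (simp add: algebra_simps)
qed

end

lemma R_B_eq_infsum_int: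
  "R_B m J \<tau> v = (\<Sum>\<^sub>\<infinity>s::int. (-1) powi s *
     of_real (sgn (of_int (J + (2 * int m + 1) * s) + 1/2) - E_fun ((of_int (J + (2 * int m + 1) * s) + 1/2 +
         (2 * of_nat m + 1) * (Im v / Im \<tau>)) * sqrt (Im \<tau> / (of_nat m + 1/2)))) *
     exp (- (of_real pi * \<i> * (of_int (J + (2 * int m + 1) * s) + 1/2)\<^sup>2 * \<tau> / (2 * of_nat m + 1)) - 2 *
         of_real pi * \<i> * (of_int (J + (2 * int m + 1) * s) + 1/2) * v))"
proof -
  define N where "N = 2 * int m + 1"
  define g where "g s = of_int (J + N * s) + (1/2 :: real)" for s
  have N: "real_of_int N = 2 * of_nat m + 1" by (simp add: N_def)
  have bij: "bij_betw g UNIV {n::real. n - 1/2 \<in> \<int> \<and> (\<exists>l::int. n - (of_int J + 1/2) = of_int l * (2 * of_nat m + 1))}"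
  proof (rule bij_betwI')
    show "(g s = g t) = (s = t)" for s t by (simp add: g_def N_def)
    show "g s \<in> {n::real. n - 1/2 \<in> \<int> \<and> (\<exists>l::int. n - (of_int J + 1/2) = of_int l * (2 * of_nat m + 1))}" for s
      by (auto simp: g_def N[symmetric] intro!: exI[of _ s])
    fix n :: real assume "n \<in> {n::real. n - 1/2 \<in> \<int> \<and> (\<exists>l::int. n - (of_int J + 1/2) = of_int l * (2 *
        of_nat m + 1))}"
    then obtain l :: int where "n - (of_int J + 1/2) = of_int l * (2 * of_nat m + 1)" by auto
    then have "n = g l" by (simp add: g_def N algebra_simps)
    then show "\<exists>s\<in>UNIV. n = g s" by blast
  qed
  have sgn: "(-1) powi \<lfloor>g s - (of_int J + 1/2)\<rfloor> = ((-1) powi s :: complex)" for s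
  proof -
    have "g s - (of_int J + 1/2) = of_int (N * s)" by (simp add: g_def)
    then have "\<lfloor>g s - (of_int J + 1/2)\<rfloor> = N * s" by (metis floor_of_int)
    then show ?thesis by (simp add: minus_one_powi N_def)
  qed
  have g: "complex_of_real (g s) = of_int (J + N * s) + 1/2" for s by (simp add: g_def)
  show ?thesis
    unfolding R_B_def infsum_reindex_bij_betw[OF bij, symmetric] sgn g by (simp add: g_def N_def)
qed

lemma Theta_minus_term:
  "(-1) powi n * exp (2 * of_real pi * \<i> * (of_nat m + 1/2) * z * (of_int n + p / (2 * of_nat m + 1))) *
      qpow \<tau> ((of_nat m + 1/2) * (of_int n + p / (2 * of_nat m + 1))\<^sup>2)
   = (-1) powi n * exp (of_real pi * \<i> * ((2 * of_nat m + 1) * (of_int n) + p) * z + of_real pi * \<i> * ((2 *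
       of_nat m + 1) * of_int n + p)\<^sup>2 * \<tau> / (2 * of_nat m + 1))"
proof -
  define N :: complex where "N = 2 * of_nat m + 1"
  have "N = of_nat (2 * m + 1)" by (simp add: N_def)
  then have N0: "N \<noteq> 0" by (metis of_nat_eq_0_iff add_is_0 one_neq_zero)
  have h: "of_nat m + 1/2 = N / 2" by (simp add: N_def)
  show ?thesis
    unfolding N_def[symmetric] h qpow_def mult.assoc mult_exp_exp using N0
    by (intro arg_cong2[where f = "(*)"] arg_cong[where f = exp] refl) (simp add: field_simps power2_eq_square)
qed

text \<open>
  The index \<open>n + 1/2\<close> of \<^const>\<open>R_B\<close> runs through a residue class modulo \<open>2m + 1\<close>, and so does the
  index of the theta function, multiplied by \<open>2m + 1\<close>; their sum is \<open>(2m + 1) j\<close>. Summing over all classes gives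
  the whole double series. For the opposite theta function one replaces \<open>n + 1/2\<close> by its negative,
  which exchanges \<open>z1\<close> and \<open>z2\<close> and reverses the sign, since \<open>E\<close> and \<open>sgn\<close> are odd.
\<close>

lemma sum_R_B_Theta_minus:
  assumes \<tau>: "Im \<tau> > 0"
  shows "(\<Sum>J\<in>{0..2 * int m}. R_B m J \<tau> ((z1 - z2) / 2) * Theta_minus m (- (of_int J + 1/2)) \<tau> (z1 + z2)) =
      (\<Sum>\<^sub>\<infinity>(j, n). corr_term m \<tau> z1 z2 j n)"
    and "(\<Sum>J\<in>{0..2 * int m}. R_B m J \<tau> ((z1 - z2) / 2) * Theta_minus m (of_int J + 1/2) \<tau> (z1 + z2)) = -
        (\<Sum>\<^sub>\<infinity>(j, n). corr_term m \<tau> z2 z1 j n)"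
proof -
  define N where "N = 2 * int m + 1"
  have N: "N > 0" "complex_of_int N = 2 * of_nat m + 1" by (simp_all add: N_def)
  have N0: "2 * of_nat m + 1 \<noteq> (0 :: complex)" using N by (metis of_int_eq_0_iff less_irrefl)
  define w where "w = z1 + z2"
  define v where "v = (z1 - z2) / 2"
  define S where "S n = complex_of_real (sgn (of_int n + 1/2) - E_fun ((of_int n + 1/2 + (2 * of_nat m + 1) *
      (Im v / Im \<tau>)) * sqrt (Im \<tau> / (of_nat m + 1/2))))" for n :: int
  define R where "R J s = (-1) powi s * S (J + N * s) * exp (- (of_real pi * \<i> * (of_int (J + N * s) + 1/2)\<^sup>2 *
      \<tau> / (2 * of_nat m + 1)) - 2 * of_real pi * \<i> * (of_int (J + N * s) + 1/2) * v)" for J s :: int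
  define T where "T p n = (-1) powi n * exp (of_real pi * \<i> * ((2 * of_nat m + 1) * (of_int n) + p) * w +
      of_real pi * \<i> * ((2 * of_nat m + 1) * of_int n + p)\<^sup>2 * \<tau> / (2 * of_nat m + 1))" for p :: complex and n :: int
  have RB: "R_B m J \<tau> v = (\<Sum>\<^sub>\<infinity>s. R J s)" for J
    unfolding R_B_eq_infsum_int R_def S_def N_def ..
  have TH: "Theta_minus m p \<tau> w = (\<Sum>\<^sub>\<infinity>n. T (of_real p) n)" for p
    unfolding Theta_minus_def Theta_minus_term T_def ..
  have sum_int: "(\<Sum>J\<in>{0..2 * int m}. \<Sum>\<^sub>\<infinity>s. \<Sum>\<^sub>\<infinity>j. c j (J + N * s)) = (\<Sum>\<^sub>\<infinity>(j, n). c j n)"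
    if c: "(\<lambda>(j, n). c j n) summable_on UNIV" for c :: "int \<Rightarrow> int \<Rightarrow> complex"
  proof -
    have c': "(\<lambda>(n, j). c j n) summable_on UNIV \<times> UNIV"
      using c summable_on_swap[of "\<lambda>(j, n). c j n" UNIV UNIV] by (simp add: case_prod_unfold)
    have "(\<lambda>n. \<Sum>\<^sub>\<infinity>j. c j n) summable_on UNIV"
      by (rule summable_on_Sigma_banach[of "\<lambda>n j. c j n", OF c'])
    then have "(\<Sum>J\<in>{0..<N}. \<Sum>\<^sub>\<infinity>s. \<Sum>\<^sub>\<infinity>j. c j (J + N * s)) = (\<Sum>\<^sub>\<infinity>n. \<Sum>\<^sub>\<infinity>j. c j n)"
      by (rule infsum_int_residues[OF N(1), symmetric])
    also have "\<dots> = (\<Sum>\<^sub>\<infinity>j. \<Sum>\<^sub>\<infinity>n. c j n)"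
      by (rule infsum_swap_banach) (use c' in simp)
    also have "\<dots> = (\<Sum>\<^sub>\<infinity>(j, n)\<in>UNIV \<times> UNIV. c j n)"
      by (rule infsum_Sigma'_banach) (use c in simp)
    also have "{0..<N} = {0..2 * int m}" by (auto simp: N_def)
    finally show ?thesis by simp
  qed
  have 1: "R J s * T (of_real (- (of_int J + 1/2))) n = corr_term m \<tau> z1 z2 (n + s) (J + N * s)" for J s n
  proof -
    define a :: complex where "a = of_int (J + N * s) + 1/2"
    have p: "(2 * of_nat m + 1) * of_int n + of_real (- (of_int J + 1/2)) = (2 * of_nat m + 1) * of_int (n + s) - a"
      by (simp add: a_def N algebra_simps)
    have sg: "(-1) powi s * (-1) powi n = ((-1) powi (n + s) :: complex)" by (simp add: minus_one_powi)
    have ex: "- (of_real pi * \<i> * a\<^sup>2 * \<tau> / (2 * of_nat m + 1)) - 2 * of_real pi * \<i> * a * v + 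
        (of_real pi * \<i> * ((2 * of_nat m + 1) * of_int (n + s) - a) * w + of_real pi * \<i> * ((2 * of_nat m + 1) *
            of_int (n + s) - a)\<^sup>2 * \<tau> / (2 * of_nat m + 1)) =
        of_real pi * \<i> * (2 * of_nat m + 1) * of_int (n + s) * (z1 + z2) + of_real pi * \<i> * (2 * of_nat m + 1) *
            (of_int (n + s))\<^sup>2 * \<tau> - 2 * of_real pi * \<i> * a * (z1 + of_int (n + s) * \<tau>)"
    proof -
      have "- (of_real pi * \<i> * a\<^sup>2 * \<tau> / B) - 2 * of_real pi * \<i> * a * v + 
        (of_real pi * \<i> * (B * k - a) * w + of_real pi * \<i> * (B * k - a)\<^sup>2 * \<tau> / B) =
        of_real pi * \<i> * B * k * (z1 + z2) + of_real pi * \<i> * B * k\<^sup>2 * \<tau> - 2 * of_real pi * \<i> * a * (z1 + k *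
            \<tau>)" if "B \<noteq> 0" for B k :: complex
        using that by (simp add: v_def w_def field_simps power2_eq_square)
      from this[OF N0] show ?thesis .
    qed
    have "R J s * T (of_real (- (of_int J + 1/2))) n = ((-1) powi s * (-1) powi n) * S (J + N * s) *
        (exp (- (of_real pi * \<i> * a\<^sup>2 * \<tau> / (2 * of_nat m + 1)) - 2 * of_real pi * \<i> * a * v) * 
       exp (of_real pi * \<i> * ((2 * of_nat m + 1) * of_int (n + s) - a) * w + of_real pi * \<i> * ((2 * of_nat m +
           1) * of_int (n + s) - a)\<^sup>2 * \<tau> / (2 * of_nat m + 1)))"
      unfolding R_def T_def p a_def[symmetric] by (simp only: mult_ac)
    also have "\<dots> = corr_term m \<tau> z1 z2 (n + s) (J + N * s)"
      unfolding sg mult_exp_exp ex unfolding corr_term_def S_def v_def a_def ..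
    finally show ?thesis .
  qed
  have shift: "(\<Sum>\<^sub>\<infinity>n. c (n + s)) = (\<Sum>\<^sub>\<infinity>j. c j)" for c :: "int \<Rightarrow> complex" and s
    by (rule infsum_reindex_bij_witness[of _ "\<lambda>j. j - s" "\<lambda>n. n + s"]) auto
  have "(\<Sum>J\<in>{0..2 * int m}. R_B m J \<tau> v * Theta_minus m (- (of_int J + 1/2)) \<tau> w) = 
     (\<Sum>J\<in>{0..2 * int m}. \<Sum>\<^sub>\<infinity>s. \<Sum>\<^sub>\<infinity>n. corr_term m \<tau> z1 z2 (n + s) (J + N * s))"
    unfolding RB TH infsum_cmult_infsum 1 ..
  also have "\<dots> = (\<Sum>J\<in>{0..2 * int m}. \<Sum>\<^sub>\<infinity>s. \<Sum>\<^sub>\<infinity>j. corr_term m \<tau> z1 z2 j (J + N * s))"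
    by (intro sum.cong infsum_cong refl shift)
  also have "\<dots> = (\<Sum>\<^sub>\<infinity>(j, n). corr_term m \<tau> z1 z2 j n)"
    by (rule sum_int[OF corr_term_summable[OF \<tau>]])
  finally show "(\<Sum>J\<in>{0..2 * int m}. R_B m J \<tau> ((z1 - z2) / 2) * Theta_minus m (- (of_int J + 1/2)) \<tau> (z1 +
      z2)) = (\<Sum>\<^sub>\<infinity>(j, n). corr_term m \<tau> z1 z2 j n)"
    unfolding v_def w_def .
  have 2: "R J s * T (of_real (of_int J + 1/2)) n = - corr_term m \<tau> z2 z1 (n + - s) (- 1 - (J + N * s))" for J s n
  proof -
    define a :: complex where "a = of_int (J + N * s) + 1/2"
    have p: "(2 * of_nat m + 1) * of_int n + of_real (of_int J + 1/2) = (2 * of_nat m + 1) * of_int (n + - s) + a"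
      by (simp add: a_def N algebra_simps)
    have sg: "(-1) powi s * (-1) powi n = ((-1) powi (n + - s) :: complex)" by (simp add: minus_one_powi)
    have ex: "- (of_real pi * \<i> * a\<^sup>2 * \<tau> / (2 * of_nat m + 1)) - 2 * of_real pi * \<i> * a * v + 
        (of_real pi * \<i> * ((2 * of_nat m + 1) * of_int (n + - s) + a) * w + of_real pi * \<i> * ((2 * of_nat m +
            1) * of_int (n + - s) + a)\<^sup>2 * \<tau> / (2 * of_nat m + 1)) =
        of_real pi * \<i> * (2 * of_nat m + 1) * of_int (n + - s) * (z2 + z1) + of_real pi * \<i> * (2 * of_nat m +
            1) * (of_int (n + - s))\<^sup>2 * \<tau> - 2 * of_real pi * \<i> * (- a) * (z2 + of_int (n + - s) * \<tau>)"
    proof -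
      have "- (of_real pi * \<i> * a\<^sup>2 * \<tau> / B) - 2 * of_real pi * \<i> * a * v + 
        (of_real pi * \<i> * (B * k + a) * w + of_real pi * \<i> * (B * k + a)\<^sup>2 * \<tau> / B) =
        of_real pi * \<i> * B * k * (z2 + z1) + of_real pi * \<i> * B * k\<^sup>2 * \<tau> - 2 * of_real pi * \<i> * (- a) * (z2 +
            k * \<tau>)" if "B \<noteq> 0" for B k :: complex
        using that by (simp add: v_def w_def field_simps power2_eq_square)
      from this[OF N0] show ?thesis .
    qed
    define a' :: real where "a' = of_int (J + N * s) + 1/2"
    have a': "of_int (- 1 - (J + N * s)) + 1/2 = - a'" "of_int (- 1 - (J + N * s)) + 1/2 = - a" 
      by (simp_all add: a'_def a_def)
    have Sm: "S (J + N * s) = - of_real (sgn (- a') - E_fun ((- a' + (2 * of_nat m + 1) * (Im ((z2 - z1) / 2) /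
        Im \<tau>)) * sqrt (Im \<tau> / (of_nat m + 1/2))))"
    proof -
      have "Im ((z2 - z1) / 2) / Im \<tau> = - (Im v / Im \<tau>)" by (simp add: v_def minus_divide_left)
      then have "- a' + (2 * of_nat m + 1) * (Im ((z2 - z1) / 2) / Im \<tau>) = - (a' + (2 * of_nat m + 1) * (Im v /
          Im \<tau>))"
        by simp
      then show ?thesis unfolding S_def a'_def[symmetric] by (simp only: mult_minus_left E_fun_minus sgn_minus) simp
    qed
    have "R J s * T (of_real (of_int J + 1/2)) n = ((-1) powi s * (-1) powi n) * S (J + N * s) *
        (exp (- (of_real pi * \<i> * a\<^sup>2 * \<tau> / (2 * of_nat m + 1)) - 2 * of_real pi * \<i> * a * v) * 
       exp (of_real pi * \<i> * ((2 * of_nat m + 1) * of_int (n + - s) + a) * w + of_real pi * \<i> * ((2 * of_nat m +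
           1) * of_int (n + - s) + a)\<^sup>2 * \<tau> / (2 * of_nat m + 1)))"
      unfolding R_def T_def p a_def[symmetric] by (simp only: mult_ac)
    also have "\<dots> = - corr_term m \<tau> z2 z1 (n + - s) (- 1 - (J + N * s))"
      unfolding sg mult_exp_exp ex unfolding corr_term_def Sm a' by (simp only: mult_minus_left mult_minus_right)
    finally show ?thesis .
  qed
  have neg_sum: "(\<lambda>(j, n). - corr_term m \<tau> z2 z1 j (- 1 - n)) summable_on UNIV"
  proof -
    have "(\<lambda>(j, n). corr_term m \<tau> z2 z1 j (- 1 - n)) summable_on UNIV"
      by (rule summable_on_reindex_bij_witness[of UNIV "\<lambda>(j, n). (j, - 1 - n)" "\<lambda>(j, n). (j, - 1 -
          n)", THEN iffD1, OF _ _ _ _ _ corr_term_summable[OF \<tau>, of m z2 z1]]) auto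
    from summable_on_uminus[THEN iffD2, OF this] show ?thesis by (simp add: case_prod_unfold)
  qed
  have "(\<Sum>J\<in>{0..2 * int m}. R_B m J \<tau> v * Theta_minus m (of_int J + 1/2) \<tau> w) = 
     (\<Sum>J\<in>{0..2 * int m}. \<Sum>\<^sub>\<infinity>s. \<Sum>\<^sub>\<infinity>n. - corr_term m \<tau> z2 z1 (n + - s) (- 1 - (J + N * s)))"
    unfolding RB TH infsum_cmult_infsum 2 ..
  also have "\<dots> = (\<Sum>J\<in>{0..2 * int m}. \<Sum>\<^sub>\<infinity>s. \<Sum>\<^sub>\<infinity>j. - corr_term m \<tau> z2 z1 j (- 1 - (J + N * s)))"
    by (rule sum.cong[OF refl], rule infsum_cong) (rule shift)
  also have "\<dots> = (\<Sum>\<^sub>\<infinity>(j, n). - corr_term m \<tau> z2 z1 j (- 1 - n))"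
    by (rule sum_int[OF neg_sum])
  also have "\<dots> = (\<Sum>\<^sub>\<infinity>(j, n). - corr_term m \<tau> z2 z1 j n)"
    by (rule infsum_reindex_bij_witness[of _ "\<lambda>(j, n). (j, - 1 - n)" "\<lambda>(j, n). (j, - 1 - n)"]) auto
  also have "\<dots> = - (\<Sum>\<^sub>\<infinity>(j, n). corr_term m \<tau> z2 z1 j n)"
    by (simp add: case_prod_unfold infsum_uminus)
  finally show "(\<Sum>J\<in>{0..2 * int m}. R_B m J \<tau> ((z1 - z2) / 2) * Theta_minus m (of_int J + 1/2) \<tau> (z1 + z2)) = -
      (\<Sum>\<^sub>\<infinity>(j, n). corr_term m \<tau> z2 z1 j n)"
    unfolding v_def w_def .
qed

theorem Phi_tilde_B_eq_kron_sum:
  assumes \<tau>: "Im \<tau> > 0" and z: "\<not> in_lattice \<tau> z1" "\<not> in_lattice \<tau> z2"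
  shows "Phi_tilde_B m \<tau> z1 z2 t = exp (2 * of_real pi * \<i> * (of_nat m + 1/2) * t) * (\<i> / (2 * of_real pi) *
      (kron_sum m \<tau> z1 z2 - kron_sum m \<tau> z2 z1))"
proof -
  have Phi1: "Phi1_B m \<tau> u v t = exp (2 * of_real pi * \<i> * (of_nat m + 1/2) * t) * Phi1_B m \<tau> u v 0" for u v
    by (simp add: Phi1_B_def)
  show ?thesis
    unfolding Phi_tilde_B_def Phi_B_def Phi_add_B_def Phi1[of z1] Phi1[of z2] distrib_left sum.distrib
        sum_R_B_Theta_minus[OF \<tau>]
      right_diff_distrib kron_sum_expansion[OF \<tau> z(1)] kron_sum_expansion[OF \<tau> z(2)]
    by (simp add: algebra_simps)
qed


section \<open>Transformations of the lattice sum\<close>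

lemma kron_term_alt:
  "kron_term m \<tau> z1 z2 j n = (-1) powi (j + n + j * n) * 
     exp (of_real pi * \<i> * (2 * of_nat m + 1) * of_int j * z2 
       - of_real (pi * (2 * of_nat m + 1) / (2 * Im \<tau>)) * (z1 + of_int j * \<tau> + of_int n) * (cnj (z1 + of_int j *
           \<tau> + of_int n) + z2 - cnj z2)) / (z1 + of_int j * \<tau> + of_int n)"
proof -
  have "2 * \<i> * of_real (Im z2) = z2 - cnj z2" by (simp add: complex_eq_iff)
  then show ?thesis unfolding kron_term_def Let_def by (simp only: add_diff_eq)
qed

text \<open>
  The lattice of \<open>- 1/\<tau>\<close> is that of \<open>\<tau>\<close>, divided by \<open>\<tau>\<close>: the point \<open>z1/\<tau> - j/\<tau> + n\<close> is
  \<open>(z1 + n \<tau> - j)/\<tau>\<close>. The exponents of corresponding terms differ by the constant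
  \<open>pi \<i> (2m + 1) z1 z2/\<tau>\<close>.
\<close>

lemma kron_sum_S:
  assumes \<tau>: "Im \<tau> > 0"
  shows "kron_sum m (- 1 / \<tau>) (z1 / \<tau>) (z2 / \<tau>) = \<tau> * exp (of_real pi * \<i> * (2 * of_nat m + 1) * z1 * z2 / \<tau>) *
      kron_sum m \<tau> z1 z2"
proof -
  have \<tau>0: "\<tau> \<noteq> 0" "cnj \<tau> \<noteq> 0" using \<tau> by auto
  define C :: complex where "C = of_real (pi * (2 * of_nat m + 1) / (2 * Im \<tau>))"
  have C: "of_real pi * \<i> * (2 * of_nat m + 1) = C * (\<tau> - cnj \<tau>)"
    using \<tau> by (simp add: C_def complex_eq_iff)
  have C': "of_real (pi * (2 * of_nat m + 1) / (2 * Im (- 1 / \<tau>))) = C * (\<tau> * cnj \<tau>)"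
  proof -
    have "Im (- 1 / \<tau>) = Im \<tau> / (norm \<tau>)\<^sup>2" by (simp add: Im_divide cmod_power2)
    then have "pi * (2 * of_nat m + 1) / (2 * Im (- 1 / \<tau>)) = pi * (2 * of_nat m + 1) / (2 * Im \<tau>) * (norm \<tau>)\<^sup>2"
      by simp
    then show ?thesis unfolding C_def complex_norm_square[symmetric] by simp
  qed
  have trm: "kron_term m (- 1 / \<tau>) (z1 / \<tau>) (z2 / \<tau>) j n = \<tau> * exp (of_real pi * \<i> * (2 * of_nat m + 1) * z1 *
      z2 / \<tau>) * kron_term m \<tau> z1 z2 n (- j)" for j n
  proof -
    define \<zeta> where "\<zeta> = z1 + of_int n * \<tau> + of_int (- j)"
    have z: "z1 / \<tau> + of_int j * (- 1 / \<tau>) + of_int n = \<zeta> / \<tau>" using \<tau>0 by (simp add: \<zeta>_def field_simps)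
    have sgn: "(-1) powi (j + n + j * n) = ((-1) powi (n + - j + n * -
        j) :: complex)" by (simp add: minus_one_powi) blast
    have j: "of_int j = z1 + of_int n * \<tau> - \<zeta>" by (simp add: \<zeta>_def)
    have ex: "C * (\<tau> - cnj \<tau>) * of_int j * (z2 / \<tau>) - C * (\<tau> * cnj \<tau>) * (\<zeta> / \<tau>) * (cnj (\<zeta> / \<tau>) + z2 / \<tau> -
        cnj (z2 / \<tau>)) = 
       C * (\<tau> - cnj \<tau>) * z1 * z2 / \<tau> + (C * (\<tau> - cnj \<tau>) * of_int n * z2 - C * \<zeta> * (cnj \<zeta> + z2 - cnj z2))"
      unfolding j complex_cnj_divide using \<tau>0 by (simp add: field_simps)
    show ?thesis
      unfolding kron_term_alt[of _ "- 1 / \<tau>"] kron_term_alt[of _ \<tau>] z C C' \<zeta>_def[symmetric] C_def[symmetric] ex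
          exp_add sgn by simp
  qed
  have "kron_sum m (- 1 / \<tau>) (z1 / \<tau>) (z2 / \<tau>) = (\<Sum>\<^sub>\<infinity>(j, n). \<tau> * exp (of_real pi * \<i> * (2 * of_nat m + 1) * z1 *
      z2 / \<tau>) * kron_term m \<tau> z1 z2 j n)"
    unfolding kron_sum_def
    by (rule infsum_reindex_bij_witness[of _ "\<lambda>(j, n). (- n, j)" "\<lambda>(j, n). (n, -
        j)"]) (auto simp: trm[unfolded minus_divide_left[symmetric]])
  then show ?thesis by (simp add: case_prod_unfold infsum_cmult_right' kron_sum_def)
qed

lemma kron_sum_T: "kron_sum m (\<tau> + 1) z1 z2 = kron_sum m \<tau> z1 z2"
proof -
  have trm: "kron_term m (\<tau> + 1) z1 z2 j n = kron_term m \<tau> z1 z2 j (n + j)" for j n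
  proof -
    have z: "z1 + of_int j * (\<tau> + 1) + of_int n = z1 + of_int j * \<tau> + of_int (n + j)" by (simp add: algebra_simps)
    have sgn: "(-1) powi (j + n + j * n) = ((-1) powi (j + (n + j) + j * (n +
        j)) :: complex)" by (simp add: minus_one_powi) blast
    have Im: "Im (\<tau> + 1) = Im \<tau>" by simp
    show ?thesis unfolding kron_term_alt z sgn Im ..
  qed
  show ?thesis unfolding kron_sum_def
    by (rule infsum_reindex_bij_witness[of _ "\<lambda>(j, n). (j, n - j)" "\<lambda>(j, n). (j, n + j)"]) (auto simp: trm)
qed

text \<open>
  A real translation only renumbers the lattice points; the congruence makes the change of the sign
  independent of \<open>j\<close>.
\<close>

lemma kron_sum_shift:
  assumes "even (p - q)"
  shows "kron_sum m \<tau> (z1 + of_int p) (z2 + of_int q) = (-1) powi p * kron_sum m \<tau> z1 z2"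
proof -
  have trm: "kron_term m \<tau> (z1 + of_int p) (z2 + of_int q) j n = (-1) powi p * kron_term m \<tau> z1 z2 j (n + p)" for j n
  proof -
    define C :: complex where "C = of_real (pi * (2 * of_nat m + 1) / (2 * Im \<tau>))"
    define \<zeta> where "\<zeta> = z1 + of_int j * \<tau> + of_int (n + p)"
    have z: "z1 + of_int p + of_int j * \<tau> + of_int n = \<zeta>" by (simp add: \<zeta>_def algebra_simps)
    have ex: "of_real pi * \<i> * (2 * of_nat m + 1) * of_int j * (z2 + of_int q) - C * \<zeta> * (cnj \<zeta> + (z2 +
        of_int q) - cnj (z2 + of_int q)) = 
      of_real pi * \<i> * of_int ((2 * int m + 1) * j * q) + (of_real pi * \<i> * (2 * of_nat m + 1) * of_int j * z2 -
          C * \<zeta> * (cnj \<zeta> + z2 - cnj z2))"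
      by (simp add: algebra_simps)
    have sgn: "(-1) powi (j + n + j * n) * (-1) powi ((2 * int m + 1) * j * q) = (-1) powi p * ((-1) powi (j +
        (n + p) + j * (n + p)) :: complex)" 
      using assms by (simp add: minus_one_powi)
    show ?thesis
      unfolding kron_term_alt z \<zeta>_def[symmetric] C_def[symmetric] ex exp_add exp_pi_i_int mult.assoc[symmetric]
          sgn by simp
  qed
  have "kron_sum m \<tau> (z1 + of_int p) (z2 + of_int q) = (\<Sum>\<^sub>\<infinity>(j, n). (-1) powi p * kron_term m \<tau> z1 z2 j n)"
    unfolding kron_sum_def
    by (rule infsum_reindex_bij_witness[of _ "\<lambda>(j, n). (j, n - p)" "\<lambda>(j, n). (j, n + p)"]) (auto simp: trm)
  then show ?thesis by (simp add: case_prod_unfold infsum_cmult_right' kron_sum_def)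
qed

section \<open>Expansion at level M\<close>

text \<open>
  Along \<open>b = b0 + 2 c\<close> the summand is geometric with ratio \<open>exp (- 2 pi \<i> N h/M)\<close>, an \<open>M\<close>-th root of
  unity which is 1 exactly if \<open>M\<close> divides \<open>h\<close>, as \<open>N\<close> is prime to \<open>M\<close>.
\<close>

lemma sum_roots_of_unity_coset:
  fixes M :: int and N h a0 :: int
  assumes M: "M > 0" and cop: "coprime M N"
  shows "(\<Sum>b\<in>{b\<in>{- M..<M}. even (a0 - b)}. exp (- (of_real pi * \<i> * of_int N / of_int M * of_int h * (of_int b +
      e)))) = 
    (if M dvd h then of_int M * exp (- (of_real pi * \<i> * of_int N / of_int M * of_int h * (of_int a0 + e))) else 0)"
proof -
  define q where "q = of_real pi * \<i> * of_int N / (of_int M :: complex)"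
  define b0 where "b0 = (a0 + M) mod 2 - M"
  define r where "r = exp (- (2 * q * of_int h))"
  have level_nonzero: "(of_int M :: complex) \<noteq> 0" using M by simp
  have qM: "q * of_int M = of_real pi * \<i> * of_int N" using level_nonzero by (simp add: q_def)
  have "(\<Sum>b\<in>{b\<in>{- M..<M}. even (a0 - b)}. exp (- (q * of_int h * (of_int b + e)))) = (\<Sum>c<nat M. exp (- (q *
      of_int h * (of_int (b0 + 2 * int c) + e))))"
  proof (rule sum.reindex_bij_witness[of _ "\<lambda>c. b0 + 2 * int c" "\<lambda>b. nat ((b - b0) div 2)"])
    fix b assume b: "b \<in> {b\<in>{- M..<M}. even (a0 - b)}"
    have "even (b - b0)" using b by (simp add: b0_def) presburger
    moreover have "0 \<le> b - b0" using b unfolding b0_def by simp presburger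
    moreover have "b - b0 < 2 * M" using b by (simp add: b0_def) presburger
    ultimately show "b0 + 2 * int (nat ((b - b0) div 2)) = b" "nat ((b - b0) div 2) \<in> {..<nat M}"
      by (auto elim!: evenE)
    then show "exp (- (q * of_int h * (of_int (b0 + 2 * int (nat ((b - b0) div 2))) + e))) = exp (- (q *
        of_int h * (of_int b + e)))" by simp
  next
    fix c assume c: "c \<in> {..<nat M}"
    then have "b0 + 2 * int c < M" unfolding b0_def by simp
    moreover have "- M \<le> b0 + 2 * int c" by (simp add: b0_def)
    moreover have "even (a0 - (b0 + 2 * int c))" unfolding b0_def by presburger
    ultimately show "b0 + 2 * int c \<in> {b\<in>{- M..<M}. even (a0 - b)}" by simp
  qed auto
  also have "\<dots> = exp (- (q * of_int h * (of_int b0 + e))) * (\<Sum>c<nat M. r ^ c)"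
    unfolding sum_distrib_left r_def exp_of_nat_mult[symmetric] mult_exp_exp
    by (intro sum.cong refl arg_cong[where f = exp]) (simp add: algebra_simps)
  also have "\<dots> = (if M dvd h then of_int M * exp (- (q * of_int h * (of_int a0 + e))) else 0)"
  proof (cases "M dvd h")
    case True
    then obtain s where s: "h = M * s" by auto
    have "r = exp 0" unfolding r_def
      by (rule exp_eq_2pi_intI[where k = "- (N * s)"]) (use level_nonzero in \<open>simp add: q_def s field_simps\<close>)
    moreover have "even (b0 - a0)" unfolding b0_def by presburger
    then obtain d where d: "b0 = a0 + 2 * d" by (metis evenE add_diff_cancel_left' diff_add_cancel add.commute)
    have "exp (- (q * of_int h * (of_int b0 + e))) = exp (- (q * of_int h * (of_int a0 + e)))"
      by (rule exp_eq_2pi_intI[where k = "- (N * s * d)"]) (use level_nonzero in \<open>simp add: q_def s d field_simps\<close>)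
    ultimately show ?thesis using True M by simp
  next
    case False
    have "r \<noteq> 1"
    proof
      assume "r = 1"
      then obtain n :: int where "Im (- (2 * q * of_int h)) = of_int (2 * n) *
          pi" unfolding r_def by (auto simp: exp_eq_1)
      moreover have "Im (2 * q * of_int h) = 2 * pi * (of_int N * of_int h / of_int M)"
        by (simp add: q_def Im_divide power2_eq_square)
      ultimately have "2 * pi * (of_int N * of_int h / of_int M) = 2 * pi * - real_of_int n" by simp
      then have "of_int N * of_int h / of_int M = - real_of_int n" by (simp only: mult_cancel_left) simp
      then have "real_of_int (N * h) = of_int (- n * M)" using M by (simp add: field_simps)
      then have "N * h = - n * M" by linarith
      then have "M dvd N * h" by (metis dvd_triv_right)
      then have "M dvd h" using cop by (metis coprime_dvd_mult_right_iff)
      with False show False by simp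
    qed
    moreover have "r ^ nat M = 1"
    proof -
      have "r ^ nat M = exp 0" unfolding r_def exp_of_nat_mult[symmetric]
        by (rule exp_eq_2pi_intI[where k = "- (N * h)"]) (use M qM in \<open>simp add: algebra_simps\<close>)
      then show ?thesis by simp
    qed
    ultimately show ?thesis using False by (simp add: geometric_sum)
  qed
  finally show ?thesis unfolding q_def .
qed

definition level_const :: "nat \<Rightarrow> nat \<Rightarrow> complex" where "level_const M m = of_real pi * \<i> * (2 * of_nat m + 1) /
    of_nat M"

definition level_kernel :: "nat \<Rightarrow> nat \<Rightarrow> complex \<Rightarrow> complex \<Rightarrow> complex \<Rightarrow> complex" where
  "level_kernel M m \<tau> z2 \<xi> = exp (- (of_real (pi * (2 * of_nat m + 1) / (2 * real M * Im \<tau>)) * \<xi> * (cnj \<xi> + z2 -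
      cnj z2))) / \<xi>"

text \<open>
  One of the two halves of \<^const>\<open>Psi_tilde_B\<close>, up to a factor; the other half has \<open>z1, z2\<close> and \<open>a, b\<close>
  exchanged.
\<close>

definition level_sum :: "nat \<Rightarrow> nat \<Rightarrow> real \<Rightarrow> real \<Rightarrow> real \<Rightarrow> complex \<Rightarrow> complex \<Rightarrow> complex \<Rightarrow> complex" where
  "level_sum M m s a b t z1 z2 = qpow t ((2 * of_nat m + 1) / (2 * of_nat M) * of_real a * of_real b) *
     exp (2 * of_real pi * \<i> * (2 * of_nat m + 1) / (2 * of_nat M) * (of_real b * z1 + of_real a * z2)) *
     kron_sum m (of_nat M * t) (z1 + of_real a * t + of_real s) (z2 + of_real b * t + of_real s)"

text \<open>
  The terms of a half of \<^const>\<open>Psi_tilde_B\<close> at \<open>- 1/\<tau>\<close> (up to a factor) and at \<open>\<tau>\<close>, written with the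
  same kernel. Its argument runs through \<open>z1 + (J + e) \<tau> + M n - j\<close> in the first case and through
  \<open>z1 + (a + M l) \<tau> + n + e'\<close> in the second one, where \<open>b\<close> enters only through a root of unity.
\<close>

definition inverted_term :: "nat \<Rightarrow> nat \<Rightarrow> real \<Rightarrow> real \<Rightarrow> complex \<Rightarrow> int \<Rightarrow> int \<Rightarrow> complex \<Rightarrow> complex \<Rightarrow> int \<Rightarrow> int \<Rightarrow>
    complex" where
  "inverted_term M m e e' \<tau> j0 k0 z1 z2 J n = (-1) powi (J + n + J * n) *
     exp (- (of_real pi * \<i> * (2 * of_nat m + 1) * of_real e * of_int n) + level_const M m *
         (of_real (of_int J + e)) * (z2 - of_real (of_int k0 + e'))) *
     level_kernel M m \<tau> z2 (z1 + of_real (of_int J + e) * \<tau> + (of_nat M * of_int n - of_real (of_int j0 + e')))"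

definition slashed_term :: "nat \<Rightarrow> nat \<Rightarrow> real \<Rightarrow> real \<Rightarrow> complex \<Rightarrow> complex \<Rightarrow> complex \<Rightarrow> int \<Rightarrow> int \<Rightarrow> int \<Rightarrow> int \<Rightarrow>
    complex" where
  "slashed_term M m e e' \<tau> z1 z2 a0 b0 l n = (-1) powi (l + n + l * n) *
     exp (of_real pi * \<i> * (2 * of_nat m + 1) * of_int l * of_real e' + level_const M m * (of_real (of_int (a0 +
         int M * l) + e) * z2 - of_real (of_int b0 + e) * of_real (of_int n + e'))) *
     level_kernel M m \<tau> z2 (z1 + of_real (of_int (a0 + int M * l) + e) * \<tau> + of_real (of_int n + e'))"

definition weighted_sum :: "nat \<Rightarrow> nat \<Rightarrow> real \<Rightarrow> real \<Rightarrow> complex \<Rightarrow> int \<Rightarrow> int \<Rightarrow> complex \<Rightarrow> complex \<Rightarrow> int \<Rightarrow> int \<Rightarrow>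
    complex" where
  "weighted_sum M m e e' \<tau> j0 k0 z1 z2 a0 b0 = (-1) powi a0 * 
     exp (- (level_const M m * of_real ((of_int b0 + e) * (of_int j0 + e') + (of_int a0 + e) * (of_int k0 +
         e')))) * level_sum M m e' (of_int a0 + e) (of_int b0 + e) \<tau> z1 z2"

text \<open>
  The pairs in \<^const>\<open>Omega_B\<close>, with the common fractional part removed.
\<close>

definition index_set :: "nat \<Rightarrow> (int \<times> int) set" where
  "index_set M = {(a, b). a \<in> {- int M..<int M} \<and> b \<in> {0..<int M} \<and> even (a - b)}"

context
  fixes M m :: nat and e e' :: real and e2 :: int and \<tau> :: complex
  assumes M: "M > 0" and cop: "coprime (int M) (2 * (2 * int m + 1))"
    and e: "2 * e \<in> \<int>" and e2: "of_int e2 = 2 * e'"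
    and \<tau>: "Im \<tau> > 0"
begin

lemma level_nonzero: "(of_nat M :: complex) \<noteq> 0" using M by simp

lemma level_const_M: "level_const M m * of_nat M = of_real pi * \<i> * (2 * of_nat m + 1)"
  using level_nonzero by (simp add: level_const_def)

lemma odd_M: "odd M"
proof
  assume "even M"
  then have "2 dvd int M" by simp
  moreover have "2 dvd 2 * (2 * int m + 1)" by simp
  ultimately have "is_unit (2 :: int)" using cop coprime_common_divisor by blast
  then show False by simp
qed

lemma coprime_level: "coprime (int M) (2 * int m + 1)"
  using cop unfolding coprime_mult_right_iff by simp

text \<open>
  With \<open>C (\<tau> - cnj \<tau>) = pi \<i> (2m + 1)/M\<close>, translating \<open>z2\<close> by \<open>b \<tau>\<close> changes the exponent of the kernel
  by a multiple of \<open>b \<xi>\<close>, which cancels the dependence of the prefactor on \<open>b\<close> apart from the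
  character \<open>exp (- pi \<i> (2m + 1) b (n + e')/M)\<close>.
\<close>

lemma slashed_term_eq:
  "qpow \<tau> ((2 * of_nat m + 1) / (2 * of_nat M) * of_real (of_int a0 + e) * of_real (of_int b0 + e)) *
     exp (2 * of_real pi * \<i> * (2 * of_nat m + 1) / (2 * of_nat M) * (of_real (of_int b0 + e) * z1 +
         of_real (of_int a0 + e) * z2)) *
     kron_term m (of_nat M * \<tau>) (z1 + of_real (of_int a0 + e) * \<tau> + of_real e') (z2 + of_real (of_int b0 + e) *
         \<tau> + of_real e') l n =
   slashed_term M m e e' \<tau> z1 z2 a0 b0 l n"
proof -
  define a :: complex where "a = of_real (of_int a0 + e)"
  define b :: complex where "b = of_real (of_int b0 + e)"
  define \<xi> where "\<xi> = z1 + of_real (of_int (a0 + int M * l) + e) * \<tau> + of_real (of_int n + e')"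
  define C :: complex where "C = of_real (pi * (2 * of_nat m + 1) / (2 * real M * Im \<tau>))"
  have xi: "z1 + a * \<tau> + of_real e' + of_int l * (of_nat M * \<tau>) + of_int n = \<xi>"
    unfolding \<xi>_def a_def by (simp add: algebra_simps)
  have CM: "of_real (pi * (2 * of_nat m + 1) / (2 * Im (of_nat M * \<tau>))) = C"
    by (simp add: C_def)
  have Cy: "C * (\<tau> - cnj \<tau>) = level_const M m"
    using \<tau> M by (simp add: C_def level_const_def complex_eq_iff Re_divide Im_divide power2_eq_square)
  have cnjs: "cnj b = b" "cnj (of_real e' :: complex) = of_real e'" by (simp_all add: b_def)
  have z2: "cnj \<xi> + (z2 + b * \<tau> + of_real e') - cnj (z2 + b * \<tau> + of_real e') = (cnj \<xi> + z2 - cnj z2) + b * (\<tau> -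
      cnj \<tau>)"
    unfolding complex_cnj_add complex_cnj_mult cnjs by (simp add: algebra_simps)
  have q: "qpow \<tau> ((2 * of_nat m + 1) / (2 * of_nat M) * a * b) * exp (2 * of_real pi * \<i> * (2 * of_nat m + 1) /
      (2 * of_nat M) * (b * z1 + a * z2)) = 
     exp (level_const M m * (a * b * \<tau> + b * z1 + a * z2))"
    unfolding qpow_def mult_exp_exp level_const_def using level_nonzero by (intro arg_cong[where f =
        exp]) (simp add: field_simps)
  have A: "of_real (of_int (a0 + int M * l) + e) = a + of_nat M * of_int l" by (simp add: a_def)
  have B: "of_real (of_int n + e') = \<xi> - z1 - (a + of_nat M * of_int l) * \<tau>" by (simp add: \<xi>_def a_def algebra_simps)
  have ex: "exp (level_const M m * (a * b * \<tau> + b * z1 + a * z2)) * exp (of_real pi * \<i> * (2 * of_nat m + 1) *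
      of_int l * (z2 + b * \<tau> + of_real e') - C * \<xi> * (cnj \<xi> + (z2 + b * \<tau> + of_real e') - cnj (z2 + b * \<tau> +
      of_real e'))) = 
     exp (of_real pi * \<i> * (2 * of_nat m + 1) * of_int l * of_real e' + level_const M m * ((a + of_nat M *
         of_int l) * z2 - b * of_real (of_int n + e'))) * exp (- (C * \<xi> * (cnj \<xi> + z2 - cnj z2)))"
    unfolding mult_exp_exp z2 B level_const_M[symmetric] Cy[symmetric]
    by (rule arg_cong[where f = exp]) (simp add: algebra_simps)
  have alg: "E * (s * F / X) = s * P * (Q / X)" if "E * F = P * Q" for E F P Q s X :: complex
  proof -
    have "E * (s * F / X) = s * (E * F) / X" by simp
    then show ?thesis unfolding that by simp
  qed
  show ?thesis
    unfolding kron_term_alt slashed_term_def level_kernel_def a_def[symmetric] b_def[symmetric] q xi CM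
        \<xi>_def[symmetric] C_def[symmetric] A[symmetric]
    unfolding A by (rule alg[OF ex])
qed

text \<open>
  The kernel at \<open>\<tau>/M\<close> and arguments divided by \<open>M\<close> agrees with the kernel at \<open>M \<tau>\<close>, since both have
  the same exponent \<open>pi (2m + 1) \<bar>\<xi>\<bar>\<^sup>2/(2 M Im \<tau>)\<close>.
\<close>

lemma inverted_term_eq:
  fixes j0 k0 :: int
  defines "j \<equiv> of_real (of_int j0 + e') :: complex" and "k \<equiv> of_real (of_int k0 + e') :: complex"
  shows "exp (level_const M m * (of_real e * (z1 + z2 - j - k) + (of_real e)\<^sup>2 * \<tau>)) *
     kron_term m (\<tau> / of_nat M) ((z1 - j + of_real e * \<tau>) / of_nat M) ((z2 - k + of_real e * \<tau>) /
         of_nat M) J n = of_nat M * inverted_term M m e e' \<tau> j0 k0 z1 z2 J n"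
proof -
  define \<xi> where "\<xi> = z1 + of_real (of_int J + e) * \<tau> + (of_nat M * of_int n - j)"
  define C :: complex where "C = of_real (pi * (2 * of_nat m + 1) / (2 * real M * Im \<tau>))"
  have xi: "(z1 - j + of_real e * \<tau>) / of_nat M + of_int J * (\<tau> / of_nat M) + of_int n = \<xi> / of_nat M"
    using level_nonzero by (simp add: \<xi>_def field_simps)
  have CM: "of_real (pi * (2 * of_nat m + 1) / (2 * Im (\<tau> / of_nat M))) = C * of_nat M * of_nat M"
  proof -
    have "Im (\<tau> / of_nat M) = Im \<tau> / real M" by (simp add: Im_divide_of_nat)
    then have "pi * (2 * of_nat m + 1) / (2 * Im (\<tau> / of_nat M)) = pi * (2 * of_nat m + 1) / (2 * real M *
        Im \<tau>) * real M * real M"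
      using M \<tau> by (simp add: field_simps)
    then show ?thesis unfolding C_def by simp
  qed
  have Cy: "C * (\<tau> - cnj \<tau>) = level_const M m"
    using \<tau> M by (simp add: C_def level_const_def complex_eq_iff Re_divide Im_divide power2_eq_square)
  have cnjs: "cnj k = k" by (simp add: k_def)
  have A: "of_real (of_int J + e) = of_int J + of_real e" by simp
  have jj: "j = z1 + (of_int J + of_real e) * \<tau> + of_nat M * of_int n - \<xi>" by (simp add: \<xi>_def)
  have ex: "exp (level_const M m * (of_real e * (z1 + z2 - j - k) + (of_real e)\<^sup>2 * \<tau>)) * exp (of_real pi * \<i> *
      (2 * of_nat m + 1) * of_int J * ((z2 - k + of_real e * \<tau>) / of_nat M) - 
      C * of_nat M * of_nat M * (\<xi> / of_nat M) * (cnj (\<xi> / of_nat M) + (z2 - k + of_real e * \<tau>) / of_nat M -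
          cnj ((z2 - k + of_real e * \<tau>) / of_nat M))) = 
     exp (- (of_real pi * \<i> * (2 * of_nat m + 1) * of_real e * of_int n) + level_const M m * (of_int J +
         of_real e) * (z2 - k)) * exp (- (C * \<xi> * (cnj \<xi> + z2 - cnj z2)))"
    unfolding mult_exp_exp complex_cnj_divide complex_cnj_add complex_cnj_diff complex_cnj_mult cnjs
        level_const_M[symmetric] Cy[symmetric] jj
    using level_nonzero by (intro arg_cong[where f = exp]) (simp add: field_simps power2_eq_square)
  have alg: "E * (s * F / (X / L)) = L * (s * P * (Q / X))" if "E * F = P * Q" for E F P Q s X L :: complex
  proof -
    have "E * (s * F / (X / L)) = L * s * (E * F) / X" by simp
    then show ?thesis unfolding that by simp
  qed
  show ?thesis
    unfolding kron_term_alt inverted_term_def level_kernel_def j_def[symmetric] k_def[symmetric] xi CM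
        \<xi>_def[symmetric] C_def[symmetric]
    unfolding A by (rule alg[OF ex])
qed


lemma level_sum_eq_slashed: 
  "level_sum M m e' (of_int a0 + e) (of_int b0 + e) \<tau> z1 z2 = (\<Sum>\<^sub>\<infinity>(l, n). slashed_term M m e e' \<tau> z1 z2 a0 b0 l n)"
  unfolding level_sum_def kron_sum_def infsum_cmult_right'[symmetric]
  by (rule infsum_cong) (simp add: case_prod_unfold flip: slashed_term_eq)

lemma slashed_term_summable:
  assumes nz: "\<And>p r::int. z1 \<noteq> of_real (of_int p + e) * \<tau> + of_real (of_int r + e')"
  shows "(\<lambda>(l, n). slashed_term M m e e' \<tau> z1 z2 a0 b0 l n) summable_on UNIV"
proof -
  obtain ee :: int where ee: "2 * e = of_int ee" using e by (elim Ints_cases)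
  have "\<not> in_lattice (of_nat M * \<tau>) (z1 + of_real (of_int a0 + e) * \<tau> + of_real e')"
  proof
    assume "in_lattice (of_nat M * \<tau>) (z1 + of_real (of_int a0 + e) * \<tau> + of_real e')"
    then obtain p r :: int where pr: "z1 + of_real (of_int a0 + e) * \<tau> + of_real e' = of_int p * (of_nat M *
        \<tau>) + of_int r"
      unfolding in_lattice_def by blast
    have "of_real (of_int (int M * p - a0 - ee) + e) = (of_nat M * of_int p - of_real (of_int a0 + e) :: complex)"
      "of_real (of_int (r - e2) + e') = (of_int r - of_real e' :: complex)"
      using arg_cong[OF ee, of complex_of_real] arg_cong[OF e2, of complex_of_real] by (simp_all add: algebra_simps)
    then have "z1 = of_real (of_int (int M * p - a0 - ee) + e) * \<tau> + of_real (of_int (r - e2) + e')"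
      using pr by (simp only:) (simp add: algebra_simps)
    with nz show False by blast
  qed
  from kron_term_summable[OF _ this] \<tau> M
  have "(\<lambda>(l, n). kron_term m (of_nat M * \<tau>) (z1 + of_real (of_int a0 + e) * \<tau> + of_real e') (z2 +
      of_real (of_int b0 + e) * \<tau> + of_real e') l n) summable_on UNIV"
    by simp
  from summable_on_cmult_right[OF this] show ?thesis
    unfolding slashed_term_eq[symmetric] by (simp add: case_prod_unfold)
qed

lemma level_sum_S:
  fixes j0 k0 :: int
  defines "j \<equiv> of_real (of_int j0 + e') :: complex" and "k \<equiv> of_real (of_int k0 + e') :: complex"
  assumes nz: "\<And>p r::int. z1 \<noteq> of_real (of_int p + e) * \<tau> + of_real (of_int r + e')"
  shows "level_sum M m e (of_int j0 + e') (of_int k0 + e') (- 1 / \<tau>) (z1 / \<tau>) (z2 / \<tau>) = exp (level_const M m *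
      z1 * z2 / \<tau>) * \<tau> * (\<Sum>\<^sub>\<infinity>(J, n). inverted_term M m e e' \<tau> j0 k0 z1 z2 J n)"
    and "(\<lambda>(J, n). inverted_term M m e e' \<tau> j0 k0 z1 z2 J n) summable_on UNIV"
proof -
  have \<tau>0: "\<tau> \<noteq> 0" using \<tau> by auto
  define t where "t = \<tau> / of_nat M"
  have t: "Im t > 0" using \<tau> M by (simp add: t_def Im_divide_of_nat)
  have t0: "t \<noteq> 0" using \<tau>0 level_nonzero by (simp add: t_def)
  define w1 w2 where "w1 = (z1 - j + of_real e * \<tau>) / of_nat M" and "w2 = (z2 - k + of_real e * \<tau>) / of_nat M"
  define P where "P = exp (level_const M m * (of_real e * (z1 + z2 - j - k) + (of_real e)\<^sup>2 * \<tau>))"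
  have Pu: "P * kron_term m t w1 w2 J n = of_nat M * inverted_term M m e e' \<tau> j0 k0 z1 z2 J n" for J n
    unfolding P_def t_def w1_def w2_def j_def k_def by (rule inverted_term_eq)
  have args: "of_nat M * (- 1 / \<tau>) = - 1 / t" "z1 / \<tau> + j * (- 1 / \<tau>) + of_real e = w1 / t" "z2 / \<tau> + k * (- 1 /
      \<tau>) + of_real e = w2 / t"
    using \<tau>0 level_nonzero by (simp_all add: t_def w1_def w2_def field_simps)
  have ex: "qpow (- 1 / \<tau>) ((2 * of_nat m + 1) / (2 * of_nat M) * j * k) * exp (2 * of_real pi * \<i> * (2 *
      of_nat m + 1) / (2 * of_nat M) * (k * (z1 / \<tau>) + j * (z2 / \<tau>))) * exp (of_real pi * \<i> * (2 * of_nat m +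
      1) * w1 * w2 / t) = 
     exp (level_const M m * z1 * z2 / \<tau>) * P"
    unfolding qpow_def mult_exp_exp P_def w1_def w2_def t_def level_const_def using level_nonzero \<tau>0
    by (intro arg_cong[where f = exp]) (simp add: field_simps power2_eq_square)
  have "level_sum M m e (of_int j0 + e') (of_int k0 + e') (- 1 / \<tau>) (z1 / \<tau>) (z2 / \<tau>) = 
     qpow (- 1 / \<tau>) ((2 * of_nat m + 1) / (2 * of_nat M) * j * k) * exp (2 * of_real pi * \<i> * (2 * of_nat m +
         1) / (2 * of_nat M) * (k * (z1 / \<tau>) + j * (z2 / \<tau>))) * 
     (t * exp (of_real pi * \<i> * (2 * of_nat m + 1) * w1 * w2 / t) * kron_sum m t w1 w2)"
    unfolding level_sum_def j_def[symmetric] k_def[symmetric] args kron_sum_S[OF t] ..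
  also have "\<dots> = (qpow (- 1 / \<tau>) ((2 * of_nat m + 1) / (2 * of_nat M) * j * k) * exp (2 * of_real pi * \<i> * (2 *
      of_nat m + 1) / (2 * of_nat M) * (k * (z1 / \<tau>) + j * (z2 / \<tau>))) * 
     exp (of_real pi * \<i> * (2 * of_nat m + 1) * w1 * w2 / t)) * (t * kron_sum m t w1 w2)"
    by (simp only: mult_ac)
  also have "\<dots> = exp (level_const M m * z1 * z2 / \<tau>) * t * (P * kron_sum m t w1 w2)"
    unfolding ex by (simp only: mult_ac)
  also have "P * kron_sum m t w1 w2 = of_nat M * (\<Sum>\<^sub>\<infinity>(J, n). inverted_term M m e e' \<tau> j0 k0 z1 z2 J n)"
    unfolding kron_sum_def infsum_cmult_right'[symmetric]
    by (rule infsum_cong) (simp add: case_prod_unfold Pu)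
  finally show "level_sum M m e (of_int j0 + e') (of_int k0 + e') (- 1 / \<tau>) (z1 / \<tau>) (z2 / \<tau>) =
      exp (level_const M m * z1 * z2 / \<tau>) * \<tau> * (\<Sum>\<^sub>\<infinity>(J, n). inverted_term M m e e' \<tau> j0 k0 z1 z2 J n)"
    using level_nonzero by (simp add: t_def)
  obtain ee :: int where ee: "2 * e = of_int ee" using e by (elim Ints_cases)
  have "\<not> in_lattice t w1"
  proof
    assume "in_lattice t w1"
    then obtain p r :: int where "w1 = of_int p * t + of_int r" unfolding in_lattice_def by blast
    then have "z1 = (of_int p - of_real e) * \<tau> + (of_nat M * of_int r + j)"
      using level_nonzero by (simp add: w1_def t_def field_simps)
    also have "of_int p - of_real e = (of_real (of_int (p - ee) + e) :: complex)"
      using arg_cong[OF ee, of complex_of_real] by (simp add: algebra_simps)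
    also have "of_nat M * of_int r + j = of_real (of_int (int M * r + j0) + e')" by (simp add: j_def)
    finally show False using nz by blast
  qed
  from kron_term_summable[OF t this, of m w2]
  have "(\<lambda>x. inverse (of_nat M) * (P * (case x of (J, n) \<Rightarrow> kron_term m t w1 w2 J n))) summable_on UNIV"
    by (intro summable_on_cmult_right)
  then show "(\<lambda>(J, n). inverted_term M m e e' \<tau> j0 k0 z1 z2 J n) summable_on UNIV"
    using level_nonzero by (simp add: case_prod_unfold Pu mult.assoc[symmetric])
qed

text \<open>
  Only \<open>exp (- pi \<i> (2m + 1) b (j + n + e')/M)\<close> depends on \<open>b\<close>, so the sum over \<open>b\<close> selects the indices
  with \<open>j + n + e'\<close> divisible by \<open>M\<close>; these are the terms of the inverted series.
\<close>

lemma sum_weighted_sum_coset: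
  assumes nz: "\<And>p r::int. z1 \<noteq> of_real (of_int p + e) * \<tau> + of_real (of_int r + e')"
    and jk: "even (j0 - k0)"
  shows "(\<Sum>b0\<in>{b\<in>{- int M..<int M}. even (a0 - b)}. weighted_sum M m e e' \<tau> j0 k0 z1 z2 a0 b0) = 
     (-1) powi (j0 + e2) * of_nat M * (\<Sum>\<^sub>\<infinity>(l, n). inverted_term M m e e' \<tau> j0 k0 z1 z2 (a0 + int M * l) n)"
proof -
  define B where "B = {b\<in>{- int M..<int M}. even (a0 - b)}"
  have finB: "finite B" unfolding B_def by (rule finite_subset[of _ "{- int M..<int M}"]) auto
  define W where "W b0 l n = (-1) powi a0 * exp (- (level_const M m * of_real ((of_int b0 + e) * (of_int j0 +
      e') + (of_int a0 + e) * (of_int k0 + e')))) * slashed_term M m e e' \<tau> z1 z2 a0 b0 l n" for b0 l n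
  define V where "V l n = (-1) powi (a0 + l + n + l * n) * 
     exp (- (level_const M m * (of_int a0 + of_real e) * (of_int k0 + of_real e')) + of_real pi * \<i> * (2 *
         of_nat m + 1) * of_int l * of_real e' + level_const M m * of_real (of_int (a0 + int M * l) + e) * z2) *
     level_kernel M m \<tau> z2 (z1 + of_real (of_int (a0 + int M * l) + e) * \<tau> + of_real (of_int n + e'))" for l n
  have e2c: "2 * of_real e' = (of_int e2 :: complex)" using arg_cong[OF e2, of complex_of_real] by simp
  have WV: "W b0 l n = exp (- (level_const M m * of_int (j0 + n + e2) * (of_int b0 + of_real e))) * V l n" for b0 l n
  proof -
    have sg: "(-1) powi a0 * (-1) powi (l + n + l * n) = ((-1) powi (a0 + l + n + l *
        n) :: complex)" by (auto simp: minus_one_powi)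
    have ex: "exp (- (level_const M m * of_real ((of_int b0 + e) * (of_int j0 + e') + (of_int a0 + e) *
        (of_int k0 + e')))) * 
       exp (of_real pi * \<i> * (2 * of_nat m + 1) * of_int l * of_real e' + level_const M m *
           (of_real (of_int (a0 + int M * l) + e) * z2 - of_real (of_int b0 + e) * of_real (of_int n + e'))) = 
       exp (- (level_const M m * of_int (j0 + n + e2) * (of_int b0 + of_real e))) * exp (- (level_const M m *
           (of_int a0 + of_real e) * (of_int k0 + of_real e')) + of_real pi * \<i> * (2 * of_nat m + 1) *
           of_int l * of_real e' + level_const M m * of_real (of_int (a0 + int M * l) + e) * z2)"
      unfolding mult_exp_exp by (rule arg_cong[where f = exp]) (simp add: algebra_simps flip: e2c)
    have alg: "s1 * E * (s2 * F * G) = P * (s3 * Q * G)" if "E * F = P * Q" "s1 * s2 =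
        s3" for E F P Q s1 s2 s3 G :: complex
    proof -
      have "s1 * E * (s2 * F * G) = (s1 * s2) * (E * F) * G" by (simp only: mult_ac)
      then show ?thesis unfolding that by (simp only: mult_ac)
    qed
    show ?thesis unfolding W_def V_def slashed_term_def by (rule alg[OF ex sg])
  qed
  have W_sum: "(\<lambda>(l, n). W b0 l n) summable_on UNIV" for b0
    using summable_on_cmult_right[OF slashed_term_summable[OF nz]] by (simp add: W_def case_prod_unfold)
  have weighted_sum: "weighted_sum M m e e' \<tau> j0 k0 z1 z2 a0 b0 = (\<Sum>\<^sub>\<infinity>(l, n). W b0 l n)" for b0
    unfolding weighted_sum_def level_sum_eq_slashed W_def infsum_cmult_right'[symmetric] by (simp add:
        case_prod_unfold)
  have lc_eq: "level_const M m = of_real pi * \<i> * of_int (2 * int m + 1) /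
      of_int (int M)" by (simp add: level_const_def)
  have coset: "(\<Sum>b0\<in>B. exp (- (level_const M m * of_int h * (of_int b0 + of_real e)))) =
      (if int M dvd h then of_nat M * exp (- (level_const M m * of_int h * (of_int a0 + of_real e))) else 0)" for h
    unfolding B_def lc_eq by (subst sum_roots_of_unity_coset) (use M coprime_level in auto)
  have "(\<Sum>b0\<in>B. weighted_sum M m e e' \<tau> j0 k0 z1 z2 a0 b0) = (\<Sum>\<^sub>\<infinity>x. \<Sum>b0\<in>B. case x of (l, n) \<Rightarrow> W b0 l n)"
    unfolding weighted_sum by (rule infsumI[symmetric], rule has_sum_sum[OF finB], rule has_sum_infsum, rule W_sum)
  also have "\<dots> = (\<Sum>\<^sub>\<infinity>(l, n). (if int M dvd j0 + n + e2 then of_nat M * exp (- (level_const M m * of_int (j0 +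
      n + e2) * (of_int a0 + of_real e))) else 0) * V l n)"
    unfolding coset[symmetric] sum_distrib_right by (intro infsum_cong) (simp add: case_prod_unfold WV)
  also have "\<dots> = (\<Sum>\<^sub>\<infinity>(l, n)\<in>{(l, n). int M dvd j0 + n + e2}. of_nat M * exp (- (level_const M m * of_int (j0 +
      n + e2) * (of_int a0 + of_real e))) * V l n)"
    by (rule infsum_cong_neutral) auto
  also have "\<dots> = (\<Sum>\<^sub>\<infinity>(l, n). (-1) powi (j0 + e2) * of_nat M * inverted_term M m e e' \<tau> j0 k0 z1 z2 (a0 + int M *
      l) n)"
  proof (rule infsum_reindex_bij_witness[of _ "\<lambda>(l, n). (l, int M * n - j0 - e2)" "\<lambda>(l, n). (l, (j0 + n +
      e2) div int M)"])
    fix x :: "int \<times> int" assume x: "x \<in> {(l, n). int M dvd j0 + n + e2}"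
    obtain l n' where ln': "x = (l, n')" by (cases x)
    with x obtain n where n: "j0 + n' + e2 = int M * n" by auto
    have n': "n' = int M * n - j0 - e2" using n by simp
    have div: "(j0 + n' + e2) div int M = n" using n M by simp
    show "(case case x of (l, n) \<Rightarrow> (l, (j0 + n + e2) div int M) of (l, n) \<Rightarrow> (l, int M * n - j0 - e2)) = x"
      by (simp add: ln' div n')
    have xi: "of_real (of_int n' + e') = (of_nat M * of_int n - of_real (of_int j0 + e') :: complex)"
      using e2c by (simp add: n' algebra_simps flip: e2c)
    \<comment> \<open>the integer by which the phases of the two terms differ, in units of \<open>pi \<i> (2m + 1)\<close>\<close>
    define r where "r = a0 * n - l * (k0 + e2)"
    have sg: "(-1) powi (j0 + e2) * (-1) powi (a0 + int M * l + n + (a0 + int M * l) * n) = ((-1) powi (- ((2 *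
        int m + 1) * r)) * (-1) powi (a0 + l + n' + l * n') :: complex)"
      using odd_M jk by (simp add: minus_one_powi n' r_def) blast
    have e2d: "of_int e2 = (2 * of_real e' :: complex)" using e2c by simp
    have ex: "exp (- (level_const M m * of_int (int M * n) * (of_int a0 + of_real e))) *
        exp (- (level_const M m * (of_int a0 + of_real e) * (of_int k0 + of_real e')) + of_real pi * \<i> * (2 *
        of_nat m + 1) * of_int l * of_real e' + level_const M m * of_real (of_int (a0 + int M * l) + e) * z2) = 
       (-1) powi (- ((2 * int m + 1) * r)) * exp (- (of_real pi * \<i> * (2 * of_nat m + 1) * of_real e *
           of_int n) + level_const M m * (of_real (of_int (a0 + int M * l) + e)) * (z2 - of_real (of_int k0 + e')))"
      unfolding mult_exp_exp exp_pi_i_int[symmetric]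
    proof (rule arg_cong[where f = exp], goal_cases)
      case 1
      have N: "of_real pi * \<i> * of_int (- ((2 * int m + 1) * r)) = - (level_const M m * of_nat M) * (of_int a0 *
          of_int n - of_int l * (of_int k0 + 2 * of_real e'))"
        unfolding level_const_M by (simp add: r_def e2d)
      show ?case unfolding N level_const_M[symmetric] by (simp add: algebra_simps)
    qed
    have alg: "s1 * L * (s2 * P * G) = L * E * (s4 * F * G)" if ex: "E * F = s3 * P" and sg: "s1 * s2 = s3 *
        s4" for E F P s1 s2 s3 s4 L G :: complex
    proof -
      have "s1 * L * (s2 * P * G) = (s1 * s2) * (L * P * G)" by (simp only: mult_ac)
      also have "\<dots> = L * (s3 * P) * (s4 * G)" unfolding sg by (simp only: mult_ac)
      finally show ?thesis unfolding ex[symmetric] by (simp only: mult_ac)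
    qed
    show "(case case x of (l, n) \<Rightarrow> (l, (j0 + n + e2) div int M) of (l, n) \<Rightarrow> (-1) powi (j0 + e2) * of_nat M *
        inverted_term M m e e' \<tau> j0 k0 z1 z2 (a0 + int M * l) n) = 
      (case x of (l, n) \<Rightarrow> of_nat M * exp (- (level_const M m * of_int (j0 + n + e2) * (of_int a0 +
          of_real e))) * V l n)"
      unfolding ln' prod.case div unfolding n unfolding inverted_term_def V_def xi by (rule alg[OF ex sg])
  qed (use M in auto)
  finally show ?thesis
    unfolding B_def by (simp add: case_prod_unfold infsum_cmult_right')
qed

lemma level_sum_S_sum:
  assumes nz: "\<And>p r::int. z1 \<noteq> of_real (of_int p + e) * \<tau> + of_real (of_int r + e')"
    and jk: "even (j0 - k0)"
  shows "level_sum M m e (of_int j0 + e') (of_int k0 + e') (- 1 / \<tau>) (z1 / \<tau>) (z2 / \<tau>) = 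
    exp (level_const M m * z1 * z2 / \<tau>) * \<tau> / of_nat M * (-1) powi (j0 + e2) *
        (\<Sum>a0\<in>{0..<int M}. \<Sum>b0\<in>{b\<in>{- int M..<int M}. even (a0 - b)}. weighted_sum M m e e' \<tau> j0 k0 z1 z2 a0 b0)"
proof -
  have "(\<Sum>\<^sub>\<infinity>(J, n). inverted_term M m e e' \<tau> j0 k0 z1 z2 J n) =
      (\<Sum>a0\<in>{0..<int M}. \<Sum>\<^sub>\<infinity>(l, n). inverted_term M m e e' \<tau> j0 k0 z1 z2 (a0 + int M * l) n)"
    by (rule infsum_int_pair_residues[OF _ level_sum_S(2)[OF nz]]) (use M in auto)
  moreover have "(-1) powi (j0 + e2) * ((-1) powi (j0 + e2) * c) = (c :: complex)" for c
    by (simp add: minus_one_powi)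
  ultimately show ?thesis
    unfolding level_sum_S(1)[OF nz] sum_weighted_sum_coset[OF nz jk] sum_distrib_left[symmetric] using
        level_nonzero by (simp add: mult_ac)
qed

text \<open>
  Replacing \<open>l\<close> by \<open>l + 1\<close> restores \<open>a + M l\<close>; the signs cancel because \<open>M\<close> is odd and
  \<open>j0 - k0\<close> is even.
\<close>

lemma weighted_sum_shift:
  assumes jk: "even (j0 - k0)"
  shows "weighted_sum M m e e' \<tau> j0 k0 z1 z2 (a0 + int M) (b0 - int M) = weighted_sum M m e e' \<tau> j0 k0 z1 z2 a0 b0"
proof -
  have trm: "(-1) powi (a0 + int M) * 
     exp (- (level_const M m * of_real ((of_int (b0 - int M) + e) * (of_int j0 + e') + (of_int (a0 + int M) +
         e) * (of_int k0 + e')))) * slashed_term M m e e' \<tau> z1 z2 (a0 + int M) (b0 - int M) l n = 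
     (-1) powi a0 * exp (- (level_const M m * of_real ((of_int b0 + e) * (of_int j0 + e') + (of_int a0 + e) *
         (of_int k0 + e')))) * slashed_term M m e e' \<tau> z1 z2 a0 b0 (l + 1) n" for l n
  proof -
    define r where "r = j0 - k0 + n"
    define g where "g = level_kernel M m \<tau> z2 (z1 + of_real (of_int (a0 + int M * (l + 1)) + e) * \<tau> +
        of_real (of_int n + e'))"
    have A: "a0 + int M + int M * l = a0 + int M * (l + 1)" by (simp add: algebra_simps)
    have ex: "exp (- (level_const M m * of_real ((of_int (b0 - int M) + e) * (of_int j0 + e') + (of_int (a0 +
        int M) + e) * (of_int k0 + e')))) * 
      exp (of_real pi * \<i> * (2 * of_nat m + 1) * of_int l * of_real e' + level_const M m *
          (of_real (of_int (a0 + int M * (l + 1)) + e) * z2 - of_real (of_int (b0 - int M) + e) *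
          of_real (of_int n + e'))) = 
      (-1) powi ((2 * int m + 1) * r) * (exp (- (level_const M m * of_real ((of_int b0 + e) * (of_int j0 + e') +
          (of_int a0 + e) * (of_int k0 + e')))) *
      exp (of_real pi * \<i> * (2 * of_nat m + 1) * of_int (l + 1) * of_real e' + level_const M m *
          (of_real (of_int (a0 + int M * (l + 1)) + e) * z2 - of_real (of_int b0 + e) * of_real (of_int n + e'))))"
      unfolding mult_exp_exp exp_pi_i_int[symmetric]
    proof (rule arg_cong[where f = exp], goal_cases)
      case 1
      have N: "of_real pi * \<i> * of_int ((2 * int m + 1) * r) = level_const M m * of_nat M * (of_int j0 -
          of_int k0 + of_int n)"
        unfolding level_const_M by (simp add: r_def)
      show ?case unfolding N level_const_M[symmetric] by (simp add: algebra_simps)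
    qed
    have sg: "(-1) powi (a0 + int M) * (-1) powi (l + n + l * n) * (-1) powi ((2 * int m + 1) * r) =
        ((-1) powi a0 * (-1) powi (l + 1 + n + (l + 1) * n) :: complex)"
      using odd_M jk by (auto simp: minus_one_powi r_def)
    have alg: "s1 * E * (s2 * F * G) = s4 * P * (s5 * Q * G)" if ex: "E * F = s3 * (P * Q)" and sg: "s1 * s2 *
        s3 = s4 * s5" for E F P Q s1 s2 s3 s4 s5 G :: complex
    proof -
      have "s1 * E * (s2 * F * G) = (s1 * s2) * (E * F) * G" by (simp only: mult_ac)
      also have "\<dots> = (s1 * s2 * s3) * (P * Q) * G" unfolding ex by (simp only: mult_ac)
      finally show ?thesis unfolding sg by (simp only: mult_ac)
    qed
    show ?thesis unfolding slashed_term_def A by (rule alg[OF ex sg])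
  qed
  show ?thesis
    unfolding weighted_sum_def level_sum_eq_slashed infsum_cmult_right'[symmetric]
  proof (rule infsum_reindex_bij_witness[of _ "\<lambda>(l, n). (l - 1, n)" "\<lambda>(l, n). (l + 1, n)"], goal_cases)
    case (5 x)
    obtain l n where x: "x = (l, n)" by (cases x)
    show ?case unfolding x prod.case by (rule trm[symmetric])
  qed auto
qed


end

lemma sum_index_set_swap:
  fixes F :: "int \<Rightarrow> int \<Rightarrow> complex"
  shows "(\<Sum>(a, b)\<in>index_set M. F b a) = (\<Sum>a0\<in>{0..<int M}. \<Sum>b0\<in>{b\<in>{- int M..<int M}. even (a0 - b)}. F a0 b0)"
proof -
  have "(\<Sum>a0\<in>{0..<int M}. \<Sum>b0\<in>{b\<in>{- int M..<int M}. even (a0 - b)}. F a0 b0) = 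
     (\<Sum>(a0, b0)\<in>Sigma {0..<int M} (\<lambda>a0. {b\<in>{- int M..<int M}. even (a0 - b)}). F a0 b0)"
    by (rule sum.Sigma) (auto intro: finite_subset[of _ "{- int M..<int M}"])
  also have "\<dots> = (\<Sum>(a, b)\<in>index_set M. F b a)"
    by (rule sum.reindex_bij_witness[of _ "\<lambda>(a, b). (b, a)" "\<lambda>(a, b). (b, a)"]) (auto simp: index_set_def)
  finally show ?thesis by simp
qed

text \<open>
  A function invariant under \<open>(M, - M)\<close> has the same sum over two rectangles that are related by
  exchanging the coordinates: the pairs with negative first coordinate are moved by \<open>(M, - M)\<close>.
\<close>

lemma sum_index_set_shift:
  fixes F :: "int \<Rightarrow> int \<Rightarrow> complex"
  assumes M: "M > 0" and F: "\<And>a b. F (a + int M) (b - int M) = F a b"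
  shows "(\<Sum>(a, b)\<in>index_set M. F a b) = (\<Sum>a0\<in>{0..<int M}. \<Sum>b0\<in>{b\<in>{- int M..<int M}. even (a0 - b)}. F a0 b0)"
proof -
  have "(\<Sum>(a, b)\<in>index_set M. F a b) = (\<Sum>(a, b)\<in>index_set M. F b a)"
  proof (rule sum.reindex_bij_witness[of _ "\<lambda>(b, a). if b < 0 then (a - int M, b + int M) else (a, b)" 
          "\<lambda>(a, b). if a < 0 then (b - int M, a + int M) else (b, a)"])
    fix x :: "int \<times> int" assume "x \<in> index_set M"
    then show "(case case x of (a, b) \<Rightarrow> if a < 0 then (b - int M, a + int M) else (b, a) of (a, b) \<Rightarrow> F b a) =
        (case x of (a, b) \<Rightarrow> F a b)"
      using F by (auto split: prod.splits)
  qed (use M in \<open>auto simp: index_set_def split: if_splits\<close>)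
  then show ?thesis unfolding sum_index_set_swap .
qed

section \<open>Transformation of the characters\<close>

lemma Omega_B_eq:
  assumes e: "e \<in> {0, 1/2}"
  shows "Omega_B M e = (\<lambda>(a, b). (of_int a + e, of_int b + e)) ` index_set M"
proof (intro equalityI subsetI)
  fix x assume "x \<in> Omega_B M e"
  then obtain j k n where x: "x = (j, k)" and jk: "j - e \<in> \<int>" "k - e \<in> \<int>" "- real M \<le> j" "j < real M" "0 \<le>
      k" "k < real M" "j - k = 2 * of_int n"
    by (auto simp: Omega_B_def)
  obtain a b :: int where a: "j = of_int a + e" and b: "k = of_int b + e"
    using jk(1,2) by (metis Ints_cases diff_add_cancel)
  have "real_of_int (a - b) = of_int (2 * n)" using jk(7) by (simp add: a b)
  then have "even (a - b)" by (metis dvd_triv_left of_int_eq_iff)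
  moreover have "- int M \<le> a" "a < int M" "0 \<le> b" "b < int M"
    using jk(3-6) e by (auto simp: a b)
  ultimately show "x \<in> (\<lambda>(a, b). (of_int a + e, of_int b + e)) ` index_set M"
    by (auto simp: x a b index_set_def)
next
  fix x assume "x \<in> (\<lambda>(a, b). (of_int a + e, of_int b + e)) ` index_set M"
  then obtain a b :: int where x: "x = (of_int a + e, of_int b + e)" and ab: "- int M \<le> a" "a < int M" "0 \<le>
      b" "b < int M" "even (a - b)"
    by (auto simp: index_set_def)
  obtain n where "a - b = 2 * n" using ab(5) by (elim evenE)
  then have "of_int a + e - (of_int b + e) = 2 * real_of_int n" by (metis add_diff_cancel_right of_int_diff
      of_int_mult of_int_numeral)
  moreover have "- real M \<le> of_int a + e" "of_int a + e < real M" "0 \<le> of_int b + e" "of_int b + e < real M"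
    using ab e by auto
  ultimately show "x \<in> Omega_B M e" by (auto simp: Omega_B_def x)
qed

text \<open>
  The theta functions in the denominator vanish at these points.
\<close>

lemma regular_point_imp:
  assumes "regular_point e e' \<tau> z1 z2" and e: "e \<in> {0, 1/2}" and e': "e' \<in> {0, 1/2}"
  shows "z1 \<noteq> of_real (of_int p + e') * \<tau> + of_real (of_int r + e)" "z2 \<noteq> of_real (of_int p + e') * \<tau> +
      of_real (of_int r + e)"
proof -
  have "z \<noteq> of_real (of_int p + e') * \<tau> + of_real (of_int r + e)" if "jacobi_theta (1 - 2 * e') (1 - 2 *
      e) \<tau> z \<noteq> 0" for z
  proof
    assume "z = of_real (of_int p + e') * \<tau> + of_real (of_int r + e)"
    then have "z = of_real e + of_real e' * \<tau> + of_int r + of_int p * \<tau>" by (simp add: algebra_simps)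
    from jacobi_theta_eq_0[OF this] that show False by simp
  qed
  then show "z1 \<noteq> of_real (of_int p + e') * \<tau> + of_real (of_int r + e)" "z2 \<noteq> of_real (of_int p + e') * \<tau> +
      of_real (of_int r + e)"
    using assms(1) by (auto simp: regular_point_def)
qed

lemma Psi_tilde_B_eq:
  assumes \<tau>: "Im \<tau> > 0" and M: "M > 0"
    and nz: "\<And>p r::int. z1 + of_real a * \<tau> + of_real s \<noteq> of_int p * \<tau> + of_int r" "\<And>p r::int. z2 + of_real b *
        \<tau> + of_real s \<noteq> of_int p * \<tau> + of_int r"
  shows "Psi_tilde_B M m s a b s' \<tau> z1 z2 t = exp (of_real pi * \<i> * (2 * of_nat m + 1) * t / of_nat M) * (\<i> /
      (2 * of_real pi)) * 
    (level_sum M m s a b \<tau> z1 z2 - level_sum M m s b a \<tau> z2 z1)"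
proof -
  define w1 w2 where "w1 = z1 + of_real a * \<tau> + of_real s" and "w2 = z2 + of_real b * \<tau> + of_real s"
  have nl: "\<not> in_lattice (of_nat M * \<tau>) w" if "\<And>p r::int. w \<noteq> of_int p * \<tau> + of_int r" for w
  proof
    assume "in_lattice (of_nat M * \<tau>) w"
    then obtain p r where "w = of_int p * (of_nat M * \<tau>) + of_int r" unfolding in_lattice_def by blast
    then have "w = of_int (p * int M) * \<tau> + of_int r" by simp
    with that show False by blast
  qed
  have MT: "Im (of_nat M * \<tau>) > 0" using \<tau> M by simp
  have ex: "exp (2 * of_real pi * \<i> * (of_nat m + 1/2) * (t / of_nat M)) = exp (of_real pi * \<i> * (2 * of_nat m +
      1) * t / of_nat M)"
    by (rule arg_cong[where f = exp]) (use M in \<open>simp add: field_simps\<close>)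
  have Phi: "Phi_tilde_B m (of_nat M * \<tau>) w1 w2 (t / of_nat M) = exp (of_real pi * \<i> * (2 * of_nat m + 1) * t /
      of_nat M) * 
      (\<i> / (2 * of_real pi) * (kron_sum m (of_nat M * \<tau>) w1 w2 - kron_sum m (of_nat M * \<tau>) w2 w1))"
    unfolding Phi_tilde_B_eq_kron_sum[OF MT nl nl, OF nz[folded w1_def w2_def]] ex ..
  have X1: "level_sum M m s a b \<tau> z1 z2 = qpow \<tau> ((2 * of_nat m + 1) / (2 * of_nat M) * of_real a * of_real b) *
     exp (2 * of_real pi * \<i> * (2 * of_nat m + 1) / (2 * of_nat M) * (of_real b * z1 + of_real a * z2)) *
         kron_sum m (of_nat M * \<tau>) w1 w2"
    unfolding level_sum_def w1_def w2_def ..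
  have X2: "level_sum M m s b a \<tau> z2 z1 = qpow \<tau> ((2 * of_nat m + 1) / (2 * of_nat M) * of_real a * of_real b) *
     exp (2 * of_real pi * \<i> * (2 * of_nat m + 1) / (2 * of_nat M) * (of_real b * z1 + of_real a * z2)) *
         kron_sum m (of_nat M * \<tau>) w2 w1"
    unfolding level_sum_def w1_def w2_def by (simp add: mult_ac add.commute)
  show ?thesis
    unfolding Psi_tilde_B_def w1_def[symmetric] w2_def[symmetric] Phi X1 X2 by (simp add: algebra_simps)
qed


lemma half_int_neg:
  assumes "e \<in> {0, 1/2 :: real}"
  obtains ee :: int where "of_int ee = 2 * e" "\<And>p::int. of_int p - e = of_int (p - ee) + e"
proof
  show "of_int (if e = 0 then 0 else 1) = 2 * e" "\<And>p::int. of_int p - e = of_int (p - (if e = 0 then 0 else 1)) + e"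
    using assms by auto
qed

text \<open>
  In the half with \<open>z1, z2\<close> exchanged the coordinates of the index exchange their roles, so the sum
  over the index set is taken over the reflected rectangle.
\<close>

lemma Psi_tilde_B_S:
  assumes M: "M > 0" and cop: "coprime (int M) (2 * (2 * int m + 1))"
    and e: "e \<in> {0, 1/2}" and e': "e' \<in> {0, 1/2}" and e2: "of_int e2 = 2 * e'" and \<tau>: "Im \<tau> > 0"
    and jk: "even (j0 - k0)"
    and nz1: "\<And>p r::int. z1 \<noteq> of_real (of_int p + e) * \<tau> + of_real (of_int r + e')"
    and nz2: "\<And>p r::int. z2 \<noteq> of_real (of_int p + e) * \<tau> + of_real (of_int r + e')"
  shows "(-1) powi j0 * Psi_tilde_B M m e (of_int j0 + e') (of_int k0 + e') e' (- 1 / \<tau>) (z1 / \<tau>) (z2 / \<tau>) (t -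
      z1 * z2 / \<tau>) =
    (-1) powi e2 * \<tau> / of_nat M * (\<Sum>(a, b)\<in>index_set M. 
       exp (- (of_real pi * \<i> * (2 * of_nat m + 1) / of_nat M) * of_real ((of_int b + e) * (of_int j0 + e') +
           (of_int a + e) * (of_int k0 + e'))) * 
       ((-1) powi a * Psi_tilde_B M m e' (of_int a + e) (of_int b + e) e \<tau> z1 z2 t))"
proof -
  have \<tau>0: "\<tau> \<noteq> 0" using \<tau> by auto
  have \<tau>': "Im (- 1 / \<tau>) > 0" using \<tau> by (simp add: Im_divide power2_eq_square complex_eq_iff sum_squares_gt_zero_iff)
  have "2 * e = 0 \<or> 2 * e = 1" using e by auto
  then have ei: "2 * e \<in> \<int>" by (metis Ints_0 Ints_1)
  note [simp] = M
  define q where "q = level_const M m"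
  have q: "q = of_real pi * \<i> * (2 * of_nat m + 1) / of_nat M" by (simp add: q_def level_const_def)
  obtain ee where ee: "\<And>p::int. of_int p - e = of_int (p - ee) + e" using half_int_neg[OF e] by metis
  obtain ee' where ee': "\<And>p::int. of_int p - e' = of_int (p - ee') + e'" using half_int_neg[OF e'] by metis
  have nzL: "z / \<tau> + of_real (of_int j + e') * (- 1 / \<tau>) + of_real e \<noteq> of_int p * (- 1 / \<tau>) + of_int r"
    if nz: "\<And>p r::int. z \<noteq> of_real (of_int p + e) * \<tau> + of_real (of_int r + e')" for z and j p r :: int
  proof
    assume "z / \<tau> + of_real (of_int j + e') * (- 1 / \<tau>) + of_real e = of_int p * (- 1 / \<tau>) + of_int r"
    then have "z = of_real (of_int r - e) * \<tau> + of_real (of_int (j - p) + e')"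
      using \<tau>0 by (simp add: field_simps)
    with nz show False unfolding ee by blast
  qed
  have nzR: "z + of_real (of_int a + e) * \<tau> + of_real e' \<noteq> of_int p * \<tau> + of_int r"
    if nz: "\<And>p r::int. z \<noteq> of_real (of_int p + e) * \<tau> + of_real (of_int r + e')" for z and a p r :: int
  proof
    assume "z + of_real (of_int a + e) * \<tau> + of_real e' = of_int p * \<tau> + of_int r"
    then have "z = of_real (of_int (p - a) - e) * \<tau> + of_real (of_int r - e')" by (simp add: algebra_simps)
    with nz show False unfolding ee ee' by blast
  qed
  define c where "c = exp (of_real pi * \<i> * (2 * of_nat m + 1) * t / of_nat M) * (\<i> / (2 * of_real pi))"
  define W1 where "W1 = weighted_sum M m e e' \<tau> j0 k0 z1 z2"
  define W2 where "W2 = weighted_sum M m e e' \<tau> k0 j0 z2 z1"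
  have kj: "even (k0 - j0)" using jk by simp
  have S1: "level_sum M m e (of_int j0 + e') (of_int k0 + e') (- 1 / \<tau>) (z1 / \<tau>) (z2 / \<tau>) = 
      exp (q * z1 * z2 / \<tau>) * \<tau> / of_nat M * (-1) powi (j0 + e2) * (\<Sum>(a, b)\<in>index_set M. W1 a b)"
    unfolding q_def W1_def level_sum_S_sum[OF M cop ei e2 \<tau> nz1 jk]
    by (subst sum_index_set_shift[OF M]) (rule weighted_sum_shift[OF M cop ei e2 \<tau> jk], rule refl)
  have S2: "level_sum M m e (of_int k0 + e') (of_int j0 + e') (- 1 / \<tau>) (z2 / \<tau>) (z1 / \<tau>) = 
      exp (q * z1 * z2 / \<tau>) * \<tau> / of_nat M * (-1) powi (j0 + e2) * (\<Sum>(a, b)\<in>index_set M. W2 b a)"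
  proof -
    have A: "(-1) powi (k0 + e2) = ((-1) powi (j0 + e2) :: complex)" using jk by (simp add: minus_one_powi)
    have B: "level_const M m * z2 * z1 = level_const M m * z1 * z2" by simp
    show ?thesis
      unfolding q_def W2_def level_sum_S_sum[OF M cop ei e2 \<tau> nz2 kj] sum_index_set_swap A B ..
  qed
  have Rt: "c * (W1 a b - W2 b a) = exp (- q * of_real ((of_int b + e) * (of_int j0 + e') + (of_int a + e) *
      (of_int k0 + e'))) * 
       ((-1) powi a * Psi_tilde_B M m e' (of_int a + e) (of_int b + e) e \<tau> z1 z2 t)" if "(a, b) \<in> index_set M" for a b
  proof -
    have "even (a - b)" using that by (simp add: index_set_def)
    then have ab: "(-1) powi b = ((-1) powi a :: complex)" by (simp add: minus_one_powi)
    have P: "Psi_tilde_B M m e' (of_int a + e) (of_int b + e) e \<tau> z1 z2 t = c * (level_sum M m e' (of_int a +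
        e) (of_int b + e) \<tau> z1 z2 - level_sum M m e' (of_int b + e) (of_int a + e) \<tau> z2 z1)"
      unfolding c_def by (rule Psi_tilde_B_eq[OF \<tau> M nzR[OF nz1] nzR[OF nz2]])
    have "of_real ((of_int a + e) * (of_int k0 + e') + (of_int b + e) * (of_int j0 + e')) =
        (of_real ((of_int b + e) * (of_int j0 + e') + (of_int a + e) * (of_int k0 + e')) :: complex)"
      by (simp add: add.commute)
    then show ?thesis
      unfolding W1_def W2_def weighted_sum_def P ab q_def[symmetric] by (simp add: algebra_simps)
  qed
  have ex: "exp (of_real pi * \<i> * (2 * of_nat m + 1) * (t - z1 * z2 / \<tau>) / of_nat M) * exp (q * z1 * z2 / \<tau>) =
      exp (of_real pi * \<i> * (2 * of_nat m + 1) * t / of_nat M)"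
    unfolding q mult_exp_exp using \<tau>0 by (intro arg_cong[where f = exp]) (simp add: field_simps)
  have sg: "(-1) powi j0 * (-1) powi (j0 + e2) = ((-1) powi e2 :: complex)" by (simp add: minus_one_powi)
  define e1 where "e1 = exp (of_real pi * \<i> * (2 * of_nat m + 1) * (t - z1 * z2 / \<tau>) / of_nat M)"
  have P: "Psi_tilde_B M m e (of_int j0 + e') (of_int k0 + e') e' (- 1 / \<tau>) (z1 / \<tau>) (z2 / \<tau>) (t - z1 * z2 /
      \<tau>) = e1 * (\<i> / (2 * of_real pi)) * 
     (level_sum M m e (of_int j0 + e') (of_int k0 + e') (- 1 / \<tau>) (z1 / \<tau>) (z2 / \<tau>) -
         level_sum M m e (of_int k0 + e') (of_int j0 + e') (- 1 / \<tau>) (z2 / \<tau>) (z1 / \<tau>))"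
    unfolding e1_def by (rule Psi_tilde_B_eq[OF \<tau>' M nzL[OF nz1] nzL[OF nz2]])
  have "(-1) powi j0 * Psi_tilde_B M m e (of_int j0 + e') (of_int k0 + e') e' (- 1 / \<tau>) (z1 / \<tau>) (z2 / \<tau>) (t -
      z1 * z2 / \<tau>) = 
     ((-1) powi j0 * (-1) powi (j0 + e2)) * \<tau> / of_nat M * ((e1 * exp (q * z1 * z2 / \<tau>)) * (\<i> / (2 *
         of_real pi)) * ((\<Sum>(a, b)\<in>index_set M. W1 a b) - (\<Sum>(a, b)\<in>index_set M. W2 b a)))"
    unfolding P S1 S2 right_diff_distrib[symmetric] by (simp only: mult_ac times_divide_eq_right
        times_divide_eq_left divide_divide_eq_left)
  also have "\<dots> = (-1) powi e2 * \<tau> / of_nat M * (c * ((\<Sum>(a, b)\<in>index_set M. W1 a b) - (\<Sum>(a, b)\<in>index_set M. W2 b a)))"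
    unfolding sg e1_def ex c_def ..
  also have "c * ((\<Sum>(a, b)\<in>index_set M. W1 a b) - (\<Sum>(a, b)\<in>index_set M. W2 b a)) = (\<Sum>(a, b)\<in>index_set M. c *
      (W1 a b - W2 b a))"
    by (simp add: sum_distrib_left case_prod_unfold flip: sum_subtractf)
  also have "\<dots> = (\<Sum>(a, b)\<in>index_set M. exp (- q * of_real ((of_int b + e) * (of_int j0 + e') + (of_int a + e) *
      (of_int k0 + e'))) * 
       ((-1) powi a * Psi_tilde_B M m e' (of_int a + e) (of_int b + e) e \<tau> z1 z2 t))"
    by (rule sum.cong) (auto simp: Rt)
  finally show ?thesis unfolding q .
qed

lemma kron_sum_T_nat: "kron_sum m (\<tau> + of_nat n) z1 z2 = kron_sum m \<tau> z1 z2"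
proof (induction n)
  case (Suc n)
  have "\<tau> + of_nat (Suc n) = (\<tau> + of_nat n) + 1" by simp
  then show ?case by (simp only: kron_sum_T Suc)
qed auto

text \<open>
  Besides the power of \<open>q\<close>, only the translation of the arguments by integers contributes.
\<close>

lemma level_sum_T:
  assumes p: "of_int p = a + s - s''" and q: "of_int q = b + s - s''" and pq: "even (p - q)"
  shows "level_sum M m s a b (\<tau> + 1) z1 z2 = exp (of_real pi * \<i> * (2 * of_nat m + 1) / of_nat M * of_real (a *
      b)) * (-1) powi p * level_sum M m s'' a b \<tau> z1 z2"
proof -
  have p': "of_real a + of_real s = (of_real s'' + of_int p :: complex)" using arg_cong[OF p, of
      complex_of_real] by simp
  have q': "of_real b + of_real s = (of_real s'' + of_int q :: complex)" using arg_cong[OF q, of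
      complex_of_real] by simp
  have a1: "z1 + of_real a * (\<tau> + 1) + of_real s = (z1 + of_real a * \<tau> + of_real s'') + of_int p"
    using p' by (simp add: algebra_simps)
  have a2: "z2 + of_real b * (\<tau> + 1) + of_real s = (z2 + of_real b * \<tau> + of_real s'') + of_int q"
    using q' by (simp add: algebra_simps)
  have a3: "of_nat M * (\<tau> + 1) = of_nat M * \<tau> + of_nat M" by (simp add: algebra_simps)
  have q1: "qpow (\<tau> + 1) ((2 * of_nat m + 1) / (2 * of_nat M) * of_real a * of_real b) = 
     exp (of_real pi * \<i> * (2 * of_nat m + 1) / of_nat M * of_real (a * b)) * qpow \<tau> ((2 * of_nat m + 1) / (2 *
         of_nat M) * of_real a * of_real b)"
    unfolding qpow_def mult_exp_exp by (cases "M = 0") (auto intro!: arg_cong[where f = exp] simp: field_simps)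
  show ?thesis
    unfolding level_sum_def a1 a2 a3 q1 kron_sum_T_nat kron_sum_shift[OF pq] by (simp only: mult_ac)
qed

lemma Psi_tilde_B_T:
  assumes M: "M > 0" and e: "e \<in> {0, 1/2}" and e': "e' \<in> {0, 1/2}" and \<tau>: "Im \<tau> > 0" and jk: "even (j0 - k0)"
    and s: "of_int s = e + e' - \<bar>e - e'\<bar>"
    and nz1: "\<And>p r::int. z1 \<noteq> of_real (of_int p + e') * \<tau> + of_real (of_int r + \<bar>e - e'\<bar>)"
    and nz2: "\<And>p r::int. z2 \<noteq> of_real (of_int p + e') * \<tau> + of_real (of_int r + \<bar>e - e'\<bar>)"
  shows "Psi_tilde_B M m e (of_int j0 + e') (of_int k0 + e') e' (\<tau> + 1) z1 z2 t = 
    exp (of_real pi * \<i> * (2 * of_nat m + 1) / of_nat M * of_real ((of_int j0 + e') * (of_int k0 + e'))) *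
        (-1) powi (j0 + s) * 
    Psi_tilde_B M m \<bar>e - e'\<bar> (of_int j0 + e') (of_int k0 + e') e' \<tau> z1 z2 t"
proof -
  define s'' where "s'' = \<bar>e - e'\<bar>"
  have s'': "s'' \<in> {0, 1/2}" using e e' by (auto simp: s''_def)
  have \<tau>': "Im (\<tau> + 1) > 0" using \<tau> by simp
  obtain ee' where ee': "\<And>p::int. of_int p - e' = of_int (p - ee') + e'" using half_int_neg[OF e'] by metis
  obtain es where es: "\<And>p::int. of_int p - s'' = of_int (p - es) + s''" using half_int_neg[OF s''] by metis
  have p: "of_int (j0 + s) = of_int j0 + e' + e - s''" "of_int (k0 + s) = of_int k0 + e' + e - s''"
    using s by (simp_all add: s''_def)
  have even: "even (j0 + s - (k0 + s))" "even (k0 + s - (j0 + s))" using jk by auto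
  have nzR: "z + of_real (of_int a + e') * \<tau> + of_real s'' \<noteq> of_int p * \<tau> + of_int r"
    if nz: "\<And>p r::int. z \<noteq> of_real (of_int p + e') * \<tau> + of_real (of_int r + s'')" for z and a p r :: int
  proof
    assume "z + of_real (of_int a + e') * \<tau> + of_real s'' = of_int p * \<tau> + of_int r"
    then have "z = of_real (of_int (p - a) - e') * \<tau> + of_real (of_int r - s'')" by (simp add: algebra_simps)
    with nz show False unfolding ee' es by blast
  qed
  have nzL: "z + of_real (of_int a + e') * (\<tau> + 1) + of_real e \<noteq> of_int p * (\<tau> + 1) + of_int r"
    if nz: "\<And>p r::int. z \<noteq> of_real (of_int p + e') * \<tau> + of_real (of_int r + s'')" for z and a p r :: int
  proof
    assume "z + of_real (of_int a + e') * (\<tau> + 1) + of_real e = of_int p * (\<tau> + 1) + of_int r"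
    moreover have "of_real e = (of_int s + of_real s'' - of_real e' :: complex)"
    proof -
      have "e = of_int s + s'' - e'" using s by (simp add: s''_def)
      from arg_cong[OF this, of complex_of_real] show ?thesis by simp
    qed
    ultimately have "z + of_real (of_int a + e') * \<tau> + of_real s'' = of_int p * \<tau> + of_int (r + p - a - s)"
      by (simp add: algebra_simps)
    with nzR[OF nz] show False by blast
  qed
  note nz1' = nz1[folded s''_def] and nz2' = nz2[folded s''_def]
  have sg: "(-1) powi (k0 + s) = ((-1) powi (j0 + s) :: complex)" using jk by (simp add: minus_one_powi)
  define E where "E = exp (of_real pi * \<i> * (2 * of_nat m + 1) / of_nat M * of_real ((of_int j0 + e') *
      (of_int k0 + e')))"
  have S1: "level_sum M m e (of_int j0 + e') (of_int k0 + e') (\<tau> + 1) z1 z2 = E * (-1) powi (j0 + s) *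
      level_sum M m s'' (of_int j0 + e') (of_int k0 + e') \<tau> z1 z2"
    unfolding E_def by (rule level_sum_T[OF p(1) p(2) even(1)])
  have S2: "level_sum M m e (of_int k0 + e') (of_int j0 + e') (\<tau> + 1) z2 z1 = E * (-1) powi (j0 + s) *
      level_sum M m s'' (of_int k0 + e') (of_int j0 + e') \<tau> z2 z1"
    unfolding level_sum_T[OF p(2) p(1) even(2)] sg E_def by (simp only: mult.commute[of "of_int k0 +
        e'" "of_int j0 + e'"])
  have alg: "c * (E * g * A - E * g * B) = E * g * (c * (A - B))" for c g A B :: complex
    by (simp add: algebra_simps)
  show ?thesis
    unfolding s''_def[symmetric] Psi_tilde_B_eq[OF \<tau>' M nzL[OF nz1'] nzL[OF nz2']] Psi_tilde_B_eq[OF \<tau> M nzR[OF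
        nz1'] nzR[OF nz2']]
      S1 S2 E_def[symmetric] by (rule alg)
qed

theorem theorem6p12:
  fixes m M :: nat and eps eps' j k :: real and tau z1 z2 t :: complex
  assumes "M \<ge> 1" and "gcd M (4 * m + 2) = 1"
    and "eps \<in> {0, 1/2}" and "eps' \<in> {0, 1/2}"
    and "(j, k) \<in> Omega_B M eps'"
    and "Im tau > 0"
  shows "(regular_point eps' eps tau z1 z2 \<longrightarrow>
      ch_tilde_B M m eps j k eps' (- 1 / tau) (z1 / tau) (z2 / tau) (t - z1 * z2 / tau) =
        \<i> powi \<lfloor>4 * eps * eps' + 2 * eps - 2 * eps'\<rfloor> / of_nat M *
        (\<Sum>(a, b)\<in>Omega_B M eps.
           exp (- (of_real pi * \<i> * (2 * of_nat m + 1) / of_nat M) * of_real (b * j + a * k))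
           * ch_tilde_B M m eps' a b eps tau z1 z2 t)) \<and>
    (regular_point \<bar>eps - eps'\<bar> eps' tau z1 z2 \<longrightarrow>
      ch_tilde_B M m eps j k eps' (tau + 1) z1 z2 t =
        (-1) powi \<lfloor>4 * eps * eps'\<rfloor> *
        exp (of_real pi * \<i> * (2 * of_nat m + 1) / of_nat M * of_real (j * k)
             + of_real pi * \<i> * of_real (j + 3/2 * eps'))
        * ch_tilde_B M m \<bar>eps - eps'\<bar> j k eps' tau z1 z2 t)"
proof -
  note e = assms(3) and e' = assms(4) and \<tau> = assms(6)
  have M: "M > 0" using assms(1) by simp
  have "coprime M (4 * m + 2)" using assms(2) by (simp only: coprime_iff_gcd_eq_1)
  then have "coprime (int M) (int (4 * m + 2))" by (simp only: coprime_int_iff)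
  moreover have "int (4 * m + 2) = 2 * (2 * int m + 1)" by simp
  ultimately have cop: "coprime (int M) (2 * (2 * int m + 1))" by metis
  obtain j0 k0 where jk: "j = of_int j0 + eps'" "k = of_int k0 + eps'" "(j0, k0) \<in> index_set M"
    using assms(5) unfolding Omega_B_eq[OF e'] by auto
  have ev: "even (j0 - k0)" using jk(3) by (simp add: index_set_def)
  define e2 where "e2 = \<lfloor>2 * eps'\<rfloor>"
  have e2: "of_int e2 = 2 * eps'" using e' unfolding e2_def by (elim insertE emptyE; hypsubst; simp)
  have flj: "\<lfloor>j - eps'\<rfloor> = j0" by (simp add: jk)
  have part1: "ch_tilde_B M m eps j k eps' (- 1 / tau) (z1 / tau) (z2 / tau) (t - z1 * z2 / tau) =
        \<i> powi \<lfloor>4 * eps * eps' + 2 * eps - 2 * eps'\<rfloor> / of_nat M *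
        (\<Sum>(a, b)\<in>Omega_B M eps.
           exp (- (of_real pi * \<i> * (2 * of_nat m + 1) / of_nat M) * of_real (b * j + a * k))
           * ch_tilde_B M m eps' a b eps tau z1 z2 t)" if reg: "regular_point eps' eps tau z1 z2"
  proof -
    define R where "R = R_hat eps' eps tau z1 z2 t"
    define R' where "R' = R_hat eps eps' (- 1 / tau) (z1 / tau) (z2 / tau) (t - z1 * z2 / tau)"
    define \<kappa> :: complex where "\<kappa> = \<i> powi \<lfloor>4 * eps * eps' + 2 * eps - 2 * eps'\<rfloor>"
    define T :: "int \<Rightarrow> int \<Rightarrow> complex" where "T a b = exp (- (of_real pi * \<i> * (2 * of_nat m + 1) / of_nat M) *
        of_real ((of_int b + eps) * j + (of_int a + eps) * k)) * 
       ((-1) powi a * Psi_tilde_B M m eps' (of_int a + eps) (of_int b + eps) eps tau z1 z2 t)" for a b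
    have RR: "\<kappa> * R' = (-1) powi e2 * tau * R" unfolding R_def R'_def \<kappa>_def e2_def by (rule R_hat_S[OF \<tau> e e'])
    have \<kappa>0: "\<kappa> \<noteq> 0" by (simp add: \<kappa>_def)
    have \<tau>0: "tau \<noteq> 0" using \<tau> by auto
    \<comment> \<open>also true if both denominators vanish\<close>
    have quot: "(-1) powi e2 * tau / R' = \<kappa> / R"
    proof (cases "R = 0")
      case True
      then have "R' = 0" using RR \<kappa>0 by simp
      with True show ?thesis by simp
    next
      case False
      then have "R' \<noteq> 0" using RR \<kappa>0 \<tau>0 by (auto simp: minus_one_powi split: if_splits)
      have "(-1) powi e2 * tau / R' = ((-1) powi e2 * tau * R) / (R' * R)" using False by simp
      also have "\<dots> = (\<kappa> * R') / (R' * R)" unfolding RR ..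
      also have "\<dots> = \<kappa> / R" using \<open>R' \<noteq> 0\<close> by simp
      finally show ?thesis .
    qed
    have S: "(-1) powi j0 * Psi_tilde_B M m eps j k eps' (- 1 / tau) (z1 / tau) (z2 / tau) (t - z1 * z2 / tau) =
      (-1) powi e2 * tau / of_nat M * (\<Sum>(a, b)\<in>index_set M. T a b)"
      unfolding T_def jk(1,2) by (rule Psi_tilde_B_S[OF M cop e e' e2 \<tau> ev regular_point_imp[OF reg e' e]])
    have inj: "inj_on (\<lambda>(a :: int, b :: int). (of_int a + eps, of_int b + eps)) (index_set M)"
      by (auto simp: inj_on_def)
    have "(\<Sum>(a, b)\<in>Omega_B M eps. exp (- (of_real pi * \<i> * (2 * of_nat m + 1) / of_nat M) * of_real (b * j + a *
        k)) * ch_tilde_B M m eps' a b eps tau z1 z2 t) = 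
       (\<Sum>(a, b)\<in>index_set M. T a b / R)"
      unfolding Omega_B_eq[OF e] sum.reindex[OF inj] by (rule sum.cong) (auto simp: ch_tilde_B_def T_def R_def)
    also have "\<dots> = (\<Sum>(a, b)\<in>index_set M. T a b) / R" by (simp add: sum_divide_distrib case_prod_unfold)
    finally have RHS: "(\<Sum>(a, b)\<in>Omega_B M eps. exp (- (of_real pi * \<i> * (2 * of_nat m + 1) / of_nat M) *
        of_real (b * j + a * k)) * ch_tilde_B M m eps' a b eps tau z1 z2 t) = 
       (\<Sum>(a, b)\<in>index_set M. T a b) / R" .
    have "ch_tilde_B M m eps j k eps' (- 1 / tau) (z1 / tau) (z2 / tau) (t - z1 * z2 / tau) = ((-1) powi e2 *
        tau / R') * ((\<Sum>(a, b)\<in>index_set M. T a b) / of_nat M)"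
      unfolding ch_tilde_B_def flj R'_def[symmetric] times_divide_eq_right S by simp
    also have "\<dots> = \<kappa> / of_nat M * ((\<Sum>(a, b)\<in>index_set M. T a b) / R)" unfolding quot by simp
    finally show ?thesis unfolding RHS \<kappa>_def .
  qed
  have part2: "ch_tilde_B M m eps j k eps' (tau + 1) z1 z2 t =
        (-1) powi \<lfloor>4 * eps * eps'\<rfloor> *
        exp (of_real pi * \<i> * (2 * of_nat m + 1) / of_nat M * of_real (j * k)
             + of_real pi * \<i> * of_real (j + 3/2 * eps'))
        * ch_tilde_B M m \<bar>eps - eps'\<bar> j k eps' tau z1 z2 t" if reg: "regular_point \<bar>eps - eps'\<bar> eps' tau z1 z2"
  proof -
    define s where "s = \<lfloor>4 * eps * eps'\<rfloor>"
    have s: "of_int s = eps + eps' - \<bar>eps - eps'\<bar>" using e e' unfolding s_def by (elim insertE emptyE; hypsubst; simp)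
    have e'': "\<bar>eps - eps'\<bar> \<in> {0, 1/2}" using e e' by auto
    define R where "R = R_hat \<bar>eps - eps'\<bar> eps' tau z1 z2 t"
    define X where "X = exp (of_real pi * \<i> * (2 * of_nat m + 1) / of_nat M * of_real (j * k))"
    have P: "Psi_tilde_B M m eps j k eps' (tau + 1) z1 z2 t = X * (-1) powi (j0 + s) * Psi_tilde_B M m \<bar>eps -
        eps'\<bar> j k eps' tau z1 z2 t"
      unfolding X_def jk(1,2) by (rule Psi_tilde_B_T[OF M e e' \<tau> ev s regular_point_imp[OF reg e'' e']])
    have R: "(-1) powi (j0 + s) / R_hat eps eps' (tau + 1) z1 z2 t = (-1) powi s * exp (of_real pi * \<i> *
        of_real (j + 3/2 * eps')) / R"
    proof (cases "eps' = 0")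
      case True
      have "R_hat eps eps' (tau + 1) z1 z2 t = R" using True e R_hat_T_untwisted[of eps tau z1 z2 t] by (auto
          simp: R_def)
      moreover have "exp (of_real pi * \<i> * of_real (j + 3/2 * eps')) = (-1) powi j0"
        using True exp_pi_i_int[of j0] by (simp add: jk(1))
      moreover have "(-1) powi (j0 + s) = ((-1) powi s * (-1) powi j0 :: complex)" by (simp add: minus_one_powi)
      ultimately show ?thesis by simp
    next
      case False
      then have h: "eps' = 1/2" using e' by auto
      have 1: "R_hat eps eps' (tau + 1) z1 z2 t = exp (3 * of_real pi * \<i> / 4) * R"
        unfolding R_def h by (rule R_hat_T_twisted[OF e])
      have 2: "exp (of_real pi * \<i> * of_real (j + 3/2 * eps')) = (-1) powi j0 * exp (- (3 * of_real pi * \<i> / 4))"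
        unfolding exp_pi_i_int[symmetric] mult_exp_exp
        by (rule exp_eq_2pi_intI[where k = 1]) (simp add: jk(1) h field_simps)
      have 3: "(-1) powi (j0 + s) = ((-1) powi s * (-1) powi j0 :: complex)" by (simp add: minus_one_powi)
      show ?thesis unfolding 1 2 3 exp_minus by (simp only: divide_inverse inverse_mult_distrib mult_ac)
    qed
    have "ch_tilde_B M m eps j k eps' (tau + 1) z1 z2 t = (-1) powi j0 * (X * Psi_tilde_B M m \<bar>eps -
        eps'\<bar> j k eps' tau z1 z2 t * ((-1) powi (j0 + s) / R_hat eps eps' (tau + 1) z1 z2 t))"
      unfolding ch_tilde_B_def flj P by (simp only: divide_inverse mult_ac)
    also have "\<dots> = (-1) powi s * (X * exp (of_real pi * \<i> * of_real (j + 3/2 * eps'))) * ((-1) powi j0 *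
        (Psi_tilde_B M m \<bar>eps - eps'\<bar> j k eps' tau z1 z2 t / R))"
      unfolding R by simp
    finally show ?thesis unfolding ch_tilde_B_def flj R_def X_def s_def mult_exp_exp .
  qed
  from part1 part2 show ?thesis by blast
qed

end
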